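(* Let $p$ be a prime, $K$ a field of characteristic $p$ with $[K:K^p]<\infty$, and $S=K[\![x_1,\dots,x_n]\!]$. Let $d$ be a positive integer. Then for every $f\in S$ the ring $S[\![y]\!]/(y^{p^d}+f)$ has finite F-representation type (FFRT).
   Context: For a ring $A$ of characteristic $p$, an $A$-module $M$ and a positive integer $e$, $F_*^e(M)$ is the $A$-module equal to $M$ as an abelian group (the element corresponding to $m$ is written $F_*^e(m)$) with $aF_*^e(m)=F_*^e(a^{p^e}m)$. A Noetherian ring $A$ of prime characteristic $p$ has finite F-representation type (FFRT) if there are finitely generated $A$-modules $M_1,\dots,M_s$ such that for every positive integer $e$ there are nonnegative integers $t_{(e,1)},\dots,t_{(e,s)}$ with $F_*^e(A)\cong\bigoplus_{j=1}^s M_j^{\oplus t_{(e,j)}}$ as $A$-modules. Here $y$ is a new variable over $S$. *)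

theory Defs
  imports "HOL-Algebra.Algebra" "HOL-Computational_Algebra.Primes"
begin

section \<open>Formal power series rings\<close>

text \<open>
  \<open>power_series_ring R I\<close> is the ring of formal power series over \<open>R\<close> in the variables indexed by
  the finite set \<open>I\<close>. As in \<^theory>\<open>HOL-Algebra.Indexed_Polynomials\<close>, a monomial is the multiset of
  the variables occurring in it, and a series is the function giving the coefficient of each
  monomial; coefficients at monomials involving a letter outside \<open>I\<close> are zero.
\<close>

definition power_series_ring :: "('a, 'b) ring_scheme \<Rightarrow> 'i set \<Rightarrow> ('i multiset \<Rightarrow> 'a) ring" where
  "power_series_ring R I =
    \<lparr> carrier = {f. (\<forall>m. f m \<in> carrier R) \<and> (\<forall>m. \<not> set_mset m \<subseteq> I \<longrightarrow> f m = \<zero>\<^bsub>R\<^esub>)},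
      monoid.mult = (\<lambda>f g m. \<Oplus>\<^bsub>R\<^esub>k\<in>{k. k \<subseteq># m}. f k \<otimes>\<^bsub>R\<^esub> g (m - k)),
      one = (\<lambda>m. if m = {#} then \<one>\<^bsub>R\<^esub> else \<zero>\<^bsub>R\<^esub>),
      ring.zero = (\<lambda>m. \<zero>\<^bsub>R\<^esub>),
      ring.add = (\<lambda>f g m. f m \<oplus>\<^bsub>R\<^esub> g m) \<rparr>"

definition ps_const :: "('a, 'b) ring_scheme \<Rightarrow> 'a \<Rightarrow> ('i multiset \<Rightarrow> 'a)" where
  "ps_const R a = (\<lambda>m. if m = {#} then a else \<zero>\<^bsub>R\<^esub>)"

definition ps_var :: "('a, 'b) ring_scheme \<Rightarrow> 'i \<Rightarrow> ('i multiset \<Rightarrow> 'a)" where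
  "ps_var R i = (\<lambda>m. if m = {#i#} then \<one>\<^bsub>R\<^esub> else \<zero>\<^bsub>R\<^esub>)"


section \<open>Modules\<close>

definition module_isomorphic ::
    "('a, 'b) ring_scheme \<Rightarrow> ('a, 'm, 'c) module_scheme \<Rightarrow> ('a, 'n, 'd) module_scheme \<Rightarrow> bool" where
  "module_isomorphic R M N \<longleftrightarrow>
    (\<exists>h. bij_betw h (carrier M) (carrier N) \<and>
         (\<forall>x\<in>carrier M. \<forall>y\<in>carrier M. h (x \<oplus>\<^bsub>M\<^esub> y) = h x \<oplus>\<^bsub>N\<^esub> h y) \<and>
         (\<forall>a\<in>carrier R. \<forall>x\<in>carrier M. h (a \<odot>\<^bsub>M\<^esub> x) = a \<odot>\<^bsub>N\<^esub> h x))"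

definition finitely_generated_module ::
    "('a, 'b) ring_scheme \<Rightarrow> ('a, 'm, 'c) module_scheme \<Rightarrow> bool" where
  "finitely_generated_module R M \<longleftrightarrow> module R M \<and>
    (\<exists>B. finite B \<and> B \<subseteq> carrier M \<and>
         (\<forall>m\<in>carrier M. \<exists>c\<in>B \<rightarrow> carrier R. m = (\<Oplus>\<^bsub>M\<^esub>x\<in>B. c x \<odot>\<^bsub>M\<^esub> x)))"

text \<open>The fields \<open>mult\<close> and \<open>one\<close> of a module record play no role in module theory.\<close>

definition direct_sum_module ::
    "'i set \<Rightarrow> ('i \<Rightarrow> ('a, 'm, 'c) module_scheme) \<Rightarrow> ('a, 'i \<Rightarrow> 'm) module" where
  "direct_sum_module I M =
    \<lparr> carrier = {x \<in> (\<Pi>\<^sub>E i\<in>I. carrier (M i)). finite {i \<in> I. x i \<noteq> \<zero>\<^bsub>M i\<^esub>}},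
      monoid.mult = undefined,
      one = undefined,
      ring.zero = (\<lambda>i\<in>I. \<zero>\<^bsub>M i\<^esub>),
      ring.add = (\<lambda>x y. \<lambda>i\<in>I. x i \<oplus>\<^bsub>M i\<^esub> y i),
      smult = (\<lambda>a x. \<lambda>i\<in>I. a \<odot>\<^bsub>M i\<^esub> x i) \<rparr>"

definition regular_module :: "('a, 'b) ring_scheme \<Rightarrow> ('a, 'a) module" where
  "regular_module R =
    \<lparr> carrier = carrier R, monoid.mult = monoid.mult R, one = one R,
      ring.zero = ring.zero R, ring.add = ring.add R, smult = monoid.mult R \<rparr>"

definition frobenius_pushforward ::
    "nat \<Rightarrow> nat \<Rightarrow> ('a, 'b) ring_scheme \<Rightarrow> ('a, 'm) module \<Rightarrow> ('a, 'm) module" where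
  "frobenius_pushforward p e R M = M\<lparr> smult := (\<lambda>a m. (a [^]\<^bsub>R\<^esub> (p ^ e)) \<odot>\<^bsub>M\<^esub> m) \<rparr>"


section \<open>Finite F-representation type\<close>

definition has_characteristic :: "('a, 'b) ring_scheme \<Rightarrow> nat \<Rightarrow> bool" where
  "has_characteristic R p \<longleftrightarrow> (\<forall>n::nat. [n] \<cdot>\<^bsub>R\<^esub> \<one>\<^bsub>R\<^esub> = \<zero>\<^bsub>R\<^esub> \<longleftrightarrow> p dvd n)"

text \<open>
  The zero ring counts as a ring of characteristic \<open>p\<close> (that is, an \<open>\<bbbF>\<^sub>p\<close>-algebra) here. This matters
  since a quotient \<open>S[[y]]/(y\<^sup>q + f)\<close> vanishes when \<open>f\<close> is a unit.

  The quantification over finitely generated modules ranges over modules with elements of type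
  \<^typ>\<open>(nat \<Rightarrow> 'a) set\<close>, as the quotients of the free modules of finite rank have. This is no
  restriction: see \<open>finitely_generated_module_representative\<close> below.
\<close>

definition has_FFRT :: "nat \<Rightarrow> ('a, 'b) ring_scheme \<Rightarrow> bool" where
  "has_FFRT p A \<longleftrightarrow>
    Factorial_Ring.prime p \<and> cring A \<and> noetherian_ring A \<and>
    (has_characteristic A p \<or> carrier A = {\<zero>\<^bsub>A\<^esub>}) \<and>
    (\<exists>(s::nat) (M :: nat \<Rightarrow> ('a, (nat \<Rightarrow> 'a) set) module).
       (\<forall>j<s. finitely_generated_module A (M j)) \<and>
       (\<forall>e>0. \<exists>t :: nat \<Rightarrow> nat.
          module_isomorphic A
            (frobenius_pushforward p e A (regular_module A))
            (direct_sum_module (SIGMA j:{..<s}. {..<t j}) (\<lambda>(j, i). M j))))"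

lemma finitely_generated_module_transport:
  fixes M :: "('a, 'm, 'c) module_scheme" and h :: "'m \<Rightarrow> 'n"
  assumes M: "finitely_generated_module R M" and inj: "inj_on h (carrier M)"
  shows "\<exists>N :: ('a, 'n) module. finitely_generated_module R N \<and> module_isomorphic R M N"
proof -
  interpret module R M using M by (simp add: finitely_generated_module_def)
  define g where "g = the_inv_into (carrier M) h"
  define N :: "('a, 'n) module" where
    "N = \<lparr> carrier = h ` carrier M, monoid.mult = undefined, one = undefined, ring.zero = h \<zero>\<^bsub>M\<^esub>,
        ring.add = (\<lambda>x y. h (g x \<oplus>\<^bsub>M\<^esub> g y)), smult = (\<lambda>a x. h (a \<odot>\<^bsub>M\<^esub> g x)) \<rparr>"
  have g: "g (h x) = x" if "x \<in> carrier M" for x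
    using that inj by (simp add: g_def the_inv_into_f_f)
  have "module R N"
  proof (rule moduleI)
    show "abelian_group N"
    proof (rule abelian_groupI)
      fix x assume "x \<in> carrier N"
      then obtain u where u: "u \<in> carrier M" "x = h u" by (auto simp: N_def)
      then show "\<exists>y\<in>carrier N. y \<oplus>\<^bsub>N\<^esub> x = \<zero>\<^bsub>N\<^esub>"
        by (intro bexI[of _ "h (\<ominus>\<^bsub>M\<^esub> u)"]) (auto simp: N_def g M.l_neg)
    qed (auto simp: N_def g M.a_ac)
  qed (auto simp: N_def g smult_l_distr smult_r_distr smult_assoc1 R.is_cring)
  then interpret N: module R N .
  have h_sum: "h (\<Oplus>\<^bsub>M\<^esub>x\<in>B. F x) = (\<Oplus>\<^bsub>N\<^esub>x\<in>B. h (F x))"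
    if "finite B" "F \<in> B \<rightarrow> carrier M" for B :: "'m set" and F
    using that
  proof (induction B rule: finite_induct)
    case empty
    have "h \<zero>\<^bsub>M\<^esub> = \<zero>\<^bsub>N\<^esub>" by (simp add: N_def)
    then show ?case by simp
  next
    case (insert y B)
    have F: "F \<in> B \<rightarrow> carrier M" "F y \<in> carrier M" using insert by auto
    then have hF: "(\<lambda>x. h (F x)) \<in> B \<rightarrow> carrier N" "h (F y) \<in> carrier N"
      by (auto simp: N_def)
    have "h (F y \<oplus>\<^bsub>M\<^esub> (\<Oplus>\<^bsub>M\<^esub>x\<in>B. F x)) = h (F y) \<oplus>\<^bsub>N\<^esub> h (\<Oplus>\<^bsub>M\<^esub>x\<in>B. F x)"
      using F by (simp add: N_def g)
    then show ?case
      using insert F hF by (simp add: M.finsum_insert N.finsum_insert)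
  qed
  obtain B where B: "finite B" "B \<subseteq> carrier M"
    and gen: "\<And>m. m \<in> carrier M \<Longrightarrow> \<exists>c\<in>B \<rightarrow> carrier R. m = (\<Oplus>\<^bsub>M\<^esub>x\<in>B. c x \<odot>\<^bsub>M\<^esub> x)"
    using M unfolding finitely_generated_module_def by blast
  have "\<exists>c\<in>h ` B \<rightarrow> carrier R. m = (\<Oplus>\<^bsub>N\<^esub>x\<in>h ` B. c x \<odot>\<^bsub>N\<^esub> x)" if m: "m \<in> carrier N" for m
  proof -
    obtain u where u: "u \<in> carrier M" "m = h u" using m by (auto simp: N_def)
    obtain c where c: "c \<in> B \<rightarrow> carrier R" "u = (\<Oplus>\<^bsub>M\<^esub>x\<in>B. c x \<odot>\<^bsub>M\<^esub> x)"
      using gen[OF u(1)] by blast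
    have gB: "g (h x) = x" if "x \<in> B" for x using that B g by blast
    have inj': "inj_on h B" using inj B(2) inj_on_subset by blast
    have cB: "(\<lambda>x. c x \<odot>\<^bsub>M\<^esub> x) \<in> B \<rightarrow> carrier M" using c B by auto
    have cg: "(\<lambda>x. c (g x)) \<in> h ` B \<rightarrow> carrier R" using c gB by auto
    have hc: "(\<lambda>x. c (g x) \<odot>\<^bsub>N\<^esub> x) \<in> h ` B \<rightarrow> carrier N"
      using cB by (auto simp: N_def gB)
    have "m = (\<Oplus>\<^bsub>N\<^esub>x\<in>B. h (c x \<odot>\<^bsub>M\<^esub> x))"
      unfolding u c(2) by (rule h_sum[OF B(1) cB])
    also have "\<dots> = (\<Oplus>\<^bsub>N\<^esub>x\<in>B. c (g (h x)) \<odot>\<^bsub>N\<^esub> h x)"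
      using hc by (intro N.finsum_cong') (auto simp: N_def gB)
    also have "\<dots> = (\<Oplus>\<^bsub>N\<^esub>x\<in>h ` B. c (g x) \<odot>\<^bsub>N\<^esub> x)"
      using N.finsum_reindex[OF hc inj'] by simp
    finally show ?thesis using cg by (intro bexI[of _ "\<lambda>x. c (g x)"]) auto
  qed
  moreover have "finite (h ` B)" "h ` B \<subseteq> carrier N"
    using B by (auto simp: N_def)
  ultimately have "finitely_generated_module R N"
    unfolding finitely_generated_module_def using \<open>module R N\<close> by blast
  moreover have "module_isomorphic R M N"
    unfolding module_isomorphic_def
    by (intro exI[of _ h]) (auto simp: N_def g inj bij_betw_def)
  ultimately show ?thesis by blast
qed

lemma finitely_generated_module_representative:
  fixes R :: "('a, 'b) ring_scheme" and M :: "('a, 'm, 'c) module_scheme"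
  assumes M: "finitely_generated_module R M"
  shows "\<exists>N :: ('a, (nat \<Rightarrow> 'a) set) module.
           finitely_generated_module R N \<and> module_isomorphic R M N"
proof -
  interpret module R M using M by (simp add: finitely_generated_module_def)
  obtain B where B: "finite B" "B \<subseteq> carrier M"
    and gen: "\<And>m. m \<in> carrier M \<Longrightarrow> \<exists>c\<in>B \<rightarrow> carrier R. m = (\<Oplus>\<^bsub>M\<^esub>x\<in>B. c x \<odot>\<^bsub>M\<^esub> x)"
    using M unfolding finitely_generated_module_def by blast
  obtain k :: "'m \<Rightarrow> nat" where k: "inj_on k B"
    using finite_imp_inj_to_nat_seg[OF B(1)] by blast
  define h :: "'m \<Rightarrow> (nat \<Rightarrow> 'a) set" where
    "h m = {v. (\<forall>x\<in>B. v (k x) \<in> carrier R) \<and> m = (\<Oplus>\<^bsub>M\<^esub>x\<in>B. v (k x) \<odot>\<^bsub>M\<^esub> x)}" for m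
  have "h m \<noteq> {}" if m: "m \<in> carrier M" for m
  proof -
    obtain c where c: "c \<in> B \<rightarrow> carrier R" "m = (\<Oplus>\<^bsub>M\<^esub>x\<in>B. c x \<odot>\<^bsub>M\<^esub> x)"
      using gen[OF m] by blast
    have "m = (\<Oplus>\<^bsub>M\<^esub>x\<in>B. c (the_inv_into B k (k x)) \<odot>\<^bsub>M\<^esub> x)"
      unfolding c(2) using c(1) B
      by (intro M.finsum_cong') (auto simp: the_inv_into_f_f[OF k] Pi_iff subset_iff)
    then have "(\<lambda>i. c (the_inv_into B k i)) \<in> h m"
      using c(1) by (auto simp: h_def the_inv_into_f_f[OF k])
    then show ?thesis by blast
  qed
  then have "inj_on h (carrier M)"
    by (intro inj_onI) (auto simp: h_def; blast)
  then show ?thesis by (rule finitely_generated_module_transport[OF M])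
qed

end

theory Submission
  imports Defs
begin

text \<open>
  Put \<open>q = p\<^sup>d\<close> and let \<open>S\<close> be any Noetherian ring in which \<open>p = 0\<close> and which is free of finite
  rank over itself through the Frobenius map; say that \<open>S\<close> has a Frobenius basis. Write
  \<open>g = y + f\<close> and \<open>h = y\<^sup>q + f\<close>, so that \<open>h = g(y\<^sup>q)\<close>, and let \<open>A = S[[y]]/(h)\<close>, \<open>B = S[[y]]/(g)\<close>.
  For every such \<open>S\<close> and every \<open>f \<in> S\<close> the ring \<open>A\<close> has FFRT.

  For \<open>t \<in> S[[y]]\<close> let \<open>\<psi>\<^sub>Q(t)\<close> be the series obtained by raising every coefficient to the power
  \<open>Q\<close>. When \<open>Q\<close> is a power of \<open>p\<close> one has \<open>t\<^sup>Q = \<psi>\<^sub>Q(t)(y\<^sup>Q)\<close> (lemma \<open>pow_q_series\<close>). So the \<open>q\<close>-th power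
  map has its image in \<open>S[[y\<^sup>q]]\<close>, over which \<open>S[[y]]\<close> is free on \<open>1, y, \<dots>, y\<^bsup>q-1\<^esup>\<close>. Since \<open>h\<close> lies in
  \<open>S[[y\<^sup>q]]\<close> and corresponds to \<open>g\<close> in \<open>S[[y]]\<close>, the ring \<open>A\<close> consists of \<open>q\<close> copies of \<open>B\<close>, and \<open>\<psi>\<^sub>q\<close>
  induces a ring homomorphism \<open>A \<rightarrow> B\<close>. Let \<open>N\<close> be \<open>B\<close> as an \<open>A\<close>-module through this homomorphism.

  For \<open>e = d + j\<close> an element \<open>a \<in> A\<close> acts on \<open>F\<^sup>e\<^sub>*(A)\<close> by multiplying each of the \<open>q\<close> copies of \<open>B\<close> by
  the \<open>p\<^sup>j\<close>-th power of the image of \<open>a\<close> in \<open>B\<close>. It remains to see that \<open>B\<close> is free over itself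
  through the \<open>j\<close>-th iterate of Frobenius, of the same rank \<open>r\<close> as \<open>S\<close>; then \<open>F\<^sup>e\<^sub>*(A) \<cong> N\<^bsup>qr\<^esup>\<close>.
  This is clear when evaluation at \<open>y = -f\<close> makes sense and identifies \<open>B\<close> with \<open>S\<close>. In general put
  \<open>L = p\<^sup>j\<close>. Replacing \<open>y\<^bsup>Ln+k\<^esup>\<close> by \<open>(-f)\<^sup>k y\<^sup>n\<close> for \<open>k < L\<close> gives an additive map from \<open>S[[y]]\<close> to
  itself that turns multiplication by \<open>w(y\<^sup>L)\<close> into multiplication by \<open>w\<close>. It carries the multiples
  of \<open>g\<close> to multiples of \<open>y - (-f)\<^sup>L = \<psi>\<^sub>L(g)\<close>, and the coordinates with respect to a Frobenius basis
  of \<open>S\<close>, taken coefficientwise, carry those to multiples of \<open>g\<close> again (lemma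
  \<open>linear_factor_dvd_iff\<close>). The resulting decomposition is \<open>pushforward_coordinates\<close>. The module \<open>N\<close>
  and the modules \<open>F\<^sup>e\<^sub>*(A)\<close> with \<open>0 < e < d\<close> thus suffice, and all of them are finitely generated
  because \<open>S\<close> has a Frobenius basis.

  Finally the hypotheses on \<open>S\<close> hold for an F-finite field and survive the adjunction of a power
  series variable: the Noetherian property by the analogue of Hilbert's basis theorem
  (\<open>noetherian_power_series\<close>), and a Frobenius basis \<open>b\<^sub>i\<close> of \<open>S\<close> gives the Frobenius basis
  \<open>b\<^sub>i y\<^sup>k\<close>, \<open>k < p\<close>, of \<open>S[[y]]\<close> (\<open>frobenius_basis_series\<close>). So they hold for power series rings in
  finitely many variables over \<open>K\<close> by adding the variables one at a time.
\<close>

section \<open>Finite sums\<close>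

lemma (in abelian_monoid) finsum_Sigma:
  assumes "finite A" and "\<And>x. x \<in> A \<Longrightarrow> finite (B x)"
    and "\<And>x y. x \<in> A \<Longrightarrow> y \<in> B x \<Longrightarrow> g x y \<in> carrier G"
  shows "(\<Oplus>x\<in>A. \<Oplus>y\<in>B x. g x y) = (\<Oplus>z\<in>Sigma A B. g (fst z) (snd z))"
  using assms
proof (induction A rule: finite_induct)
  case (insert a A)
  have split: "Sigma (insert a A) B = Pair a ` B a \<union> Sigma A B" by auto
  have "(\<Oplus>z\<in>Sigma (insert a A) B. g (fst z) (snd z))
      = (\<Oplus>z\<in>Pair a ` B a. g (fst z) (snd z)) \<oplus> (\<Oplus>z\<in>Sigma A B. g (fst z) (snd z))"
    unfolding split using insert by (intro finsum_Un_disjoint) auto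
  also have "(\<Oplus>z\<in>Pair a ` B a. g (fst z) (snd z)) = (\<Oplus>y\<in>B a. g a y)"
    using insert by (subst finsum_reindex) (auto simp: inj_on_def)
  also have "(\<Oplus>z\<in>Sigma A B. g (fst z) (snd z)) = (\<Oplus>x\<in>A. \<Oplus>y\<in>B x. g x y)"
    using insert by simp
  also have "(\<Oplus>y\<in>B a. g a y) \<oplus> (\<Oplus>x\<in>A. \<Oplus>y\<in>B x. g x y) = (\<Oplus>x\<in>insert a A. \<Oplus>y\<in>B x. g x y)"
    using insert by (subst finsum_insert) (auto intro!: finsum_closed)
  finally show ?case by simp
qed simp

lemma (in abelian_monoid) finsum_product_slice:
  assumes "finite A" "finite B" "k \<in> B" and g: "\<And>x. x \<in> A \<Longrightarrow> g x k \<in> carrier G"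
  shows "(\<Oplus>z\<in>A \<times> B. if snd z = k then g (fst z) (snd z) else \<zero>) = (\<Oplus>x\<in>A. g x k)"
proof -
  have "(\<Oplus>x\<in>A. g x k) = (\<Oplus>z\<in>(\<lambda>x. (x, k)) ` A. g (fst z) (snd z))"
    using g by (subst finsum_reindex) (auto simp: inj_on_def)
  also have "\<dots> = (\<Oplus>z\<in>A \<times> B. if snd z = k then g (fst z) (snd z) else \<zero>)"
    using assms by (intro add.finprod_mono_neutral_cong_left) auto
  finally show ?thesis by simp
qed

section \<open>The Frobenius map\<close>

lemma (in cring) binomial_expansion:
  assumes "a \<in> carrier R" "b \<in> carrier R"
  shows "(a \<oplus> b) [^] (n::nat) = (\<Oplus>k\<in>{..n}. [(n choose k)] \<cdot> (a [^] k \<otimes> b [^] (n - k)))"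
proof (induction n)
  case 0
  then show ?case by simp
next
  case (Suc n)
  note ab[simp] = assms
  define u where "u k = [(n choose k)] \<cdot> (a [^] Suc k \<otimes> b [^] (n - k))" for k
  define v where "v k = [(n choose k)] \<cdot> (a [^] k \<otimes> b [^] (Suc n - k))" for k
  have uv[simp]: "u k \<in> carrier R" "v k \<in> carrier R" for k by (auto simp: u_def v_def)
  have ua: "[(n choose k)] \<cdot> (a [^] k \<otimes> b [^] (n - k)) \<otimes> a = u k" for k
    unfolding u_def by (subst add_pow_ldistr) (auto simp: m_ac)
  have vb: "[(n choose k)] \<cdot> (a [^] k \<otimes> b [^] (n - k)) \<otimes> b = v k" if "k \<le> n" for k
    unfolding v_def using that by (subst add_pow_ldistr) (auto simp: m_ac Suc_diff_le)
  have step: "[(Suc n choose Suc k)] \<cdot> (a [^] Suc k \<otimes> b [^] (Suc n - Suc k)) = u k \<oplus> v (Suc k)" for k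
    unfolding u_def v_def by (simp add: add.nat_pow_mult)
  have "(a \<oplus> b) [^] Suc n
      = (\<Oplus>k\<in>{..n}. [(n choose k)] \<cdot> (a [^] k \<otimes> b [^] (n - k))) \<otimes> (a \<oplus> b)"
    using Suc.IH by simp
  also have "\<dots> = (\<Oplus>k\<in>{..n}. u k) \<oplus> (\<Oplus>k\<in>{..n}. v k)"
    by (simp add: r_distr finsum_ldistr Pi_def ua vb cong: finsum_cong)
  also have "(\<Oplus>k\<in>{..n}. v k) = (\<Oplus>k\<in>{..Suc n}. v k)"
  proof -
    have "v (Suc n) = \<zero>" by (simp add: v_def binomial_eq_0)
    then show ?thesis by (simp add: Pi_def)
  qed
  also have "(\<Oplus>k\<in>{..Suc n}. v k) = (\<Oplus>k\<in>{..n}. v (Suc k)) \<oplus> v 0"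
    by (rule finsum_Suc2) simp
  also have "(\<Oplus>k\<in>{..n}. u k) \<oplus> ((\<Oplus>k\<in>{..n}. v (Suc k)) \<oplus> v 0)
      = (\<Oplus>k\<in>{..n}. u k \<oplus> v (Suc k)) \<oplus> v 0"
    by (simp add: finsum_addf Pi_def a_assoc)
  also have "\<dots> = (\<Oplus>k\<in>{..Suc n}. [(Suc n choose k)] \<cdot> (a [^] k \<otimes> b [^] (Suc n - k)))"
  proof -
    have "v 0 = [(Suc n choose 0)] \<cdot> (a [^] (0::nat) \<otimes> b [^] (Suc n - 0))"
      by (simp add: v_def)
    then show ?thesis by (subst finsum_Suc2) (simp_all only: step, auto)
  qed
  finally show ?case .
qed

text \<open>
  The zero ring is admitted: the condition is that \<open>R\<close> be an \<open>\<bbbF>\<^sub>p\<close>-algebra, which is inherited by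
  every quotient.
\<close>

locale char_p_ring = cring R for R (structure) +
  fixes p :: nat
  assumes prime_p: "Factorial_Ring.prime p"
    and char_p: "[p] \<cdot> \<one> = \<zero>"
begin

lemma p_multiple_zero:
  assumes "a \<in> carrier R" "p dvd n"
  shows "[n] \<cdot> a = \<zero>"
proof -
  obtain m where m: "n = p * m" using assms(2) by (elim dvdE)
  have "[p] \<cdot> a = ([p] \<cdot> \<one>) \<otimes> a" using assms by (subst add_pow_ldistr) auto
  then have "[p] \<cdot> a = \<zero>" using assms by (simp add: char_p)
  then show ?thesis using assms by (simp add: m add.nat_pow_pow[symmetric])
qed

lemma pow_p_add:
  assumes "a \<in> carrier R" "b \<in> carrier R"
  shows "(a \<oplus> b) [^] p = a [^] p \<oplus> b [^] p"
proof -
  have p: "p > 0" using prime_p prime_gt_0_nat by blast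
  then obtain r where r: "p = Suc r" by (cases p) auto
  have "[(p choose k)] \<cdot> (a [^] k \<otimes> b [^] (p - k)) = \<zero>" if "k \<in> {..p} - {0, p}" for k
    using that assms prime_p by (intro p_multiple_zero dvd_choose_prime) auto
  then have "(\<Oplus>k\<in>{..p}. [(p choose k)] \<cdot> (a [^] k \<otimes> b [^] (p - k)))
      = (\<Oplus>k\<in>{0, p}. [(p choose k)] \<cdot> (a [^] k \<otimes> b [^] (p - k)))"
    using assms by (intro add.finprod_mono_neutral_cong_right) auto
  also have "\<dots> = b [^] p \<oplus> a [^] p"
    using assms p by (subst finsum_insert) auto
  finally show ?thesis using assms by (simp add: binomial_expansion a_comm)
qed

lemma pow_q_add:
  assumes "a \<in> carrier R" "b \<in> carrier R"
  shows "(a \<oplus> b) [^] (p ^ e) = a [^] (p ^ e) \<oplus> b [^] (p ^ e)"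
proof (induction e)
  case 0
  then show ?case using assms by simp
next
  case (Suc e)
  have *: "x [^] (p ^ Suc e) = (x [^] (p ^ e)) [^] p" if "x \<in> carrier R" for x
    using that by (simp add: nat_pow_pow mult.commute)
  show ?case using assms Suc by (simp add: * pow_p_add del: power_Suc)
qed

lemma q_pos: "p ^ e > 0"
  using prime_p by (simp add: prime_gt_0_nat)

lemma frobenius_hom: "(\<lambda>a. a [^] (p ^ e)) \<in> ring_hom R R"
  by (rule ring_hom_memI) (auto simp: pow_q_add nat_pow_distrib)

lemma frobenius_ring_hom_cring: "ring_hom_cring R R (\<lambda>a. a [^] (p ^ e))"
  by (intro ring_hom_cring.intro ring_hom_cring_axioms.intro is_cring frobenius_hom)

lemma pow_q_finsum:
  assumes "u \<in> I \<rightarrow> carrier R"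
  shows "(\<Oplus>i\<in>I. u i) [^] (p ^ e) = (\<Oplus>i\<in>I. u i [^] (p ^ e))"
  using ring_hom_cring.hom_finsum[OF frobenius_ring_hom_cring assms] by (simp add: o_def)

end

section \<open>Power series rings\<close>

lemma finite_submultisets: "finite {k. k \<subseteq># m}"
proof (induction m)
  case (add x m)
  have "k \<in> {k. k \<subseteq># m} \<union> add_mset x ` {k. k \<subseteq># m}" if k: "k \<subseteq># add_mset x m" for k
  proof (cases "x \<in># k")
    case True
    then obtain k' where "k = add_mset x k'" by (blast dest: multi_member_split)
    with k show ?thesis by simp
  next
    case False
    have "k - {#x#} \<subseteq># m" using k by (simp add: subset_eq_diff_conv)
    with False show ?thesis by (simp add: diff_single_trivial)
  qed
  then have "{k. k \<subseteq># add_mset x m} \<subseteq> {k. k \<subseteq># m} \<union> add_mset x ` {k. k \<subseteq># m}" by blast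
  then show ?case using add.IH by (meson finite_UnI finite_imageI finite_subset)
qed simp

lemma submultiset_diff_diff: "k \<subseteq># m \<Longrightarrow> m - (m - k) = k"
  by (auto simp: multiset_eq_iff subseteq_mset_def)

lemma power_series_carrier:
  "f \<in> carrier (power_series_ring R I) \<longleftrightarrow>
    (\<forall>m. f m \<in> carrier R) \<and> (\<forall>m. \<not> set_mset m \<subseteq> I \<longrightarrow> f m = \<zero>\<^bsub>R\<^esub>)"
  by (simp add: power_series_ring_def)

lemma power_series_add [simp]: "(f \<oplus>\<^bsub>power_series_ring R I\<^esub> g) m = f m \<oplus>\<^bsub>R\<^esub> g m"
  by (simp add: power_series_ring_def)

lemma power_series_zero [simp]: "\<zero>\<^bsub>power_series_ring R I\<^esub> m = \<zero>\<^bsub>R\<^esub>"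
  by (simp add: power_series_ring_def)

lemma power_series_one:
  "\<one>\<^bsub>power_series_ring R I\<^esub> = (\<lambda>m. if m = {#} then \<one>\<^bsub>R\<^esub> else \<zero>\<^bsub>R\<^esub>)"
  by (simp add: power_series_ring_def)

lemma power_series_mult:
  "(f \<otimes>\<^bsub>power_series_ring R I\<^esub> g) m = (\<Oplus>\<^bsub>R\<^esub>k\<in>{k. k \<subseteq># m}. f k \<otimes>\<^bsub>R\<^esub> g (m - k))"
  by (simp add: power_series_ring_def)

lemma power_series_coeff_closed:
  "f \<in> carrier (power_series_ring R I) \<Longrightarrow> f m \<in> carrier R"
  by (simp add: power_series_carrier)

lemma (in cring) power_series_mult_closed:
  fixes I :: "'i set"
  assumes f: "f \<in> carrier (power_series_ring R I)" and g: "g \<in> carrier (power_series_ring R I)"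
  shows "f \<otimes>\<^bsub>power_series_ring R I\<^esub> g \<in> carrier (power_series_ring R I)"
proof -
  have "f k \<otimes> g (m - k) = \<zero>" if "k \<subseteq># m" "\<not> set_mset m \<subseteq> I" for k m
  proof -
    have "m = k + (m - k)" using that(1) by simp
    then have "set_mset m = set_mset k \<union> set_mset (m - k)" by (metis set_mset_union)
    then have "\<not> set_mset k \<subseteq> I \<or> \<not> set_mset (m - k) \<subseteq> I" using that(2) by blast
    then have "f k = \<zero> \<or> g (m - k) = \<zero>" using f g by (auto simp: power_series_carrier)
    then show ?thesis
      using f g power_series_coeff_closed[of _ R I] by auto
  qed
  then show ?thesis
    using f g
    by (auto simp: power_series_carrier power_series_mult intro!: finsum_closed add.finprod_one_eqI)
qed

lemma (in cring) power_series_mult_comm: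
  fixes I :: "'i set"
  assumes f: "f \<in> carrier (power_series_ring R I)" and g: "g \<in> carrier (power_series_ring R I)"
  shows "f \<otimes>\<^bsub>power_series_ring R I\<^esub> g = g \<otimes>\<^bsub>power_series_ring R I\<^esub> f"
proof
  fix m :: "'i multiset"
  note [simp] = power_series_coeff_closed[OF f] power_series_coeff_closed[OF g]
  have im: "(\<lambda>k. m - k) ` {k. k \<subseteq># m} = {k. k \<subseteq># m}"
  proof (intro equalityI subsetI)
    fix k assume "k \<in> {k. k \<subseteq># m}"
    then have "k = m - (m - k)" "m - k \<in> {k. k \<subseteq># m}"
      using submultiset_diff_diff[of k m] diff_subset_eq_self by (metis mem_Collect_eq)+
    then show "k \<in> (\<lambda>k. m - k) ` {k. k \<subseteq># m}" by (rule image_eqI)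
  next
    fix k assume "k \<in> (\<lambda>k. m - k) ` {k. k \<subseteq># m}"
    then obtain j where "k = m - j" by blast
    then show "k \<in> {k. k \<subseteq># m}" by (metis diff_subset_eq_self mem_Collect_eq)
  qed
  have inj: "inj_on (\<lambda>k. m - k) {k. k \<subseteq># m}"
    by (metis (no_types, lifting) inj_on_inverseI mem_Collect_eq submultiset_diff_diff)
  have "(\<Oplus>k\<in>(\<lambda>k. m - k) ` {k. k \<subseteq># m}. f k \<otimes> g (m - k))
      = (\<Oplus>k\<in>{k. k \<subseteq># m}. f (m - k) \<otimes> g (m - (m - k)))"
    using finsum_reindex[of "\<lambda>k. f k \<otimes> g (m - k)", OF _ inj] by auto
  also have "\<dots> = (\<Oplus>k\<in>{k. k \<subseteq># m}. g k \<otimes> f (m - k))"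
    by (rule finsum_cong') (auto simp: m_comm submultiset_diff_diff)
  finally show "(f \<otimes>\<^bsub>power_series_ring R I\<^esub> g) m = (g \<otimes>\<^bsub>power_series_ring R I\<^esub> f) m"
    by (simp add: power_series_mult im)
qed

text \<open>
  Both bracketings sum \<open>f(l) g(j) h(m - l - j)\<close>: one over the chains \<open>l \<subseteq> k \<subseteq> m\<close> with \<open>k = l + j\<close>,
  the other directly over the pairs \<open>(l, j)\<close>.
\<close>

lemma (in cring) power_series_mult_assoc:
  fixes I :: "'i set"
  assumes f: "f \<in> carrier (power_series_ring R I)" and g: "g \<in> carrier (power_series_ring R I)"
    and h: "h \<in> carrier (power_series_ring R I)"
  shows "(f \<otimes>\<^bsub>power_series_ring R I\<^esub> g) \<otimes>\<^bsub>power_series_ring R I\<^esub> h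
    = f \<otimes>\<^bsub>power_series_ring R I\<^esub> (g \<otimes>\<^bsub>power_series_ring R I\<^esub> h)"
proof
  fix m :: "'i multiset"
  note [simp] = power_series_coeff_closed[OF f] power_series_coeff_closed[OF g]
    power_series_coeff_closed[OF h] finite_submultisets
  let ?L = "SIGMA k:{k. k \<subseteq># m}. {l. l \<subseteq># k}"
  let ?R = "SIGMA l:{l. l \<subseteq># m}. {j. j \<subseteq># m - l}"
  let ?\<phi> = "\<lambda>z. (fst z + snd z, fst z)"
  have inj: "inj_on ?\<phi> ?R" by (auto simp: inj_on_def)
  have sub: "l + j \<subseteq># m" if "l \<subseteq># m" "j \<subseteq># m - l" for l j
  proof -
    have "l + j \<subseteq># l + (m - l)" using that(2) by simp
    then show ?thesis by (simp only: subset_mset.add_diff_inverse[OF that(1)])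
  qed
  have im: "?\<phi> ` ?R = ?L"
  proof
    show "?\<phi> ` ?R \<subseteq> ?L" by (auto intro: sub)
    show "?L \<subseteq> ?\<phi> ` ?R"
    proof
      fix z assume "z \<in> ?L"
      then obtain k l where z: "z = (k, l)" "k \<subseteq># m" "l \<subseteq># k" by auto
      then have "l \<subseteq># m" by (meson subset_mset.order_trans)
      moreover from this have "k - l \<subseteq># m - l"
        using z(2) by (simp only: subset_eq_diff_conv subset_mset.diff_add)
      ultimately have 1: "(l, k - l) \<in> ?R" and 2: "?\<phi> (l, k - l) = z"
        using z by (simp_all add: subset_mset.add_diff_inverse)
      show "z \<in> ?\<phi> ` ?R" by (rule image_eqI[where f = ?\<phi>, OF 2[symmetric] 1])
    qed
  qed
  have "((f \<otimes>\<^bsub>power_series_ring R I\<^esub> g) \<otimes>\<^bsub>power_series_ring R I\<^esub> h) m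
      = (\<Oplus>k\<in>{k. k \<subseteq># m}. \<Oplus>l\<in>{l. l \<subseteq># k}. f l \<otimes> g (k - l) \<otimes> h (m - k))"
    by (simp add: power_series_mult finsum_ldistr Pi_def)
  also have "\<dots> = (\<Oplus>z\<in>?L. f (snd z) \<otimes> g (fst z - snd z) \<otimes> h (m - fst z))"
    by (rule finsum_Sigma) auto
  also have "\<dots> = (\<Oplus>z\<in>?R. f (fst z) \<otimes> g (fst z + snd z - fst z) \<otimes> h (m - (fst z + snd z)))"
    unfolding im[symmetric] by (subst finsum_reindex[OF _ inj]) auto
  also have "\<dots> = (\<Oplus>z\<in>?R. f (fst z) \<otimes> (g (snd z) \<otimes> h (m - fst z - snd z)))"
    by (rule finsum_cong') (auto simp: m_assoc)
  also have "\<dots> = (\<Oplus>l\<in>{l. l \<subseteq># m}. \<Oplus>j\<in>{j. j \<subseteq># m - l}. f l \<otimes> (g j \<otimes> h (m - l - j)))"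
    by (rule finsum_Sigma[symmetric]) auto
  also have "\<dots> = (f \<otimes>\<^bsub>power_series_ring R I\<^esub> (g \<otimes>\<^bsub>power_series_ring R I\<^esub> h)) m"
    by (simp add: power_series_mult finsum_rdistr Pi_def)
  finally show "((f \<otimes>\<^bsub>power_series_ring R I\<^esub> g) \<otimes>\<^bsub>power_series_ring R I\<^esub> h) m
    = (f \<otimes>\<^bsub>power_series_ring R I\<^esub> (g \<otimes>\<^bsub>power_series_ring R I\<^esub> h)) m" .
qed

lemma (in cring) power_series_cring:
  fixes I :: "'i set"
  shows "cring (power_series_ring R I)"
proof (rule cringI)
  let ?P = "power_series_ring R I"
  note [simp] = finite_submultisets
  show "abelian_group ?P"
  proof (rule abelian_groupI)
    fix f assume f: "f \<in> carrier ?P"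
    have "(\<lambda>m. \<ominus> f m) \<in> carrier ?P" using f by (auto simp: power_series_carrier)
    moreover have "(\<lambda>m. \<ominus> f m) \<oplus>\<^bsub>?P\<^esub> f = \<zero>\<^bsub>?P\<^esub>"
      using f by (auto simp: power_series_carrier l_neg)
    ultimately show "\<exists>g\<in>carrier ?P. g \<oplus>\<^bsub>?P\<^esub> f = \<zero>\<^bsub>?P\<^esub>" by blast
  qed (auto simp: power_series_carrier a_ac fun_eq_iff)
  have one: "\<one>\<^bsub>?P\<^esub> \<in> carrier ?P" by (auto simp: power_series_carrier power_series_one)
  show "comm_monoid ?P"
  proof (rule comm_monoidI)
    fix f assume f: "f \<in> carrier ?P"
    show "\<one>\<^bsub>?P\<^esub> \<otimes>\<^bsub>?P\<^esub> f = f"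
    proof
      fix m :: "'i multiset"
      have "(\<Oplus>k\<in>{k. k \<subseteq># m}. (if k = {#} then \<one> else \<zero>) \<otimes> f (m - k))
          = (\<Oplus>k\<in>{k. k \<subseteq># m}. if k = {#} then f (m - k) else \<zero>)"
        by (rule finsum_cong') (auto simp: power_series_coeff_closed[OF f])
      also have "\<dots> = f (m - {#})"
        by (rule add.finprod_singleton_swap) (auto simp: power_series_coeff_closed[OF f])
      finally show "(\<one>\<^bsub>?P\<^esub> \<otimes>\<^bsub>?P\<^esub> f) m = f m" by (simp add: power_series_mult power_series_one)
    qed
  qed (auto simp: one power_series_mult_closed power_series_mult_assoc intro: power_series_mult_comm)
  fix f g h assume fgh: "f \<in> carrier ?P" "g \<in> carrier ?P" "h \<in> carrier ?P"
  note [simp] = fgh[THEN power_series_coeff_closed]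
  show "(f \<oplus>\<^bsub>?P\<^esub> g) \<otimes>\<^bsub>?P\<^esub> h = f \<otimes>\<^bsub>?P\<^esub> h \<oplus>\<^bsub>?P\<^esub> g \<otimes>\<^bsub>?P\<^esub> h"
    by (rule ext) (simp add: power_series_mult l_distr finsum_addf Pi_def)
qed

lemma (in cring) power_series_finsum:
  assumes "u \<in> A \<rightarrow> carrier (power_series_ring R I)"
  shows "(\<Oplus>\<^bsub>power_series_ring R I\<^esub>i\<in>A. u i) m = (\<Oplus>i\<in>A. u i m)"
proof -
  interpret P: cring "power_series_ring R I" by (rule power_series_cring)
  show ?thesis using assms
  proof (induction A rule: infinite_finite_induct)
    case (insert a A)
    then have "u a \<in> carrier (power_series_ring R I)" "u \<in> A \<rightarrow> carrier (power_series_ring R I)"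
      by auto
    moreover have "u a m \<in> carrier R" "(\<lambda>i. u i m) \<in> A \<rightarrow> carrier R"
      using calculation by (simp_all add: power_series_carrier Pi_iff)
    ultimately show ?case using insert by simp
  qed auto
qed

lemma (in cring) power_series_minus:
  assumes "f \<in> carrier (power_series_ring R I)"
  shows "(\<ominus>\<^bsub>power_series_ring R I\<^esub> f) m = \<ominus> f m"
proof -
  interpret P: cring "power_series_ring R I" by (rule power_series_cring)
  have "(\<ominus>\<^bsub>power_series_ring R I\<^esub> f \<oplus>\<^bsub>power_series_ring R I\<^esub> f) m = \<zero>"
    using assms by (subst P.l_neg) auto
  then show ?thesis
    using assms power_series_coeff_closed[OF assms] power_series_coeff_closed[OF P.a_inv_closed[OF assms]]
    by (simp add: minus_equality)
qed

section \<open>Power series in one variable\<close>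

text \<open>
  A multiset over the one-element type is determined by its size, so that a series in the variable
  \<open>()\<close> is a sequence of coefficients; \<open>ps_coeff\<close> and \<open>ps_seq\<close> translate between the two views.
\<close>

definition ps_coeff :: "(unit multiset \<Rightarrow> 'a) \<Rightarrow> nat \<Rightarrow> 'a" where
  "ps_coeff t n = t (replicate_mset n ())"

definition ps_seq :: "(nat \<Rightarrow> 'a) \<Rightarrow> unit multiset \<Rightarrow> 'a" where
  "ps_seq a = (\<lambda>m. a (size m))"

definition coeff_map :: "('a \<Rightarrow> 'b) \<Rightarrow> (unit multiset \<Rightarrow> 'a) \<Rightarrow> unit multiset \<Rightarrow> 'b" where
  "coeff_map \<phi> t = (\<lambda>m. \<phi> (t m))"

lemma unit_multiset: "m = replicate_mset (size m) ()"
  by (induction m) auto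

lemma ps_eqI:
  assumes "\<And>n. ps_coeff t n = ps_coeff u n"
  shows "t = u"
proof
  fix m :: "unit multiset"
  show "t m = u m" using assms[of "size m"] unit_multiset[of m] by (simp add: ps_coeff_def)
qed

lemma ps_coeff_seq [simp]: "ps_coeff (ps_seq a) n = a n"
  by (simp add: ps_coeff_def ps_seq_def)

lemma ps_coeff_cmap [simp]: "ps_coeff (coeff_map \<phi> t) n = \<phi> (ps_coeff t n)"
  by (simp add: ps_coeff_def coeff_map_def)

lemma submultisets_replicate:
  "{k. k \<subseteq># replicate_mset n ()} = (\<lambda>i. replicate_mset i ()) ` {..n}"
proof (intro equalityI subsetI)
  fix k assume "k \<in> {k. k \<subseteq># replicate_mset n ()}"
  then have "size k \<le> n" using size_mset_mono by fastforce
  then show "k \<in> (\<lambda>i. replicate_mset i ()) ` {..n}" using unit_multiset[of k] by blast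
next
  fix k assume "k \<in> (\<lambda>i. replicate_mset i ()) ` {..n}"
  then obtain i where "i \<le> n" "k = replicate_mset i ()" by auto
  then show "k \<in> {k. k \<subseteq># replicate_mset n ()}" by (simp add: subseteq_mset_def)
qed

locale univariate_series = R?: cring R for R (structure) +
  fixes P (structure)
  defines P_def: "P \<equiv> power_series_ring R {()}"
begin

sublocale P?: cring P
  unfolding P_def by (rule R.power_series_cring)

abbreviation const :: "'a \<Rightarrow> unit multiset \<Rightarrow> 'a" where "const \<equiv> ps_const R"

abbreviation Y :: "unit multiset \<Rightarrow> 'a" where "Y \<equiv> ps_var R ()"

lemma carrier_iff: "t \<in> carrier P \<longleftrightarrow> (\<forall>n. ps_coeff t n \<in> carrier R)"
proof -
  have "(\<forall>m. t m \<in> carrier R) \<longleftrightarrow> (\<forall>n. ps_coeff t n \<in> carrier R)"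
    unfolding ps_coeff_def by (metis unit_multiset)
  then show ?thesis by (auto simp: P_def power_series_carrier)
qed

lemma coeff_closed [simp]: "t \<in> carrier P \<Longrightarrow> ps_coeff t n \<in> carrier R"
  by (simp add: carrier_iff)

lemma seq_closed: "(\<And>n. a n \<in> carrier R) \<Longrightarrow> ps_seq a \<in> carrier P"
  by (simp add: carrier_iff)

lemma coeff_map_closed: "t \<in> carrier P \<Longrightarrow> \<phi> \<in> carrier R \<rightarrow> carrier R \<Longrightarrow> coeff_map \<phi> t \<in> carrier P"
  by (auto simp: carrier_iff)

lemma coeff_add [simp]: "ps_coeff (t \<oplus>\<^bsub>P\<^esub> u) n = ps_coeff t n \<oplus> ps_coeff u n"
  by (simp add: ps_coeff_def P_def)

lemma coeff_zero [simp]: "ps_coeff \<zero>\<^bsub>P\<^esub> n = \<zero>"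
  by (simp add: ps_coeff_def P_def)

lemma coeff_one: "ps_coeff \<one>\<^bsub>P\<^esub> n = (if n = 0 then \<one> else \<zero>)"
  by (simp add: ps_coeff_def P_def power_series_one)

lemma coeff_a_inv [simp]: "t \<in> carrier P \<Longrightarrow> ps_coeff (\<ominus>\<^bsub>P\<^esub> t) n = \<ominus> ps_coeff t n"
  unfolding ps_coeff_def P_def by (rule R.power_series_minus)

lemma coeff_minus [simp]:
  "t \<in> carrier P \<Longrightarrow> u \<in> carrier P \<Longrightarrow> ps_coeff (t \<ominus>\<^bsub>P\<^esub> u) n = ps_coeff t n \<ominus> ps_coeff u n"
  by (simp add: a_minus_def)

lemma coeff_finsum:
  "u \<in> A \<rightarrow> carrier P \<Longrightarrow> ps_coeff (\<Oplus>\<^bsub>P\<^esub>i\<in>A. u i) n = (\<Oplus>i\<in>A. ps_coeff (u i) n)"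
  unfolding ps_coeff_def P_def by (rule R.power_series_finsum)

lemma coeff_mult:
  assumes "t \<in> carrier P" "u \<in> carrier P"
  shows "ps_coeff (t \<otimes>\<^bsub>P\<^esub> u) n = (\<Oplus>i\<in>{..n}. ps_coeff t i \<otimes> ps_coeff u (n - i))"
proof -
  have inj: "inj_on (\<lambda>i. replicate_mset i ()) {..n}"
    by (rule inj_on_inverseI[of _ size]) simp
  have closed: "t m \<in> carrier R" "u m \<in> carrier R" for m
    using assms by (simp_all add: P_def power_series_carrier)
  have diff: "replicate_mset n () - replicate_mset i () = replicate_mset (n - i) ()" for i
    by (rule multiset_eqI) simp
  have "ps_coeff (t \<otimes>\<^bsub>P\<^esub> u) n
      = (\<Oplus>k\<in>(\<lambda>i. replicate_mset i ()) ` {..n}. t k \<otimes> u (replicate_mset n () - k))"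
    by (simp add: ps_coeff_def P_def power_series_mult submultisets_replicate)
  also have "\<dots> = (\<Oplus>i\<in>{..n}. t (replicate_mset i ()) \<otimes> u (replicate_mset n () - replicate_mset i ()))"
    by (rule R.finsum_reindex[OF _ inj]) (simp add: closed)
  finally show ?thesis by (simp add: ps_coeff_def diff)
qed

lemma coeff_const: "ps_coeff (const a) n = (if n = 0 then a else \<zero>)"
  by (simp add: ps_coeff_def ps_const_def)

lemma coeff_Y: "ps_coeff Y n = (if n = 1 then \<one> else \<zero>)"
proof -
  have "replicate_mset n () = {#()#} \<longleftrightarrow> n = 1"
    by (metis One_nat_def size_replicate_mset replicate_mset_0 replicate_mset_Suc size_single)
  then show ?thesis by (simp add: ps_coeff_def ps_var_def)
qed

lemma const_closed [simp]: "a \<in> carrier R \<Longrightarrow> const a \<in> carrier P"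
  by (simp add: carrier_iff coeff_const)

lemma Y_closed [simp]: "Y \<in> carrier P"
  by (simp add: carrier_iff coeff_Y)

lemma coeff_const_mult [simp]:
  assumes "a \<in> carrier R" "t \<in> carrier P"
  shows "ps_coeff (const a \<otimes>\<^bsub>P\<^esub> t) n = a \<otimes> ps_coeff t n"
proof -
  have "ps_coeff (const a \<otimes>\<^bsub>P\<^esub> t) n
      = (\<Oplus>i\<in>{..n}. if i = 0 then a \<otimes> ps_coeff t (n - i) else \<zero>)"
    unfolding coeff_mult[OF const_closed[OF assms(1)] assms(2)]
    using assms by (intro R.finsum_cong') (auto simp: coeff_const)
  also have "\<dots> = a \<otimes> ps_coeff t (n - 0)"
    using assms by (intro R.add.finprod_singleton_swap) auto
  finally show ?thesis by simp
qed

lemma coeff_Y_mult: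
  assumes "t \<in> carrier P"
  shows "ps_coeff (Y \<otimes>\<^bsub>P\<^esub> t) n = (if n = 0 then \<zero> else ps_coeff t (n - 1))"
proof (cases n)
  case 0
  then show ?thesis using assms by (simp add: coeff_mult coeff_Y)
next
  case (Suc m)
  have "ps_coeff (Y \<otimes>\<^bsub>P\<^esub> t) n = (\<Oplus>i\<in>{..n}. if i = 1 then ps_coeff t (n - i) else \<zero>)"
    unfolding coeff_mult[OF Y_closed assms]
    using assms by (intro R.finsum_cong') (auto simp: coeff_Y)
  also have "\<dots> = ps_coeff t (n - 1)"
    using assms Suc by (intro R.add.finprod_singleton_swap) auto
  finally show ?thesis using Suc by simp
qed

lemma coeff_Y_pow_mult:
  assumes "t \<in> carrier P"
  shows "ps_coeff (Y [^]\<^bsub>P\<^esub> (k::nat) \<otimes>\<^bsub>P\<^esub> t) n = (if n < k then \<zero> else ps_coeff t (n - k))"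
  using assms
proof (induction k arbitrary: t)
  case (Suc k)
  have "Y [^]\<^bsub>P\<^esub> Suc k \<otimes>\<^bsub>P\<^esub> t = Y [^]\<^bsub>P\<^esub> k \<otimes>\<^bsub>P\<^esub> (Y \<otimes>\<^bsub>P\<^esub> t)"
    using Suc.prems by (simp add: P.m_assoc)
  then show ?case using Suc by (simp add: coeff_Y_mult)
qed simp

lemma coeff_Y_pow: "ps_coeff (Y [^]\<^bsub>P\<^esub> (k::nat)) n = (if n = k then \<one> else \<zero>)"
  using coeff_Y_pow_mult[OF P.one_closed, of k n] by (auto simp: coeff_one)

lemma const_add: "const (a \<oplus> b) = const a \<oplus>\<^bsub>P\<^esub> const b" if "a \<in> carrier R" "b \<in> carrier R"
  by (rule ps_eqI) (simp add: coeff_const)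

lemma const_hom: "const \<in> ring_hom R P"
  by (rule ring_hom_memI)
    (auto simp: const_add coeff_const coeff_one intro!: ps_eqI)

sublocale const: ring_hom_cring R P const
  by (intro ring_hom_cring.intro ring_hom_cring_axioms.intro const_hom R.is_cring P.is_cring)

lemma const_pow: "a \<in> carrier R \<Longrightarrow> const (a [^] (n::nat)) = const a [^]\<^bsub>P\<^esub> n"
  by (induction n) auto

lemma coeff_add_pow: "t \<in> carrier P \<Longrightarrow> ps_coeff ([(n::nat)] \<cdot>\<^bsub>P\<^esub> t) k = [n] \<cdot>\<^bsub>R\<^esub> ps_coeff t k"
  by (induction n) auto

lemma coeff_map_hom:
  assumes "\<phi> \<in> ring_hom R R"
  shows "coeff_map \<phi> \<in> ring_hom P P"
proof -
  interpret \<phi>: ring_hom_cring R R \<phi>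
    by (intro ring_hom_cring.intro ring_hom_cring_axioms.intro assms R.is_cring)
  show ?thesis
  proof (rule ring_hom_memI)
    fix t u assume "t \<in> carrier P" "u \<in> carrier P"
    then show "coeff_map \<phi> (t \<otimes>\<^bsub>P\<^esub> u) = coeff_map \<phi> t \<otimes>\<^bsub>P\<^esub> coeff_map \<phi> u"
      by (intro ps_eqI) (simp add: coeff_mult coeff_map_closed Pi_def o_def)
  qed (auto simp: coeff_map_closed coeff_one intro!: ps_eqI)
qed

end

section \<open>Substituting powers of the variable and decimation\<close>

context univariate_series
begin

text \<open>
  \<open>stretch Q w\<close> is \<open>w(Y\<^sup>Q)\<close>, and \<open>decim Q k t\<close> is the series \<open>t\<^sub>k\<close> in the unique decomposition
  \<open>t = \<Sum>\<^sub>k Y\<^sup>k t\<^sub>k(Y\<^sup>Q)\<close> with \<open>k < Q\<close>. Together they exhibit \<open>R[[Y]]\<close> as a free module over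
  \<open>R[[Y\<^sup>Q]]\<close>; equalities of series are checked below by comparing all decimations.
\<close>

definition stretch :: "nat \<Rightarrow> (unit multiset \<Rightarrow> 'a) \<Rightarrow> unit multiset \<Rightarrow> 'a" where
  "stretch Q w = ps_seq (\<lambda>n. if Q dvd n then ps_coeff w (n div Q) else \<zero>)"

definition decim :: "nat \<Rightarrow> nat \<Rightarrow> (unit multiset \<Rightarrow> 'a) \<Rightarrow> unit multiset \<Rightarrow> 'a" where
  "decim Q k t = ps_seq (\<lambda>n. ps_coeff t (Q * n + k))"

lemma coeff_stretch:
  "ps_coeff (stretch Q w) n = (if Q dvd n then ps_coeff w (n div Q) else \<zero>)"
  by (simp add: stretch_def)

lemma coeff_decim: "ps_coeff (decim Q k t) n = ps_coeff t (Q * n + k)"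
  by (simp add: decim_def)

lemma stretch_closed [simp]: "w \<in> carrier P \<Longrightarrow> stretch Q w \<in> carrier P"
  by (simp add: carrier_iff coeff_stretch)

lemma decim_closed [simp]: "t \<in> carrier P \<Longrightarrow> decim Q k t \<in> carrier P"
  by (simp add: carrier_iff coeff_decim)

lemma decim_add:
  "decim Q k (t \<oplus>\<^bsub>P\<^esub> u) = decim Q k t \<oplus>\<^bsub>P\<^esub> decim Q k u"
  by (rule ps_eqI) (simp add: coeff_decim)

lemma decim_const_mult:
  "a \<in> carrier R \<Longrightarrow> t \<in> carrier P \<Longrightarrow> decim Q k (const a \<otimes>\<^bsub>P\<^esub> t) = const a \<otimes>\<^bsub>P\<^esub> decim Q k t"
  by (rule ps_eqI) (simp add: coeff_decim)

lemma decim_finsum: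
  assumes "u \<in> A \<rightarrow> carrier P"
  shows "decim Q k (\<Oplus>\<^bsub>P\<^esub>i\<in>A. u i) = (\<Oplus>\<^bsub>P\<^esub>i\<in>A. decim Q k (u i))"
  using assms by (intro ps_eqI) (simp add: coeff_decim coeff_finsum Pi_def)

lemma decim_Y_mult:
  assumes "t \<in> carrier P"
  shows "decim Q (Suc k) (Y \<otimes>\<^bsub>P\<^esub> t) = decim Q k t"
  using assms by (intro ps_eqI) (simp add: coeff_decim coeff_Y_mult)

lemma decim_Y_mult_0:
  assumes "t \<in> carrier P" "Q > 0"
  shows "decim Q 0 (Y \<otimes>\<^bsub>P\<^esub> t) = Y \<otimes>\<^bsub>P\<^esub> decim Q (Q - 1) t"
proof (rule ps_eqI)
  fix n
  show "ps_coeff (decim Q 0 (Y \<otimes>\<^bsub>P\<^esub> t)) n = ps_coeff (Y \<otimes>\<^bsub>P\<^esub> decim Q (Q - 1) t) n"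
  proof (cases "n = 0")
    case False
    then obtain m where "n = Suc m" by (cases n) auto
    then have "Q * n - 1 = Q * (n - 1) + (Q - 1)" using assms(2) by simp
    then show ?thesis using assms False by (simp add: coeff_decim coeff_Y_mult)
  qed (simp add: coeff_decim coeff_Y_mult assms(1))
qed

lemma decim_eqI:
  assumes "Q > 0" and "\<And>k. k < Q \<Longrightarrow> decim Q k t = decim Q k u"
  shows "t = u"
proof (rule ps_eqI)
  fix n
  have "ps_coeff (decim Q (n mod Q) t) (n div Q) = ps_coeff (decim Q (n mod Q) u) (n div Q)"
    by (simp only: assms(2)[OF mod_less_divisor[OF assms(1)]])
  then show "ps_coeff t n = ps_coeff u n" by (simp add: coeff_decim)
qed

text \<open>
  Only the indices \<open>Q j\<close> contribute to a coefficient of \<open>w(Y\<^sup>Q) t\<close>, and at \<open>Q n + k\<close> they leave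
  the convolution of \<open>w\<close> with the coefficients of \<open>t\<close> at indices congruent to \<open>k\<close>.
\<close>

lemma decim_stretch_mult:
  assumes Q: "Q > 0" "k < Q" and w: "w \<in> carrier P" and t: "t \<in> carrier P"
  shows "decim Q k (stretch Q w \<otimes>\<^bsub>P\<^esub> t) = w \<otimes>\<^bsub>P\<^esub> decim Q k t"
proof (rule ps_eqI)
  fix n
  have bound: "j \<le> n" if "Q * j \<le> Q * n + k" for j
  proof (rule ccontr)
    assume "\<not> j \<le> n"
    then have "Q * Suc n \<le> Q * j" by (intro mult_le_mono2) simp
    with that Q show False by simp
  qed
  have "ps_coeff (w \<otimes>\<^bsub>P\<^esub> decim Q k t) n
      = (\<Oplus>j\<in>{..n}. ps_coeff w j \<otimes> ps_coeff t (Q * (n - j) + k))"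
    using w t by (simp add: coeff_mult coeff_decim)
  also have "\<dots> = (\<Oplus>j\<in>{..n}. ps_coeff (stretch Q w) (Q * j) \<otimes> ps_coeff t (Q * n + k - Q * j))"
    using w t Q by (intro R.finsum_cong') (auto simp: coeff_stretch diff_mult_distrib2)
  also have "\<dots> = (\<Oplus>i\<in>(\<lambda>j. Q * j) ` {..n}. ps_coeff (stretch Q w) i \<otimes> ps_coeff t (Q * n + k - i))"
    using w t Q by (subst R.finsum_reindex) (auto simp: inj_on_def)
  also have "\<dots> = (\<Oplus>i\<in>{..Q * n + k}. ps_coeff (stretch Q w) i \<otimes> ps_coeff t (Q * n + k - i))"
  proof (rule R.add.finprod_mono_neutral_cong_left)
    show "(\<lambda>j. Q * j) ` {..n} \<subseteq> {..Q * n + k}" by (auto intro: trans_le_add1)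
    fix i assume "i \<in> {..Q * n + k} - (\<lambda>j. Q * j) ` {..n}"
    then have "\<not> Q dvd i" using bound by (auto elim!: dvdE)
    then show "ps_coeff (stretch Q w) i \<otimes> ps_coeff t (Q * n + k - i) = \<zero>"
      using t by (simp add: coeff_stretch)
  qed (use w t in auto)
  finally show "ps_coeff (decim Q k (stretch Q w \<otimes>\<^bsub>P\<^esub> t)) n = ps_coeff (w \<otimes>\<^bsub>P\<^esub> decim Q k t) n"
    using w t by (simp add: coeff_decim coeff_mult)
qed

lemma decim_Y_pow:
  assumes "j < Q" "k < Q"
  shows "decim Q k (Y [^]\<^bsub>P\<^esub> j) = (if j = k then \<one>\<^bsub>P\<^esub> else \<zero>\<^bsub>P\<^esub>)"
proof (rule ps_eqI)
  fix n
  have "Q * n + k = j \<longleftrightarrow> n = 0 \<and> j = k" using assms by (cases n) auto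
  then show "ps_coeff (decim Q k (Y [^]\<^bsub>P\<^esub> j)) n = ps_coeff (if j = k then \<one>\<^bsub>P\<^esub> else \<zero>\<^bsub>P\<^esub>) n"
    by (auto simp: coeff_decim coeff_Y_pow coeff_one)
qed

lemma decim_stretch_Y_pow:
  assumes "j < Q" "k < Q" "w \<in> carrier P"
  shows "decim Q k (stretch Q w \<otimes>\<^bsub>P\<^esub> Y [^]\<^bsub>P\<^esub> j) = (if j = k then w else \<zero>\<^bsub>P\<^esub>)"
  using assms by (subst decim_stretch_mult) (auto simp: decim_Y_pow)

lemma decim_sum_Y_pow:
  assumes "k < Q" and w: "\<And>j. j < Q \<Longrightarrow> w j \<in> carrier P"
  shows "decim Q k (\<Oplus>\<^bsub>P\<^esub>j\<in>{..<Q}. stretch Q (w j) \<otimes>\<^bsub>P\<^esub> Y [^]\<^bsub>P\<^esub> j) = w k"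
proof -
  have "decim Q k (\<Oplus>\<^bsub>P\<^esub>j\<in>{..<Q}. stretch Q (w j) \<otimes>\<^bsub>P\<^esub> Y [^]\<^bsub>P\<^esub> j)
      = (\<Oplus>\<^bsub>P\<^esub>j\<in>{..<Q}. decim Q k (stretch Q (w j) \<otimes>\<^bsub>P\<^esub> Y [^]\<^bsub>P\<^esub> j))"
    using w by (intro decim_finsum) auto
  also have "\<dots> = (\<Oplus>\<^bsub>P\<^esub>j\<in>{..<Q}. if j = k then w j else \<zero>\<^bsub>P\<^esub>)"
    using assms by (intro P.finsum_cong') (auto simp: decim_stretch_Y_pow)
  also have "\<dots> = w k"
    using assms by (intro P.add.finprod_singleton_swap) auto
  finally show ?thesis .
qed

lemma decim_expansion:
  assumes "Q > 0" and t: "t \<in> carrier P"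
  shows "t = (\<Oplus>\<^bsub>P\<^esub>k\<in>{..<Q}. stretch Q (decim Q k t) \<otimes>\<^bsub>P\<^esub> Y [^]\<^bsub>P\<^esub> k)"
  by (rule decim_eqI[OF assms(1)]) (subst decim_sum_Y_pow, use t in auto)

lemma coeff_stretch_monomial:
  assumes "Q > 0" and "\<And>n. ps_coeff w n = (if n = j then a else \<zero>)"
  shows "ps_coeff (stretch Q w) n = (if n = Q * j then a else \<zero>)"
proof (cases "Q dvd n")
  case True
  then obtain i where "n = Q * i" by (rule dvdE)
  then show ?thesis using assms by (simp add: coeff_stretch)
next
  case False
  then have "n \<noteq> Q * j" by (metis dvd_triv_left)
  then show ?thesis using False by (simp add: coeff_stretch)
qed

lemma stretch_one: "stretch Q \<one>\<^bsub>P\<^esub> = \<one>\<^bsub>P\<^esub>" if "Q > 0"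
  by (rule ps_eqI) (simp only: coeff_stretch_monomial[OF that coeff_one], simp add: coeff_one)

lemma stretch_add: "stretch Q (t \<oplus>\<^bsub>P\<^esub> u) = stretch Q t \<oplus>\<^bsub>P\<^esub> stretch Q u"
  by (rule ps_eqI) (simp add: coeff_stretch)

lemma decim_stretch:
  assumes "k < Q" "w \<in> carrier P"
  shows "decim Q k (stretch Q w) = (if k = 0 then w else \<zero>\<^bsub>P\<^esub>)"
  using decim_stretch_Y_pow[of 0 Q k w] assms by auto

lemma stretch_mult:
  assumes "Q > 0" and w: "w \<in> carrier P" and v: "v \<in> carrier P"
  shows "stretch Q (w \<otimes>\<^bsub>P\<^esub> v) = stretch Q w \<otimes>\<^bsub>P\<^esub> stretch Q v"
proof (rule decim_eqI[OF assms(1)])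
  fix k assume k: "k < Q"
  have "decim Q k (stretch Q w \<otimes>\<^bsub>P\<^esub> stretch Q v) = w \<otimes>\<^bsub>P\<^esub> decim Q k (stretch Q v)"
    using assms k by (intro decim_stretch_mult) auto
  also have "\<dots> = decim Q k (stretch Q (w \<otimes>\<^bsub>P\<^esub> v))"
    using w v by (simp add: decim_stretch[OF k])
  finally show "decim Q k (stretch Q (w \<otimes>\<^bsub>P\<^esub> v)) = decim Q k (stretch Q w \<otimes>\<^bsub>P\<^esub> stretch Q v)"
    by simp
qed

lemma stretch_hom: "Q > 0 \<Longrightarrow> stretch Q \<in> ring_hom P P"
  by (rule ring_hom_memI) (auto simp: stretch_one stretch_add stretch_mult)

lemma stretch_const: "Q > 0 \<Longrightarrow> stretch Q (const a) = const a"
  by (rule ps_eqI) (simp only: coeff_stretch_monomial[OF _ coeff_const], simp add: coeff_const)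

lemma stretch_Y: "Q > 0 \<Longrightarrow> stretch Q Y = Y [^]\<^bsub>P\<^esub> Q"
  by (rule ps_eqI) (simp only: coeff_stretch_monomial[OF _ coeff_Y], simp add: coeff_Y_pow)

lemma stretch_stretch:
  "stretch Q (stretch Q' w) = stretch (Q * Q') w" if "Q > 0" "Q' > 0"
proof (rule ps_eqI)
  fix n
  have "Q * Q' dvd n \<longleftrightarrow> Q dvd n \<and> Q' dvd n div Q"
  proof (cases "Q dvd n")
    case True
    have "Q' dvd n div Q \<longleftrightarrow> Q' * Q dvd n"
      by (rule dvd_div_iff_mult) (use that True in auto)
    with True show ?thesis by (simp only: mult.commute[of Q Q'] simp_thms)
  next
    case False
    then have "\<not> Q * Q' dvd n" by (metis dvd_mult_left)
    with False show ?thesis by simp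
  qed
  then show "ps_coeff (stretch Q (stretch Q' w)) n = ps_coeff (stretch (Q * Q') w) n"
    by (simp add: coeff_stretch div_mult2_eq)
qed

lemma head_tail:
  assumes "t \<in> carrier P"
  shows "t = const (ps_coeff t 0) \<oplus>\<^bsub>P\<^esub> Y \<otimes>\<^bsub>P\<^esub> ps_seq (\<lambda>n. ps_coeff t (Suc n))"
  using assms
  by (intro ps_eqI) (auto simp: coeff_const coeff_Y_mult seq_closed)

end

locale univariate_char_p = univariate_series R P + char_p_ring R p
  for R (structure) and P (structure) and p
begin

sublocale PC: char_p_ring P p
proof (intro char_p_ring.intro char_p_ring_axioms.intro P.is_cring prime_p)
  show "[p] \<cdot>\<^bsub>P\<^esub> \<one>\<^bsub>P\<^esub> = \<zero>\<^bsub>P\<^esub>"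
  proof (rule ps_eqI)
    fix k
    have "ps_coeff ([p] \<cdot>\<^bsub>P\<^esub> \<one>\<^bsub>P\<^esub>) k = [p] \<cdot>\<^bsub>R\<^esub> ps_coeff \<one>\<^bsub>P\<^esub> k"
      by (rule coeff_add_pow[OF P.one_closed])
    also have "\<dots> = \<zero>"
      by (rule p_multiple_zero[OF coeff_closed[OF P.one_closed] dvd_refl])
    finally show "ps_coeff ([p] \<cdot>\<^bsub>P\<^esub> \<one>\<^bsub>P\<^esub>) k = ps_coeff \<zero>\<^bsub>P\<^esub> k"
      by (simp only: coeff_zero)
  qed
qed

abbreviation cpow :: "nat \<Rightarrow> (unit multiset \<Rightarrow> 'a) \<Rightarrow> unit multiset \<Rightarrow> 'a" where
  "cpow Q \<equiv> coeff_map (\<lambda>a. a [^] Q)"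

text \<open>
  Split off the constant term, \<open>t = t\<^sub>0 + Y s\<close>. As powers with exponent \<open>Q = p\<^sup>e\<close> are additive,
  \<open>t\<^sup>Q = t\<^sub>0\<^sup>Q + Y\<^sup>Q s\<^sup>Q\<close>, so that the coefficient of \<open>t\<^sup>Q\<close> at \<open>n \<ge> Q\<close> is the one of \<open>s\<^sup>Q\<close> at
  \<open>n - Q\<close>. Induction on \<open>n\<close> thus needs no limit of polynomials.
\<close>

lemma pow_q_series:
  assumes "t \<in> carrier P"
  shows "t [^]\<^bsub>P\<^esub> (p ^ e) = stretch (p ^ e) (cpow (p ^ e) t)"
proof (rule ps_eqI)
  fix n
  define Q where "Q = p ^ e"
  have Q: "Q > 0" unfolding Q_def by (rule q_pos)
  show "ps_coeff (t [^]\<^bsub>P\<^esub> Q) n = ps_coeff (stretch Q (cpow Q t)) n"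
    using assms
  proof (induction n arbitrary: t rule: less_induct)
    case (less n)
    define s where "s = ps_seq (\<lambda>n. ps_coeff t (Suc n))"
    have s: "s \<in> carrier P" using less.prems by (simp add: s_def seq_closed)
    have "t [^]\<^bsub>P\<^esub> Q = (const (ps_coeff t 0) \<oplus>\<^bsub>P\<^esub> Y \<otimes>\<^bsub>P\<^esub> s) [^]\<^bsub>P\<^esub> Q"
      by (simp only: head_tail[OF less.prems, folded s_def, symmetric])
    also have "\<dots> = const (ps_coeff t 0 [^] Q) \<oplus>\<^bsub>P\<^esub> Y [^]\<^bsub>P\<^esub> Q \<otimes>\<^bsub>P\<^esub> s [^]\<^bsub>P\<^esub> Q"
      using less.prems s by (simp add: Q_def PC.pow_q_add P.nat_pow_distrib const_pow)
    finally have *: "ps_coeff (t [^]\<^bsub>P\<^esub> Q) n =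
        (if n = 0 then ps_coeff t 0 [^] Q else \<zero>)
          \<oplus> (if n < Q then \<zero> else ps_coeff (s [^]\<^bsub>P\<^esub> Q) (n - Q))"
      using s by (simp add: coeff_const coeff_Y_pow_mult)
    show ?case
    proof (cases "n < Q")
      case True
      then have "Q dvd n \<longleftrightarrow> n = 0" by (auto dest: nat_dvd_not_less)
      then show ?thesis using True less.prems by (simp add: * coeff_stretch)
    next
      case False
      then have "ps_coeff (s [^]\<^bsub>P\<^esub> Q) (n - Q) = ps_coeff (stretch Q (cpow Q s)) (n - Q)"
        using less.IH[OF _ s] Q by simp
      moreover have "Q dvd n - Q \<longleftrightarrow> Q dvd n" "Suc ((n - Q) div Q) = n div Q"
      proof -
        obtain m where "n = m + Q" using False by (metis le_add_diff_inverse2 not_less)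
        then show "Q dvd n - Q \<longleftrightarrow> Q dvd n" "Suc ((n - Q) div Q) = n div Q" using Q by simp_all
      qed
      ultimately show ?thesis
        using False Q s less.prems by (auto simp: * coeff_stretch s_def R.nat_pow_zero)
    qed
  qed
qed

lemma cpow_closed [simp]: "t \<in> carrier P \<Longrightarrow> cpow Q t \<in> carrier P"
  by (rule coeff_map_closed) auto

lemma cpow_hom: "cpow (p ^ e) \<in> ring_hom P P"
  by (rule coeff_map_hom[OF frobenius_hom])

lemma cpow_cpow: "t \<in> carrier P \<Longrightarrow> cpow Q (cpow Q' t) = cpow (Q' * Q) t"
  by (rule ps_eqI) (simp add: R.nat_pow_pow)

lemma cpow_const: "a \<in> carrier R \<Longrightarrow> Q > 0 \<Longrightarrow> cpow Q (const a) = const (a [^] Q)"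
  by (rule ps_eqI) (simp only: ps_coeff_cmap coeff_const, simp add: R.nat_pow_zero)

lemma cpow_Y: "Q > 0 \<Longrightarrow> cpow Q Y = Y"
  by (rule ps_eqI) (simp add: coeff_Y R.nat_pow_zero)

end

section \<open>Generators of modules and ideals\<close>

definition linear_span ::
    "('a, 'b) ring_scheme \<Rightarrow> ('a, 'm, 'c) module_scheme \<Rightarrow> 'm set \<Rightarrow> 'm set" where
  "linear_span R M B = {(\<Oplus>\<^bsub>M\<^esub>x\<in>B. c x \<odot>\<^bsub>M\<^esub> x) | c. c \<in> B \<rightarrow> carrier R}"

lemma linear_spanI:
  assumes "c \<in> B \<rightarrow> carrier R" "x = (\<Oplus>\<^bsub>M\<^esub>z\<in>B. c z \<odot>\<^bsub>M\<^esub> z)"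
  shows "x \<in> linear_span R M B"
  using assms by (auto simp: linear_span_def)

context module
begin

lemma linear_span_add:
  assumes "B \<subseteq> carrier M" "x \<in> linear_span R M B" "y \<in> linear_span R M B"
  shows "x \<oplus>\<^bsub>M\<^esub> y \<in> linear_span R M B"
proof -
  obtain c where c: "c \<in> B \<rightarrow> carrier R" "x = (\<Oplus>\<^bsub>M\<^esub>z\<in>B. c z \<odot>\<^bsub>M\<^esub> z)"
    using assms(2) by (auto simp: linear_span_def)
  obtain d where d: "d \<in> B \<rightarrow> carrier R" "y = (\<Oplus>\<^bsub>M\<^esub>z\<in>B. d z \<odot>\<^bsub>M\<^esub> z)"
    using assms(3) by (auto simp: linear_span_def)
  have closed: "(\<lambda>z. c z \<odot>\<^bsub>M\<^esub> z) \<in> B \<rightarrow> carrier M" "(\<lambda>z. d z \<odot>\<^bsub>M\<^esub> z) \<in> B \<rightarrow> carrier M"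
    using assms(1) c(1) d(1) by (auto simp: Pi_iff subset_iff)
  have "x \<oplus>\<^bsub>M\<^esub> y = (\<Oplus>\<^bsub>M\<^esub>z\<in>B. c z \<odot>\<^bsub>M\<^esub> z \<oplus>\<^bsub>M\<^esub> d z \<odot>\<^bsub>M\<^esub> z)"
    unfolding c(2) d(2) by (rule M.finsum_addf[OF closed, symmetric])
  also have "\<dots> = (\<Oplus>\<^bsub>M\<^esub>z\<in>B. (c z \<oplus> d z) \<odot>\<^bsub>M\<^esub> z)"
    using assms(1) c(1) d(1)
    by (intro M.finsum_cong') (auto simp: smult_l_distr Pi_iff subset_iff)
  finally show ?thesis by (rule linear_spanI[rotated]) (use c(1) d(1) in auto)
qed

lemma linear_span_smult:
  assumes "finite B" "B \<subseteq> carrier M" "a \<in> carrier R" "x \<in> linear_span R M B"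
  shows "a \<odot>\<^bsub>M\<^esub> x \<in> linear_span R M B"
proof -
  obtain c where c: "c \<in> B \<rightarrow> carrier R" "x = (\<Oplus>\<^bsub>M\<^esub>z\<in>B. c z \<odot>\<^bsub>M\<^esub> z)"
    using assms(4) by (auto simp: linear_span_def)
  have closed: "(\<lambda>z. c z \<odot>\<^bsub>M\<^esub> z) \<in> B \<rightarrow> carrier M"
    using assms(2) c(1) by (auto simp: Pi_iff subset_iff)
  have "a \<odot>\<^bsub>M\<^esub> x = (\<Oplus>\<^bsub>M\<^esub>z\<in>B. a \<odot>\<^bsub>M\<^esub> (c z \<odot>\<^bsub>M\<^esub> z))"
    unfolding c(2) by (rule finsum_smult_ldistr[OF assms(1,3)]) (use closed in auto)
  also have "\<dots> = (\<Oplus>\<^bsub>M\<^esub>z\<in>B. (a \<otimes> c z) \<odot>\<^bsub>M\<^esub> z)"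
    using assms c(1)
    by (intro M.finsum_cong') (auto simp: smult_assoc1 Pi_iff subset_iff)
  finally show ?thesis by (rule linear_spanI[rotated]) (use c(1) assms(3) in auto)
qed

lemma linear_span_superset:
  assumes "finite B" "B \<subseteq> carrier M" "x \<in> B"
  shows "x \<in> linear_span R M B"
proof -
  have "(\<Oplus>\<^bsub>M\<^esub>z\<in>B. (if z = x then \<one> else \<zero>) \<odot>\<^bsub>M\<^esub> z) = (\<Oplus>\<^bsub>M\<^esub>z\<in>B. if z = x then z else \<zero>\<^bsub>M\<^esub>)"
    using assms by (intro M.finsum_cong') auto
  also have "\<dots> = x"
    using assms by (intro M.add.finprod_singleton_swap) auto
  finally have "x = (\<Oplus>\<^bsub>M\<^esub>z\<in>B. (if z = x then \<one> else \<zero>) \<odot>\<^bsub>M\<^esub> z)" by simp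
  moreover have "(\<lambda>z. if z = x then \<one> else \<zero>) \<in> B \<rightarrow> carrier R" by simp
  ultimately show ?thesis by (intro linear_spanI)
qed

lemma linear_span_zero:
  assumes "finite B" "B \<subseteq> carrier M"
  shows "\<zero>\<^bsub>M\<^esub> \<in> linear_span R M B"
proof -
  have "(\<Oplus>\<^bsub>M\<^esub>z\<in>B. \<zero> \<odot>\<^bsub>M\<^esub> z) = \<zero>\<^bsub>M\<^esub>"
    using assms by (intro M.add.finprod_one_eqI) auto
  then have "\<zero>\<^bsub>M\<^esub> = (\<Oplus>\<^bsub>M\<^esub>z\<in>B. \<zero> \<odot>\<^bsub>M\<^esub> z)" by simp
  moreover have "(\<lambda>z. \<zero>) \<in> B \<rightarrow> carrier R" by simp
  ultimately show ?thesis by (intro linear_spanI)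
qed

lemma linear_span_finsum:
  assumes "finite B" "B \<subseteq> carrier M" "finite I" "\<And>i. i \<in> I \<Longrightarrow> u i \<in> linear_span R M B"
  shows "(\<Oplus>\<^bsub>M\<^esub>i\<in>I. u i) \<in> linear_span R M B"
proof -
  have sub: "linear_span R M B \<subseteq> carrier M"
    using assms(2) unfolding linear_span_def by (fastforce intro!: M.finsum_closed)
  show ?thesis using assms(3,4)
  proof (induction I rule: finite_induct)
    case (insert i I)
    then have "u i \<in> carrier M" "u \<in> I \<rightarrow> carrier M" using sub by auto
    then show ?case using insert assms by (simp add: linear_span_add)
  qed (simp add: linear_span_zero assms)
qed

text \<open>
  Finite generation is phrased with a set of generators. A family may repeat an element, whose
  coefficients would then have to be added up; closure of the span under sums takes care of that.
\<close>

lemma finitely_generated_by_family: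
  assumes "finite I" "v \<in> I \<rightarrow> carrier M"
    and "\<And>x. x \<in> carrier M \<Longrightarrow> \<exists>c\<in>I \<rightarrow> carrier R. x = (\<Oplus>\<^bsub>M\<^esub>i\<in>I. c i \<odot>\<^bsub>M\<^esub> v i)"
  shows "finitely_generated_module R M"
proof -
  have B: "finite (v ` I)" "v ` I \<subseteq> carrier M" using assms by auto
  have "x \<in> linear_span R M (v ` I)" if x: "x \<in> carrier M" for x
  proof -
    obtain c where c: "c \<in> I \<rightarrow> carrier R" "x = (\<Oplus>\<^bsub>M\<^esub>i\<in>I. c i \<odot>\<^bsub>M\<^esub> v i)"
      using assms(3)[OF x] by blast
    show ?thesis unfolding c(2)
      using c(1) B assms by (intro linear_span_finsum linear_span_smult linear_span_superset) auto
  qed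
  then have "\<forall>x\<in>carrier M. \<exists>c\<in>v ` I \<rightarrow> carrier R. x = (\<Oplus>\<^bsub>M\<^esub>z\<in>v ` I. c z \<odot>\<^bsub>M\<^esub> z)"
    unfolding linear_span_def by blast
  then show ?thesis
    unfolding finitely_generated_module_def using B module_axioms by blast
qed

end

lemma finsum_regular_module [simp]: "finsum (regular_module R) = finsum R"
  by (simp add: finsum_def finprod_def regular_module_def fun_eq_iff)

lemma (in cring) module_regular: "module R (regular_module R)"
proof (rule moduleI)
  show "abelian_group (regular_module R)"
    by (rule abelian_groupI) (auto simp: regular_module_def a_ac intro: add.l_inv_ex)
qed (auto simp: regular_module_def l_distr r_distr m_assoc is_cring)

text \<open>
  The ring is a module over itself, and the span of \<open>A\<close> in it is an ideal that contains \<open>A\<close>.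
\<close>

lemma (in cring) genideal_elements:
  assumes "finite A" "A \<subseteq> carrier R" "x \<in> Idl A"
  shows "\<exists>c\<in>A \<rightarrow> carrier R. x = (\<Oplus>a\<in>A. c a \<otimes> a)"
proof -
  let ?M = "regular_module R"
  interpret M: module R ?M by (rule module_regular)
  have car: "carrier ?M = carrier R" "monoid.mult R = smult ?M" "ring.add ?M = ring.add R"
    by (simp_all add: regular_module_def)
  have A: "A \<subseteq> carrier ?M" using assms(2) by (simp add: car)
  have sub: "linear_span R ?M A \<subseteq> carrier R"
    using assms(2) unfolding linear_span_def car(2)[symmetric] finsum_regular_module
    by (fastforce intro!: finsum_closed)
  have "ideal (linear_span R ?M A) R"
  proof (rule idealI[OF ring_axioms])
    show "subgroup (linear_span R ?M A) (add_monoid R)"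
    proof (rule add.subgroupI)
      show "linear_span R ?M A \<noteq> {}" using M.linear_span_zero[OF assms(1) A] by blast
      fix x y assume x: "x \<in> linear_span R ?M A" and y: "y \<in> linear_span R ?M A"
      show "x \<oplus> y \<in> linear_span R ?M A" using M.linear_span_add[OF A x y] by (simp add: car)
      have "\<ominus> \<one> \<odot>\<^bsub>?M\<^esub> x \<in> linear_span R ?M A"
        by (rule M.linear_span_smult[OF assms(1) A _ x]) simp
      moreover have "\<ominus> \<one> \<odot>\<^bsub>?M\<^esub> x = \<ominus> x"
        using x sub by (auto simp: car(2)[symmetric] l_minus)
      ultimately show "\<ominus> x \<in> linear_span R ?M A" by simp
    qed (use sub in auto)
    fix a x assume a: "a \<in> linear_span R ?M A" and x: "x \<in> carrier R"
    show "x \<otimes> a \<in> linear_span R ?M A"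
      using M.linear_span_smult[OF assms(1) A x a] by (simp add: car)
    then show "a \<otimes> x \<in> linear_span R ?M A"
      using a x sub by (metis m_comm subsetD)
  qed
  moreover have "A \<subseteq> linear_span R ?M A"
    using M.linear_span_superset[OF assms(1) A] by blast
  ultimately have "Idl A \<subseteq> linear_span R ?M A" by (rule genideal_minimal)
  then show ?thesis
    using assms(3) unfolding linear_span_def car(2)[symmetric] finsum_regular_module by blast
qed

lemma (in ideal) finsum_in_ideal:
  assumes "\<And>i. i \<in> A \<Longrightarrow> u i \<in> I"
  shows "(\<Oplus>i\<in>A. u i) \<in> I"
  using assms
proof (induction A rule: infinite_finite_induct)
  case (insert a A)
  then have "u a \<in> carrier R" "u \<in> A \<rightarrow> carrier R" by (auto intro: a_Hcarr)
  then show ?case using insert by simp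
qed (auto simp: finsum_infinite)

lemma noetherian_ring_hom_image:
  fixes R (structure) and S (structure)
  assumes "noetherian_ring R" "ring S" "h \<in> ring_hom R S" and surj: "h ` carrier R = carrier S"
  shows "noetherian_ring S"
proof -
  interpret R: noetherian_ring R by fact
  interpret S: ring S by fact
  interpret h: ring_hom_ring R S h by (rule ring_hom_ringI2[OF R.ring_axioms S.ring_axioms assms(3)])
  show ?thesis
  proof (rule S.noetherian_ringI)
    fix J assume J: "ideal J S"
    have "ideal {r \<in> carrier R. h r \<in> J} R" by (rule h.ideal_vimage[OF J])
    then obtain A where A: "A \<subseteq> carrier R" "finite A" "{r \<in> carrier R. h r \<in> J} = Idl A"
      using R.finetely_gen by blast
    have AJ: "h ` A \<subseteq> J" using R.genideal_self[OF A(1)] A(3) by blast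
    have hA: "h ` A \<subseteq> carrier S" using A(1) surj by blast
    have "Idl A \<subseteq> {r \<in> carrier R. h r \<in> Idl\<^bsub>S\<^esub> (h ` A)}"
      using A(1) S.genideal_self[OF hA]
      by (intro R.genideal_minimal h.ideal_vimage S.genideal_ideal[OF hA]) blast
    moreover have "J \<subseteq> h ` {r \<in> carrier R. h r \<in> J}"
      using ideal.Icarr[OF J] surj by (auto simp: image_iff)
    ultimately have "J \<subseteq> Idl\<^bsub>S\<^esub> (h ` A)" unfolding A(3) by blast
    moreover have "Idl\<^bsub>S\<^esub> (h ` A) \<subseteq> J" by (rule S.genideal_minimal[OF J AJ])
    ultimately show "\<exists>A\<subseteq>carrier S. finite A \<and> J = Idl\<^bsub>S\<^esub> A"
      using A(2) hA by blast
  qed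
qed

section \<open>Noetherian power series rings\<close>

context univariate_series
begin

text \<open>
  As for polynomials, an ideal \<open>J\<close> of \<open>R[[Y]]\<close> is controlled by ideals of \<open>R\<close>, but now the lowest
  coefficients count: \<open>initial_coeffs J n\<close> collects the coefficients at \<open>n\<close> of the members of \<open>J\<close>
  of order at least \<open>n\<close>.
\<close>

definition order_ge :: "(unit multiset \<Rightarrow> 'a) \<Rightarrow> nat \<Rightarrow> bool" where
  "order_ge t n \<longleftrightarrow> (\<forall>i<n. ps_coeff t i = \<zero>)"

definition initial_coeffs :: "(unit multiset \<Rightarrow> 'a) set \<Rightarrow> nat \<Rightarrow> 'a set" where
  "initial_coeffs J n = {ps_coeff t n | t. t \<in> J \<and> order_ge t n}"

lemma initial_coeffs_ideal:
  assumes "ideal J P"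
  shows "ideal (initial_coeffs J n) R"
proof -
  interpret J: ideal J P by fact
  note car = J.Icarr
  show ?thesis
  proof (rule idealI[OF R.ring_axioms])
    show "subgroup (initial_coeffs J n) (add_monoid R)"
    proof (rule R.add.subgroupI)
      show "initial_coeffs J n \<subseteq> carrier R" using car by (auto simp: initial_coeffs_def)
      have "order_ge \<zero>\<^bsub>P\<^esub> n" by (simp add: order_ge_def)
      then show "initial_coeffs J n \<noteq> {}"
        using J.zero_closed unfolding initial_coeffs_def by blast
      fix a b assume "a \<in> initial_coeffs J n" "b \<in> initial_coeffs J n"
      then obtain t u where t: "t \<in> J" "order_ge t n" "a = ps_coeff t n"
        and u: "u \<in> J" "order_ge u n" "b = ps_coeff u n"
        by (auto simp: initial_coeffs_def)
      have "\<ominus>\<^bsub>P\<^esub> t \<in> J" "order_ge (\<ominus>\<^bsub>P\<^esub> t) n" "\<ominus> a = ps_coeff (\<ominus>\<^bsub>P\<^esub> t) n"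
        using t car[OF t(1)] by (auto simp: order_ge_def)
      then show "\<ominus> a \<in> initial_coeffs J n" unfolding initial_coeffs_def by blast
      have "t \<oplus>\<^bsub>P\<^esub> u \<in> J" "order_ge (t \<oplus>\<^bsub>P\<^esub> u) n" "a \<oplus> b = ps_coeff (t \<oplus>\<^bsub>P\<^esub> u) n"
        using t u by (auto simp: order_ge_def)
      then show "a \<oplus> b \<in> initial_coeffs J n" unfolding initial_coeffs_def by blast
    qed
    fix a x assume "a \<in> initial_coeffs J n" and x: "x \<in> carrier R"
    then obtain t where t: "t \<in> J" "order_ge t n" "a = ps_coeff t n"
      by (auto simp: initial_coeffs_def)
    have "const x \<otimes>\<^bsub>P\<^esub> t \<in> J" using t x by (simp add: J.I_l_closed)
    moreover have "order_ge (const x \<otimes>\<^bsub>P\<^esub> t) n" "x \<otimes> a = ps_coeff (const x \<otimes>\<^bsub>P\<^esub> t) n"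
      using t x car[OF t(1)] by (auto simp: order_ge_def)
    ultimately show "x \<otimes> a \<in> initial_coeffs J n" unfolding initial_coeffs_def by blast
    then show "a \<otimes> x \<in> initial_coeffs J n"
      using t x car[OF t(1)] by (simp add: R.m_comm)
  qed
qed

text \<open>
  Multiplication by \<open>Y\<close> shifts the initial coefficient by one place.
\<close>

lemma initial_coeffs_mono:
  assumes "ideal J P" "m \<le> n"
  shows "initial_coeffs J m \<subseteq> initial_coeffs J n"
proof -
  interpret J: ideal J P by fact
  have "initial_coeffs J m \<subseteq> initial_coeffs J (Suc m)" for m
  proof
    fix a assume "a \<in> initial_coeffs J m"
    then obtain t where t: "t \<in> J" "order_ge t m" "a = ps_coeff t m"
      by (auto simp: initial_coeffs_def)
    have "Y \<otimes>\<^bsub>P\<^esub> t \<in> J" using t by (simp add: J.I_l_closed)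
    moreover have "order_ge (Y \<otimes>\<^bsub>P\<^esub> t) (Suc m)" "a = ps_coeff (Y \<otimes>\<^bsub>P\<^esub> t) (Suc m)"
      using t J.Icarr[OF t(1)] by (auto simp: order_ge_def coeff_Y_mult)
    ultimately show "a \<in> initial_coeffs J (Suc m)" unfolding initial_coeffs_def by blast
  qed
  then show ?thesis using assms(2) by (rule lift_Suc_mono_le)
qed

lemma cancel_initial_coeff:
  assumes A: "finite A" "A \<subseteq> carrier R"
    and l: "\<And>a. a \<in> A \<Longrightarrow> l a \<in> carrier P \<and> order_ge (l a) n \<and> ps_coeff (l a) n = a"
    and g: "g \<in> carrier P" "order_ge g (n + m)" "ps_coeff g (n + m) \<in> Idl\<^bsub>R\<^esub> A"
  shows "\<exists>r\<in>A \<rightarrow> carrier R.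
    order_ge (g \<ominus>\<^bsub>P\<^esub> (\<Oplus>\<^bsub>P\<^esub>a\<in>A. (const (r a) \<otimes>\<^bsub>P\<^esub> Y [^]\<^bsub>P\<^esub> m) \<otimes>\<^bsub>P\<^esub> l a)) (Suc (n + m))"
proof -
  obtain r where r: "r \<in> A \<rightarrow> carrier R" "ps_coeff g (n + m) = (\<Oplus>a\<in>A. r a \<otimes> a)"
    using R.genideal_elements[OF A g(3)] by blast
  have rc: "r a \<in> carrier R" "l a \<in> carrier P" if "a \<in> A" for a using that r l by auto
  have coeff: "ps_coeff ((const (r a) \<otimes>\<^bsub>P\<^esub> Y [^]\<^bsub>P\<^esub> m) \<otimes>\<^bsub>P\<^esub> l a) i
      = (if i < m then \<zero> else r a \<otimes> ps_coeff (l a) (i - m))" if "a \<in> A" for a i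
  proof -
    have "(const (r a) \<otimes>\<^bsub>P\<^esub> Y [^]\<^bsub>P\<^esub> m) \<otimes>\<^bsub>P\<^esub> l a = const (r a) \<otimes>\<^bsub>P\<^esub> (Y [^]\<^bsub>P\<^esub> m \<otimes>\<^bsub>P\<^esub> l a)"
      using rc[OF that] by (simp add: P.m_assoc)
    then show ?thesis using rc[OF that] by (simp add: coeff_Y_pow_mult)
  qed
  have closed: "(\<lambda>a. (const (r a) \<otimes>\<^bsub>P\<^esub> Y [^]\<^bsub>P\<^esub> m) \<otimes>\<^bsub>P\<^esub> l a) \<in> A \<rightarrow> carrier P"
    using rc by auto
  let ?s = "\<Oplus>\<^bsub>P\<^esub>a\<in>A. (const (r a) \<otimes>\<^bsub>P\<^esub> Y [^]\<^bsub>P\<^esub> m) \<otimes>\<^bsub>P\<^esub> l a"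
  have "ps_coeff g i \<ominus> ps_coeff ?s i = \<zero>" if i: "i < Suc (n + m)" for i
  proof (cases "i = n + m")
    case True
    have "ps_coeff ?s i = (\<Oplus>a\<in>A. r a \<otimes> a)"
      unfolding coeff_finsum[OF closed] using l rc A(2) True
      by (intro R.finsum_cong') (auto simp: coeff)
    moreover have "(\<Oplus>a\<in>A. r a \<otimes> a) \<in> carrier R"
      using rc A(2) by (intro R.finsum_closed) auto
    ultimately show ?thesis unfolding True by (simp add: r(2))
  next
    case False
    then have i: "i < n + m" using i by simp
    have "ps_coeff ?s i = \<zero>"
      unfolding coeff_finsum[OF closed]
    proof (rule R.add.finprod_one_eqI)
      fix a assume a: "a \<in> A"
      have "ps_coeff (l a) (i - m) = \<zero>" if "\<not> i < m"
        using l[OF a] i that by (auto simp: order_ge_def)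
      then show "ps_coeff ((const (r a) \<otimes>\<^bsub>P\<^esub> Y [^]\<^bsub>P\<^esub> m) \<otimes>\<^bsub>P\<^esub> l a) i = \<zero>"
        using rc[OF a] by (simp add: coeff[OF a])
    qed
    then show ?thesis using g(2) i by (simp add: order_ge_def R.minus_eq)
  qed
  then have "order_ge (g \<ominus>\<^bsub>P\<^esub> ?s) (Suc (n + m))"
    using g(1) P.finsum_closed[OF closed] by (simp add: order_ge_def)
  then show ?thesis using r(1) by blast
qed

lemma coeff_mult_cong:
  assumes "t \<in> carrier P" "t' \<in> carrier P" "u \<in> carrier P"
    and "\<And>i. i \<le> n \<Longrightarrow> ps_coeff t i = ps_coeff t' i"
  shows "ps_coeff (t \<otimes>\<^bsub>P\<^esub> u) n = ps_coeff (t' \<otimes>\<^bsub>P\<^esub> u) n"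
  unfolding coeff_mult[OF assms(1,3)] coeff_mult[OF assms(2,3)]
  using assms by (intro R.finsum_cong') auto

text \<open>
  Cancelling the initial coefficient of \<open>g\<close> again and again changes, at step \<open>m\<close>, the multipliers of
  the generators \<open>l a\<close> by a term of degree \<open>m\<close> only: the generators have order \<open>n\<close>, and once the
  initial ideals have become stationary they can still be used, multiplied by \<open>Y\<^sup>m\<close>, to cancel at
  \<open>n + m\<close>. Hence the multipliers converge coefficientwise.
\<close>

lemma divide_with_stable_initial_coeffs:
  assumes J: "ideal J P" and A: "finite A" "A \<subseteq> carrier R"
    and l: "\<And>a. a \<in> A \<Longrightarrow> l a \<in> J \<and> order_ge (l a) n \<and> ps_coeff (l a) n = a"
    and stable: "\<And>m. initial_coeffs J (n + m) \<subseteq> Idl\<^bsub>R\<^esub> A"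
    and g: "g \<in> J" "order_ge g n"
  shows "\<exists>h\<in>A \<rightarrow> carrier P. g = (\<Oplus>\<^bsub>P\<^esub>a\<in>A. h a \<otimes>\<^bsub>P\<^esub> l a)"
proof -
  interpret J: ideal J P by fact
  have lc: "l a \<in> carrier P" if "a \<in> A" for a using l[OF that] J.Icarr by blast
  have gc: "g \<in> carrier P" using g J.Icarr by blast
  define rest where "rest h = g \<ominus>\<^bsub>P\<^esub> (\<Oplus>\<^bsub>P\<^esub>a\<in>A. h a \<otimes>\<^bsub>P\<^esub> l a)" for h
  have sumJ: "(\<Oplus>\<^bsub>P\<^esub>a\<in>A. h a \<otimes>\<^bsub>P\<^esub> l a) \<in> J" if "h \<in> A \<rightarrow> carrier P" for h
    using that l by (intro J.finsum_in_ideal J.I_l_closed) auto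
  have restJ: "rest h \<in> J" if "h \<in> A \<rightarrow> carrier P" for h
    unfolding rest_def P.minus_eq
    using sumJ[OF that] g by (intro J.a_closed J.a_inv_closed)
  let ?I = "\<lambda>m h. h \<in> A \<rightarrow> carrier P \<and> order_ge (rest h) (n + m)"
  let ?T = "\<lambda>m h h'. \<forall>a\<in>A. \<forall>i<m. ps_coeff (h' a) i = ps_coeff (h a) i"
  have step: "\<exists>h'. ?I (Suc m) h' \<and> ?T m h h'" if h: "?I m h" for m h
  proof -
    have hc: "h a \<in> carrier P" if "a \<in> A" for a using h that by auto
    have "ps_coeff (rest h) (n + m) \<in> Idl\<^bsub>R\<^esub> A"
      using stable[of m] restJ h unfolding initial_coeffs_def by blast
    then obtain r where r: "r \<in> A \<rightarrow> carrier R" and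
      ord: "order_ge (rest h \<ominus>\<^bsub>P\<^esub> (\<Oplus>\<^bsub>P\<^esub>a\<in>A. (const (r a) \<otimes>\<^bsub>P\<^esub> Y [^]\<^bsub>P\<^esub> m) \<otimes>\<^bsub>P\<^esub> l a)) (Suc (n + m))"
      using cancel_initial_coeff[OF A, of l n "rest h" m] l lc restJ h J.Icarr by blast
    have rc: "r a \<in> carrier R" if "a \<in> A" for a using r that by auto
    define h' where "h' a = h a \<oplus>\<^bsub>P\<^esub> const (r a) \<otimes>\<^bsub>P\<^esub> Y [^]\<^bsub>P\<^esub> m" for a
    have h': "h' \<in> A \<rightarrow> carrier P" using hc rc by (auto simp: h'_def)
    let ?s = "\<Oplus>\<^bsub>P\<^esub>a\<in>A. h a \<otimes>\<^bsub>P\<^esub> l a"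
    let ?s' = "\<Oplus>\<^bsub>P\<^esub>a\<in>A. (const (r a) \<otimes>\<^bsub>P\<^esub> Y [^]\<^bsub>P\<^esub> m) \<otimes>\<^bsub>P\<^esub> l a"
    have s: "?s \<in> carrier P" "?s' \<in> carrier P" using hc rc lc by (auto intro!: P.finsum_closed)
    have "(\<Oplus>\<^bsub>P\<^esub>a\<in>A. h' a \<otimes>\<^bsub>P\<^esub> l a)
        = (\<Oplus>\<^bsub>P\<^esub>a\<in>A. h a \<otimes>\<^bsub>P\<^esub> l a \<oplus>\<^bsub>P\<^esub> (const (r a) \<otimes>\<^bsub>P\<^esub> Y [^]\<^bsub>P\<^esub> m) \<otimes>\<^bsub>P\<^esub> l a)"
      using hc rc lc by (intro P.finsum_cong') (auto simp: h'_def P.l_distr)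
    also have "\<dots> = ?s \<oplus>\<^bsub>P\<^esub> ?s'"
      using hc rc lc by (intro P.finsum_addf) auto
    finally have "rest h' = rest h \<ominus>\<^bsub>P\<^esub> ?s'"
      unfolding rest_def using s gc by (simp add: P.minus_eq P.minus_add P.a_assoc)
    then have "order_ge (rest h') (n + Suc m)" using ord by simp
    moreover have "?T m h h'"
      using hc rc by (auto simp: h'_def coeff_Y_pow)
    ultimately show ?thesis using h' by blast
  qed
  have start: "\<exists>h. ?I 0 h"
  proof -
    have "(\<Oplus>\<^bsub>P\<^esub>a\<in>A. \<zero>\<^bsub>P\<^esub> \<otimes>\<^bsub>P\<^esub> l a) = \<zero>\<^bsub>P\<^esub>"
      using lc by (intro P.add.finprod_one_eqI) auto
    then have "?I 0 (\<lambda>_. \<zero>\<^bsub>P\<^esub>)" using g gc by (simp add: rest_def P.minus_eq)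
    then show ?thesis by blast
  qed
  have "\<exists>F. \<forall>m. ?I m (F m) \<and> ?T m (F m) (F (Suc m))"
    using start step by (rule dependent_nat_choice)
  then obtain F where "\<forall>m. ?I m (F m) \<and> ?T m (F m) (F (Suc m))" ..
  then have F: "\<And>m. ?I m (F m)" "\<And>m. ?T m (F m) (F (Suc m))" by simp_all
  have Fc: "F m a \<in> carrier P" if "a \<in> A" for m a using F(1)[of m] that by auto
  have stab: "ps_coeff (F (m + k) a) i = ps_coeff (F m a) i" if "a \<in> A" "i < m" for a i m k
    using that F(2) by (induction k) auto
  \<comment> \<open>the limit of the multipliers: the coefficient at \<open>i\<close> is final from step \<open>i + 1\<close> on\<close>
  define H where "H a = ps_seq (\<lambda>i. ps_coeff (F (Suc i) a) i)" for a
  have Hc: "H a \<in> carrier P" if "a \<in> A" for a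
    unfolding H_def using Fc[OF that] by (intro seq_closed) simp
  have HF: "ps_coeff (H a) i = ps_coeff (F (Suc k) a) i" if "a \<in> A" "i \<le> k" for a i k
    using stab[OF that(1), of i "Suc i" "k - i"] that(2) by (simp add: H_def)
  have "g = (\<Oplus>\<^bsub>P\<^esub>a\<in>A. H a \<otimes>\<^bsub>P\<^esub> l a)"
  proof (rule ps_eqI)
    fix k
    have closed: "(\<lambda>a. F (Suc k) a \<otimes>\<^bsub>P\<^esub> l a) \<in> A \<rightarrow> carrier P" using Fc lc by auto
    have "order_ge (rest (F (Suc k))) (n + Suc k)" using F(1) by blast
    then have "ps_coeff g k \<ominus> ps_coeff (\<Oplus>\<^bsub>P\<^esub>a\<in>A. F (Suc k) a \<otimes>\<^bsub>P\<^esub> l a) k = \<zero>"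
      unfolding rest_def order_ge_def using gc P.finsum_closed[OF closed] by simp
    then have "ps_coeff g k = ps_coeff (\<Oplus>\<^bsub>P\<^esub>a\<in>A. F (Suc k) a \<otimes>\<^bsub>P\<^esub> l a) k"
      using gc P.finsum_closed[OF closed] by simp
    also have "\<dots> = (\<Oplus>a\<in>A. ps_coeff (F (Suc k) a \<otimes>\<^bsub>P\<^esub> l a) k)"
      by (rule coeff_finsum[OF closed])
    also have "\<dots> = (\<Oplus>a\<in>A. ps_coeff (H a \<otimes>\<^bsub>P\<^esub> l a) k)"
      using Fc Hc lc HF by (intro R.finsum_cong' coeff_mult_cong) auto
    also have "\<dots> = ps_coeff (\<Oplus>\<^bsub>P\<^esub>a\<in>A. H a \<otimes>\<^bsub>P\<^esub> l a) k"
      using Hc lc by (intro coeff_finsum[symmetric]) auto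
    finally show "ps_coeff g k = ps_coeff (\<Oplus>\<^bsub>P\<^esub>a\<in>A. H a \<otimes>\<^bsub>P\<^esub> l a) k" .
  qed
  moreover have "H \<in> A \<rightarrow> carrier P" using Hc by blast
  ultimately show ?thesis by blast
qed

text \<open>
  The initial ideals of \<open>J\<close> form a chain, which becomes stationary at some \<open>N\<close>. Finitely many members
  of \<open>J\<close> whose initial coefficients generate the first \<open>N + 1\<close> initial ideals then generate \<open>J\<close>: below
  order \<open>N\<close> one cancels initial coefficients one at a time, and from there on the preceding lemma
  applies.
\<close>

theorem noetherian_power_series:
  assumes "noetherian_ring R"
  shows "noetherian_ring P"
proof (rule P.noetherian_ringI)
  fix J assume J: "ideal J P"
  interpret N: noetherian_ring R by fact
  interpret J: ideal J P by fact
  have "subset.chain {I. ideal I R} (range (initial_coeffs J))"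
    unfolding pred_on.chain_def
    using initial_coeffs_ideal[OF J] initial_coeffs_mono[OF J] nat_le_linear by blast
  then have "\<Union>(range (initial_coeffs J)) \<in> range (initial_coeffs J)"
    by (intro N.ideal_chain_is_trivial) auto
  then obtain N where N: "\<And>m. initial_coeffs J m \<subseteq> initial_coeffs J N" by blast
  have "\<exists>A. A \<subseteq> carrier R \<and> finite A \<and> initial_coeffs J n = Idl\<^bsub>R\<^esub> A" for n
    using N.finetely_gen[OF initial_coeffs_ideal[OF J]] by blast
  then obtain A where A: "\<And>n. A n \<subseteq> carrier R" "\<And>n. finite (A n)"
    and gen: "\<And>n. initial_coeffs J n = Idl\<^bsub>R\<^esub> (A n)" by metis
  have lift: "\<exists>t. t \<in> J \<and> order_ge t n \<and> ps_coeff t n = a" if "a \<in> A n" for n a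
    using that R.genideal_self[OF A(1), of n] unfolding gen[symmetric] initial_coeffs_def by blast
  define l where "l n a = (SOME t. t \<in> J \<and> order_ge t n \<and> ps_coeff t n = a)" for n a
  have l: "l n a \<in> J \<and> order_ge (l n a) n \<and> ps_coeff (l n a) n = a" if "a \<in> A n" for n a
    unfolding l_def by (rule someI_ex[OF lift[OF that]])
  define G where "G = (\<Union>n\<in>{..N}. l n ` A n)"
  have G: "finite G" "G \<subseteq> J" "G \<subseteq> carrier P" using A(2) l J.Icarr by (auto simp: G_def)
  interpret G: ideal "Idl\<^bsub>P\<^esub> G" P by (rule P.genideal_ideal[OF G(3)])
  have lG: "l n a \<in> Idl\<^bsub>P\<^esub> G" if "n \<le> N" "a \<in> A n" for n a
    using P.genideal_self[OF G(3)] that by (auto simp: G_def)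
  have "g \<in> Idl\<^bsub>P\<^esub> G" if "g \<in> J" "order_ge g (N - k)" "k \<le> N" for g k
    using that
  proof (induction k arbitrary: g)
    case 0
    obtain h where h: "h \<in> A N \<rightarrow> carrier P" "g = (\<Oplus>\<^bsub>P\<^esub>a\<in>A N. h a \<otimes>\<^bsub>P\<^esub> l N a)"
      using divide_with_stable_initial_coeffs[OF J A(2)[of N] A(1), of "l N" N g] l N 0 gen by auto
    show ?case unfolding h(2)
      using h(1) lG by (intro G.finsum_in_ideal G.I_l_closed) auto
  next
    case (Suc k)
    let ?n = "N - Suc k"
    have gc: "g \<in> carrier P" using Suc.prems J.Icarr by blast
    have lc: "l ?n a \<in> carrier P" if "a \<in> A ?n" for a using l[OF that] J.Icarr by blast
    have "ps_coeff g ?n \<in> Idl\<^bsub>R\<^esub> (A ?n)"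
      using Suc.prems unfolding gen[symmetric] initial_coeffs_def by blast
    then obtain r where r: "r \<in> A ?n \<rightarrow> carrier R" and
      ord: "order_ge (g \<ominus>\<^bsub>P\<^esub> (\<Oplus>\<^bsub>P\<^esub>a\<in>A ?n. (const (r a) \<otimes>\<^bsub>P\<^esub> Y [^]\<^bsub>P\<^esub> (0::nat)) \<otimes>\<^bsub>P\<^esub> l ?n a)) (Suc (?n + 0))"
      using cancel_initial_coeff[OF A(2)[of ?n] A(1), of "l ?n" ?n g 0] l lc gc Suc.prems by auto
    define s where "s = (\<Oplus>\<^bsub>P\<^esub>a\<in>A ?n. (const (r a) \<otimes>\<^bsub>P\<^esub> Y [^]\<^bsub>P\<^esub> (0::nat)) \<otimes>\<^bsub>P\<^esub> l ?n a)"
    have sG: "s \<in> Idl\<^bsub>P\<^esub> G" unfolding s_def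
      using r lG by (intro G.finsum_in_ideal G.I_l_closed) auto
    have sJ: "s \<in> J" unfolding s_def
      using r l by (intro J.finsum_in_ideal J.I_l_closed) auto
    have "g \<ominus>\<^bsub>P\<^esub> s \<in> J" unfolding P.minus_eq
      using Suc.prems(1) sJ by (intro J.a_closed J.a_inv_closed)
    moreover have "order_ge (g \<ominus>\<^bsub>P\<^esub> s) (N - k)"
      using ord Suc.prems(3) by (simp add: s_def Suc_diff_Suc)
    ultimately have "g \<ominus>\<^bsub>P\<^esub> s \<in> Idl\<^bsub>P\<^esub> G" using Suc by simp
    then have "g \<ominus>\<^bsub>P\<^esub> s \<oplus>\<^bsub>P\<^esub> s \<in> Idl\<^bsub>P\<^esub> G" using sG by (rule G.a_closed)
    moreover have "g \<ominus>\<^bsub>P\<^esub> s \<oplus>\<^bsub>P\<^esub> s = g"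
      using gc J.Icarr[OF sJ] by (simp add: P.minus_eq P.a_assoc P.l_neg)
    ultimately show ?case by simp
  qed
  from this[of _ N] have "J \<subseteq> Idl\<^bsub>P\<^esub> G" by (auto simp: order_ge_def)
  moreover have "Idl\<^bsub>P\<^esub> G \<subseteq> J" by (rule P.genideal_minimal[OF J G(2)])
  ultimately show "\<exists>A\<subseteq>carrier P. finite A \<and> J = Idl\<^bsub>P\<^esub> A" using G by blast
qed

end

section \<open>Frobenius bases\<close>

text \<open>
  A finite basis \<open>b\<close> of \<open>R\<close> as a module over itself through \<open>a \<mapsto> a\<^sup>Q\<close>. The coordinate functions are
  part of the structure, since the final isomorphism is assembled from them.
\<close>

locale frobenius_basis = cring R for R (structure) +
  fixes Q :: nat and I :: "'i set" and b :: "'i \<Rightarrow> 'a" and \<kappa> :: "'i \<Rightarrow> 'a \<Rightarrow> 'a"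
  assumes finite_index [simp]: "finite I"
    and basis_closed [simp]: "i \<in> I \<Longrightarrow> b i \<in> carrier R"
    and coord_closed [simp]: "i \<in> I \<Longrightarrow> s \<in> carrier R \<Longrightarrow> \<kappa> i s \<in> carrier R"
    and expansion: "s \<in> carrier R \<Longrightarrow> (\<Oplus>i\<in>I. \<kappa> i s [^] Q \<otimes> b i) = s"
    and coord: "c \<in> I \<rightarrow> carrier R \<Longrightarrow> i \<in> I \<Longrightarrow> \<kappa> i (\<Oplus>j\<in>I. c j [^] Q \<otimes> b j) = c i"

text \<open>
  Natural numbers as indices, because a type of indices cannot be quantified over; the next lemma
  shows that every finite index set can be renamed in this way.
\<close>

definition has_frobenius_basis :: "('a, 'b) ring_scheme \<Rightarrow> nat \<Rightarrow> bool" where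
  "has_frobenius_basis R Q \<longleftrightarrow> (\<exists>(I :: nat set) b \<kappa>. frobenius_basis R Q I b \<kappa>)"

lemma (in frobenius_basis) has_frobenius_basis: "has_frobenius_basis R Q"
proof -
  obtain g :: "'i \<Rightarrow> nat" where g: "inj_on g I"
    using finite_imp_inj_to_nat_seg[OF finite_index] by blast
  let ?g = "the_inv_into I g"
  have inv: "?g (g i) = i" if "i \<in> I" for i using that g by (simp add: the_inv_into_f_f)
  have sum: "(\<Oplus>j\<in>g ` I. c j [^] Q \<otimes> b (?g j)) = (\<Oplus>i\<in>I. c (g i) [^] Q \<otimes> b i)"
    if "\<And>i. i \<in> I \<Longrightarrow> c (g i) \<in> carrier R" for c
  proof -
    have "(\<Oplus>j\<in>g ` I. c j [^] Q \<otimes> b (?g j)) = (\<Oplus>i\<in>I. c (g i) [^] Q \<otimes> b (?g (g i)))"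
      using that by (intro finsum_reindex[OF _ g]) (auto simp: inv)
    also have "\<dots> = (\<Oplus>i\<in>I. c (g i) [^] Q \<otimes> b i)"
      using that by (intro finsum_cong') (auto simp: inv)
    finally show ?thesis .
  qed
  have "frobenius_basis R Q (g ` I) (\<lambda>j. b (?g j)) (\<lambda>j. \<kappa> (?g j))"
  proof
    show "finite (g ` I)" by simp
    fix j assume "j \<in> g ` I"
    then obtain i where i: "i \<in> I" "j = g i" by blast
    show "b (?g j) \<in> carrier R" using i by (simp add: inv)
    show "\<kappa> (?g j) s \<in> carrier R" if "s \<in> carrier R" for s using i that by (simp add: inv)
    show "\<kappa> (?g j) (\<Oplus>j\<in>g ` I. c j [^] Q \<otimes> b (?g j)) = c j" if "c \<in> g ` I \<rightarrow> carrier R" for c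
      using that i coord[of "\<lambda>i. c (g i)" i] by (subst sum) (auto simp: inv)
  next
    fix s assume s: "s \<in> carrier R"
    show "(\<Oplus>j\<in>g ` I. \<kappa> (?g j) s [^] Q \<otimes> b (?g j)) = s"
    proof (subst sum)
      have "(\<Oplus>i\<in>I. \<kappa> (?g (g i)) s [^] Q \<otimes> b i) = (\<Oplus>i\<in>I. \<kappa> i s [^] Q \<otimes> b i)"
        using s by (intro finsum_cong') (auto simp: inv)
      then show "(\<Oplus>i\<in>I. \<kappa> (?g (g i)) s [^] Q \<otimes> b i) = s" using expansion[OF s] by simp
    qed (use s in \<open>auto simp: inv\<close>)
  qed
  then show ?thesis unfolding has_frobenius_basis_def by blast
qed

text \<open>
  Expand the coordinates of an element once more: if \<open>s = \<Sum>\<^sub>i s\<^sub>i\<^sup>Q b\<^sub>i\<close> and \<open>s\<^sub>i = \<Sum>\<^sub>j s\<^sub>i\<^sub>j\<^bsup>Q'\<^esup> b'\<^sub>j\<close>, then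
  additivity of the \<open>Q\<close>-th power gives \<open>s = \<Sum>\<^sub>i\<^sub>j s\<^sub>i\<^sub>j\<^bsup>QQ'\<^esup> b'\<^sub>j\<^sup>Q b\<^sub>i\<close>.
\<close>

lemma (in char_p_ring) frobenius_basis_compose:
  assumes 1: "frobenius_basis R (p ^ e) I b \<kappa>" and 2: "frobenius_basis R (p ^ e') J b' \<kappa>'"
  shows "frobenius_basis R (p ^ (e' + e)) (I \<times> J)
    (\<lambda>z. b' (snd z) [^] (p ^ e) \<otimes> b (fst z)) (\<lambda>z s. \<kappa>' (snd z) (\<kappa> (fst z) s))"
proof -
  interpret A: frobenius_basis R "p ^ e" I b \<kappa> by fact
  interpret B: frobenius_basis R "p ^ e'" J b' \<kappa>' by fact
  have sum: "(\<Oplus>z\<in>I \<times> J. c z [^] (p ^ (e' + e)) \<otimes> (b' (snd z) [^] (p ^ e) \<otimes> b (fst z)))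
      = (\<Oplus>i\<in>I. (\<Oplus>j\<in>J. c (i, j) [^] (p ^ e') \<otimes> b' j) [^] (p ^ e) \<otimes> b i)"
    if c: "\<And>i j. i \<in> I \<Longrightarrow> j \<in> J \<Longrightarrow> c (i, j) \<in> carrier R" for c
  proof -
    have "(\<Oplus>i\<in>I. (\<Oplus>j\<in>J. c (i, j) [^] (p ^ e') \<otimes> b' j) [^] (p ^ e) \<otimes> b i)
        = (\<Oplus>i\<in>I. \<Oplus>j\<in>J. c (i, j) [^] (p ^ (e' + e)) \<otimes> (b' j [^] (p ^ e) \<otimes> b i))"
    proof (rule finsum_cong')
      fix i assume i: "i \<in> I"
      have "(\<Oplus>j\<in>J. c (i, j) [^] (p ^ e') \<otimes> b' j) [^] (p ^ e) \<otimes> b i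
          = (\<Oplus>j\<in>J. (c (i, j) [^] (p ^ e') \<otimes> b' j) [^] (p ^ e) \<otimes> b i)"
        using c i by (simp add: pow_q_finsum finsum_ldistr Pi_def)
      also have "\<dots> = (\<Oplus>j\<in>J. c (i, j) [^] (p ^ (e' + e)) \<otimes> (b' j [^] (p ^ e) \<otimes> b i))"
        using c i by (intro finsum_cong') (auto simp: nat_pow_distrib nat_pow_pow power_add m_assoc)
      finally show "(\<Oplus>j\<in>J. c (i, j) [^] (p ^ e') \<otimes> b' j) [^] (p ^ e) \<otimes> b i
          = (\<Oplus>j\<in>J. c (i, j) [^] (p ^ (e' + e)) \<otimes> (b' j [^] (p ^ e) \<otimes> b i))" .
    qed (use c in \<open>auto intro!: finsum_closed\<close>)
    also have "\<dots> = (\<Oplus>z\<in>I \<times> J. c (fst z, snd z) [^] (p ^ (e' + e)) \<otimes> (b' (snd z) [^] (p ^ e) \<otimes> b (fst z)))"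
      using c by (intro finsum_Sigma) auto
    finally show ?thesis by simp
  qed
  show ?thesis
  proof
    fix z assume z: "z \<in> I \<times> J"
    show "\<kappa>' (snd z) (\<kappa> (fst z)
        (\<Oplus>z\<in>I \<times> J. c z [^] (p ^ (e' + e)) \<otimes> (b' (snd z) [^] (p ^ e) \<otimes> b (fst z)))) = c z"
      if c: "c \<in> I \<times> J \<rightarrow> carrier R" for c
    proof -
      have cl: "c (i, j) \<in> carrier R" if "i \<in> I" "j \<in> J" for i j using c that by auto
      have cl': "(\<Oplus>j\<in>J. c (i, j) [^] (p ^ e') \<otimes> b' j) \<in> carrier R" if "i \<in> I" for i
        using cl that by (intro finsum_closed) auto
      have "\<kappa> (fst z) (\<Oplus>i\<in>I. (\<Oplus>j\<in>J. c (i, j) [^] (p ^ e') \<otimes> b' j) [^] (p ^ e) \<otimes> b i)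
          = (\<Oplus>j\<in>J. c (fst z, j) [^] (p ^ e') \<otimes> b' j)"
        using z cl' by (intro A.coord) auto
      also have "\<kappa>' (snd z) \<dots> = c (fst z, snd z)"
        using z cl by (intro B.coord) auto
      finally show ?thesis by (simp add: sum cl)
    qed
  next
    fix s assume s: "s \<in> carrier R"
    have "(\<Oplus>z\<in>I \<times> J. \<kappa>' (snd z) (\<kappa> (fst z) s) [^] (p ^ (e' + e)) \<otimes> (b' (snd z) [^] (p ^ e) \<otimes> b (fst z)))
        = (\<Oplus>i\<in>I. (\<Oplus>j\<in>J. \<kappa>' j (\<kappa> i s) [^] (p ^ e') \<otimes> b' j) [^] (p ^ e) \<otimes> b i)"
      using s by (subst sum) auto
    also have "\<dots> = (\<Oplus>i\<in>I. \<kappa> i s [^] (p ^ e) \<otimes> b i)"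
      using s by (intro finsum_cong') (auto simp: B.expansion)
    also have "\<dots> = s" by (rule A.expansion[OF s])
    finally show "(\<Oplus>z\<in>I \<times> J. \<kappa>' (snd z) (\<kappa> (fst z) s) [^] (p ^ (e' + e))
        \<otimes> (b' (snd z) [^] (p ^ e) \<otimes> b (fst z))) = s" .
  qed auto
qed

lemma (in char_p_ring) has_frobenius_basis_power:
  assumes "has_frobenius_basis R p"
  shows "has_frobenius_basis R (p ^ e)"
proof (induction e)
  case 0
  have "frobenius_basis R (p ^ 0) {()} (\<lambda>_. \<one>) (\<lambda>_ s. s)"
    by unfold_locales auto
  then show ?case by (rule frobenius_basis.has_frobenius_basis)
next
  case (Suc e)
  obtain I :: "nat set" and b \<kappa> where 1: "frobenius_basis R (p ^ 1) I b \<kappa>"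
    using assms unfolding has_frobenius_basis_def by auto
  obtain J :: "nat set" and b' \<kappa>' where 2: "frobenius_basis R (p ^ e) J b' \<kappa>'"
    using Suc unfolding has_frobenius_basis_def by auto
  show ?case
    using frobenius_basis.has_frobenius_basis[OF frobenius_basis_compose[OF 1 2]] by simp
qed

text \<open>
  A Frobenius basis of \<open>R\<close> acts coefficientwise: \<open>R[[Y]]\<close> is free on the same \<open>b\<^sub>i\<close> over the
  coefficientwise \<open>Q\<close>-th powers \<open>R\<^sup>Q[[Y]]\<close>, with coordinates \<open>kap i\<close>. Combined with decimation, which
  handles the step from \<open>R\<^sup>Q[[Y\<^sup>Q]]\<close> to \<open>R\<^sup>Q[[Y]]\<close>, this yields a Frobenius basis of \<open>R[[Y]]\<close>.
\<close>

locale univariate_frobenius = univariate_char_p R P p + frobenius_basis R "p ^ e" I b \<kappa>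
  for R (structure) and P (structure) and p e :: nat and I :: "'i set" and b \<kappa>
begin

abbreviation Q :: nat where "Q \<equiv> p ^ e"

abbreviation kap :: "'i \<Rightarrow> (unit multiset \<Rightarrow> 'a) \<Rightarrow> unit multiset \<Rightarrow> 'a" where
  "kap i \<equiv> coeff_map (\<kappa> i)"

lemma kap_closed [simp]: "i \<in> I \<Longrightarrow> t \<in> carrier P \<Longrightarrow> kap i t \<in> carrier P"
  by (rule coeff_map_closed) auto

lemma coeff_combination:
  assumes "c \<in> I \<rightarrow> carrier P"
  shows "ps_coeff (\<Oplus>\<^bsub>P\<^esub>i\<in>I. cpow Q (c i) \<otimes>\<^bsub>P\<^esub> const (b i)) n = (\<Oplus>i\<in>I. ps_coeff (c i) n [^] Q \<otimes> b i)"
proof -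
  have c: "c i \<in> carrier P" if "i \<in> I" for i using assms that by auto
  have "ps_coeff (\<Oplus>\<^bsub>P\<^esub>i\<in>I. cpow Q (c i) \<otimes>\<^bsub>P\<^esub> const (b i)) n
      = (\<Oplus>i\<in>I. ps_coeff (cpow Q (c i) \<otimes>\<^bsub>P\<^esub> const (b i)) n)"
    using c by (intro coeff_finsum) auto
  also have "\<dots> = (\<Oplus>i\<in>I. ps_coeff (c i) n [^] Q \<otimes> b i)"
  proof (rule R.finsum_cong')
    fix i assume i: "i \<in> I"
    have "cpow Q (c i) \<otimes>\<^bsub>P\<^esub> const (b i) = const (b i) \<otimes>\<^bsub>P\<^esub> cpow Q (c i)"
      using i c by (intro P.m_comm) auto
    then show "ps_coeff (cpow Q (c i) \<otimes>\<^bsub>P\<^esub> const (b i)) n = ps_coeff (c i) n [^] Q \<otimes> b i"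
      using i c by (simp add: R.m_comm)
  qed (use c in auto)
  finally show ?thesis .
qed

lemma kap_expansion:
  assumes "t \<in> carrier P"
  shows "(\<Oplus>\<^bsub>P\<^esub>i\<in>I. cpow Q (kap i t) \<otimes>\<^bsub>P\<^esub> const (b i)) = t"
proof (rule ps_eqI)
  fix n
  have "ps_coeff (\<Oplus>\<^bsub>P\<^esub>i\<in>I. cpow Q (kap i t) \<otimes>\<^bsub>P\<^esub> const (b i)) n
      = (\<Oplus>i\<in>I. ps_coeff (kap i t) n [^] Q \<otimes> b i)"
    using assms by (intro coeff_combination) auto
  also have "\<dots> = ps_coeff t n" using assms by (simp add: expansion)
  finally show "ps_coeff (\<Oplus>\<^bsub>P\<^esub>i\<in>I. cpow Q (kap i t) \<otimes>\<^bsub>P\<^esub> const (b i)) n = ps_coeff t n" .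
qed

lemma kap_coord:
  assumes "c \<in> I \<rightarrow> carrier P" "i \<in> I"
  shows "kap i (\<Oplus>\<^bsub>P\<^esub>j\<in>I. cpow Q (c j) \<otimes>\<^bsub>P\<^esub> const (b j)) = c i"
  by (rule ps_eqI) (use assms in \<open>simp add: coeff_combination coord Pi_iff\<close>)

lemma kap_add:
  assumes "i \<in> I" "t \<in> carrier P" "u \<in> carrier P"
  shows "kap i (t \<oplus>\<^bsub>P\<^esub> u) = kap i t \<oplus>\<^bsub>P\<^esub> kap i u"
proof -
  interpret cp: ring_hom_cring P P "cpow Q"
    by (intro ring_hom_cring.intro ring_hom_cring_axioms.intro P.is_cring cpow_hom)
  have "t \<oplus>\<^bsub>P\<^esub> u = (\<Oplus>\<^bsub>P\<^esub>j\<in>I. cpow Q (kap j t) \<otimes>\<^bsub>P\<^esub> const (b j)) \<oplus>\<^bsub>P\<^esub>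
      (\<Oplus>\<^bsub>P\<^esub>j\<in>I. cpow Q (kap j u) \<otimes>\<^bsub>P\<^esub> const (b j))"
    using assms by (simp add: kap_expansion)
  also have "\<dots> = (\<Oplus>\<^bsub>P\<^esub>j\<in>I. cpow Q (kap j t) \<otimes>\<^bsub>P\<^esub> const (b j) \<oplus>\<^bsub>P\<^esub> cpow Q (kap j u) \<otimes>\<^bsub>P\<^esub> const (b j))"
    using assms by (intro P.finsum_addf[symmetric]) auto
  also have "\<dots> = (\<Oplus>\<^bsub>P\<^esub>j\<in>I. cpow Q (kap j t \<oplus>\<^bsub>P\<^esub> kap j u) \<otimes>\<^bsub>P\<^esub> const (b j))"
    using assms by (intro P.finsum_cong') (auto simp: P.l_distr)
  finally show ?thesis
    using kap_coord[of "\<lambda>j. kap j t \<oplus>\<^bsub>P\<^esub> kap j u" i] assms by simp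
qed

lemma kap_cpow_mult:
  assumes "i \<in> I" "a \<in> carrier P" "t \<in> carrier P"
  shows "kap i (cpow Q a \<otimes>\<^bsub>P\<^esub> t) = a \<otimes>\<^bsub>P\<^esub> kap i t"
proof -
  interpret cp: ring_hom_cring P P "cpow Q"
    by (intro ring_hom_cring.intro ring_hom_cring_axioms.intro P.is_cring cpow_hom)
  have "cpow Q a \<otimes>\<^bsub>P\<^esub> t = cpow Q a \<otimes>\<^bsub>P\<^esub> (\<Oplus>\<^bsub>P\<^esub>j\<in>I. cpow Q (kap j t) \<otimes>\<^bsub>P\<^esub> const (b j))"
    using assms by (simp add: kap_expansion)
  also have "\<dots> = (\<Oplus>\<^bsub>P\<^esub>j\<in>I. cpow Q a \<otimes>\<^bsub>P\<^esub> (cpow Q (kap j t) \<otimes>\<^bsub>P\<^esub> const (b j)))"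
    using assms by (intro P.finsum_rdistr) auto
  also have "\<dots> = (\<Oplus>\<^bsub>P\<^esub>j\<in>I. cpow Q (a \<otimes>\<^bsub>P\<^esub> kap j t) \<otimes>\<^bsub>P\<^esub> const (b j))"
    using assms by (intro P.finsum_cong') (auto simp: P.m_assoc)
  finally show ?thesis
    using kap_coord[of "\<lambda>j. a \<otimes>\<^bsub>P\<^esub> kap j t" i] assms by simp
qed

lemma decim_combination:
  assumes c: "c \<in> I \<times> {..<Q} \<rightarrow> carrier P" and k: "k < Q"
  shows "decim Q k (\<Oplus>\<^bsub>P\<^esub>z\<in>I \<times> {..<Q}. c z [^]\<^bsub>P\<^esub> Q \<otimes>\<^bsub>P\<^esub> (const (b (fst z)) \<otimes>\<^bsub>P\<^esub> Y [^]\<^bsub>P\<^esub> snd z))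
    = (\<Oplus>\<^bsub>P\<^esub>i\<in>I. cpow Q (c (i, k)) \<otimes>\<^bsub>P\<^esub> const (b i))"
proof -
  have cl: "c (i, j) \<in> carrier P" if "i \<in> I" "j < Q" for i j using c that by auto
  have "decim Q k (\<Oplus>\<^bsub>P\<^esub>z\<in>I \<times> {..<Q}. c z [^]\<^bsub>P\<^esub> Q \<otimes>\<^bsub>P\<^esub> (const (b (fst z)) \<otimes>\<^bsub>P\<^esub> Y [^]\<^bsub>P\<^esub> snd z))
      = (\<Oplus>\<^bsub>P\<^esub>z\<in>I \<times> {..<Q}. decim Q k (c z [^]\<^bsub>P\<^esub> Q \<otimes>\<^bsub>P\<^esub> (const (b (fst z)) \<otimes>\<^bsub>P\<^esub> Y [^]\<^bsub>P\<^esub> snd z)))"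
    using cl by (intro decim_finsum) auto
  also have "\<dots> = (\<Oplus>\<^bsub>P\<^esub>z\<in>I \<times> {..<Q}.
      if snd z = k then cpow Q (c (fst z, snd z)) \<otimes>\<^bsub>P\<^esub> const (b (fst z)) else \<zero>\<^bsub>P\<^esub>)"
  proof (rule P.finsum_cong')
    fix z assume "z \<in> I \<times> {..<Q}"
    then obtain i j where z: "z = (i, j)" "i \<in> I" "j < Q" by auto
    have "decim Q k (c z [^]\<^bsub>P\<^esub> Q \<otimes>\<^bsub>P\<^esub> (const (b i) \<otimes>\<^bsub>P\<^esub> Y [^]\<^bsub>P\<^esub> j))
        = cpow Q (c z) \<otimes>\<^bsub>P\<^esub> decim Q k (const (b i) \<otimes>\<^bsub>P\<^esub> Y [^]\<^bsub>P\<^esub> j)"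
      unfolding pow_q_series[OF cl[OF z(2,3), folded z(1)]]
      using z k cl by (intro decim_stretch_mult) (use q_pos[of e] in auto)
    then show "decim Q k (c z [^]\<^bsub>P\<^esub> Q \<otimes>\<^bsub>P\<^esub> (const (b (fst z)) \<otimes>\<^bsub>P\<^esub> Y [^]\<^bsub>P\<^esub> snd z))
        = (if snd z = k then cpow Q (c (fst z, snd z)) \<otimes>\<^bsub>P\<^esub> const (b (fst z)) else \<zero>\<^bsub>P\<^esub>)"
      using z k cl by (simp add: decim_const_mult decim_Y_pow)
  qed (use cl in auto)
  also have "\<dots> = (\<Oplus>\<^bsub>P\<^esub>i\<in>I. cpow Q (c (i, k)) \<otimes>\<^bsub>P\<^esub> const (b i))"
    using cl k by (intro P.finsum_product_slice[where g = "\<lambda>i j. cpow Q (c (i, j)) \<otimes>\<^bsub>P\<^esub> const (b i)"]) auto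
  finally show ?thesis .
qed

lemma frobenius_basis_series:
  "frobenius_basis P Q (I \<times> {..<Q}) (\<lambda>z. const (b (fst z)) \<otimes>\<^bsub>P\<^esub> Y [^]\<^bsub>P\<^esub> snd z)
    (\<lambda>z t. kap (fst z) (decim Q (snd z) t))"
proof
  fix z assume z: "z \<in> I \<times> {..<Q}"
  show "kap (fst z) (decim Q (snd z) (\<Oplus>\<^bsub>P\<^esub>z\<in>I \<times> {..<Q}. c z [^]\<^bsub>P\<^esub> Q \<otimes>\<^bsub>P\<^esub>
      (const (b (fst z)) \<otimes>\<^bsub>P\<^esub> Y [^]\<^bsub>P\<^esub> snd z))) = c z" if "c \<in> I \<times> {..<Q} \<rightarrow> carrier P" for c
  proof (subst decim_combination[OF that])
    show "snd z < Q" using z by auto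
    have "kap (fst z) (\<Oplus>\<^bsub>P\<^esub>i\<in>I. cpow Q (c (i, snd z)) \<otimes>\<^bsub>P\<^esub> const (b i)) = c (fst z, snd z)"
      using z that by (intro kap_coord) auto
    then show "kap (fst z) (\<Oplus>\<^bsub>P\<^esub>i\<in>I. cpow Q (c (i, snd z)) \<otimes>\<^bsub>P\<^esub> const (b i)) = c z" by simp
  qed
next
  fix t assume t: "t \<in> carrier P"
  show "(\<Oplus>\<^bsub>P\<^esub>z\<in>I \<times> {..<Q}. kap (fst z) (decim Q (snd z) t) [^]\<^bsub>P\<^esub> Q \<otimes>\<^bsub>P\<^esub>
      (const (b (fst z)) \<otimes>\<^bsub>P\<^esub> Y [^]\<^bsub>P\<^esub> snd z)) = t"
  proof (rule decim_eqI[OF q_pos])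
    fix k assume k: "k < Q"
    show "decim Q k (\<Oplus>\<^bsub>P\<^esub>z\<in>I \<times> {..<Q}. kap (fst z) (decim Q (snd z) t) [^]\<^bsub>P\<^esub> Q \<otimes>\<^bsub>P\<^esub>
        (const (b (fst z)) \<otimes>\<^bsub>P\<^esub> Y [^]\<^bsub>P\<^esub> snd z)) = decim Q k t"
    proof (subst decim_combination[OF _ k])
      show "(\<Oplus>\<^bsub>P\<^esub>i\<in>I. cpow Q (kap (fst (i, k)) (decim Q (snd (i, k)) t)) \<otimes>\<^bsub>P\<^esub> const (b i)) = decim Q k t"
        using kap_expansion[of "decim Q k t"] t by simp
    qed (use t in auto)
  qed
qed auto

end

section \<open>Power series over an F-finite field\<close>

text \<open>
  The class of base rings for which the argument works.
\<close>

definition frobenius_noetherian :: "nat \<Rightarrow> ('a, 'b) ring_scheme \<Rightarrow> bool" where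
  "frobenius_noetherian p R \<longleftrightarrow> char_p_ring R p \<and> noetherian_ring R \<and> has_frobenius_basis R p"

lemma (in ring_hom_cring) hom_add_pow:
  "x \<in> carrier R \<Longrightarrow> h ([(n::nat)] \<cdot>\<^bsub>R\<^esub> x) = [n] \<cdot>\<^bsub>S\<^esub> h x"
  by (induction n) auto

lemma (in ring_hom_cring) hom_pow:
  "x \<in> carrier R \<Longrightarrow> h (x [^] (n::nat)) = h x [^]\<^bsub>S\<^esub> n"
  by (induction n) auto

text \<open>
  Needed to pass between \<open>R[[x\<^sub>1, \<dots>, x\<^sub>n]][[y]]\<close> and \<open>R[[x\<^sub>1, \<dots>, x\<^sub>n, y]]\<close>, which are different
  structures on different types.
\<close>

lemma frobenius_noetherian_iso:
  fixes R (structure) and S (structure)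
  assumes R: "frobenius_noetherian p R" and S: "cring S" and iso: "h \<in> ring_iso R S"
  shows "frobenius_noetherian p S"
proof -
  interpret R: char_p_ring R p using R by (simp add: frobenius_noetherian_def)
  interpret S: cring S by fact
  have hom: "h \<in> ring_hom R S" and bij: "bij_betw h (carrier R) (carrier S)"
    using iso by (auto simp: ring_iso_def)
  interpret h: ring_hom_cring R S h
    by (intro ring_hom_cring.intro ring_hom_cring_axioms.intro R.is_cring S hom)
  have "[p] \<cdot>\<^bsub>S\<^esub> \<one>\<^bsub>S\<^esub> = \<zero>\<^bsub>S\<^esub>"
    using h.hom_add_pow[of "\<one>" p] R.char_p by simp
  then have "char_p_ring S p"
    by (intro char_p_ring.intro char_p_ring_axioms.intro S R.prime_p)
  moreover have "noetherian_ring S"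
    using R bij S.ring_axioms
    by (intro noetherian_ring_hom_image[OF _ _ hom]) (auto simp: frobenius_noetherian_def bij_betw_def)
  moreover have "has_frobenius_basis S p"
  proof -
    obtain I :: "nat set" and b \<kappa> where B: "frobenius_basis R p I b \<kappa>"
      using R by (auto simp: frobenius_noetherian_def has_frobenius_basis_def)
    interpret B: frobenius_basis R p I b \<kappa> by (rule B)
    define g where "g = the_inv_into (carrier R) h"
    have gh: "g (h x) = x" if "x \<in> carrier R" for x
      unfolding g_def using that bij by (auto simp: bij_betw_def the_inv_into_f_f)
    have g: "g y \<in> carrier R" "h (g y) = y" if y: "y \<in> carrier S" for y
    proof -
      obtain x where "x \<in> carrier R" "y = h x" using y bij unfolding bij_betw_def by blast
      then show "g y \<in> carrier R" "h (g y) = y" using gh by auto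
    qed
    have sum: "h (\<Oplus>i\<in>I. c i [^] p \<otimes> b i) = (\<Oplus>\<^bsub>S\<^esub>i\<in>I. h (c i) [^]\<^bsub>S\<^esub> p \<otimes>\<^bsub>S\<^esub> h (b i))"
      if c: "\<And>i. i \<in> I \<Longrightarrow> c i \<in> carrier R" for c
    proof -
      have "h (\<Oplus>i\<in>I. c i [^] p \<otimes> b i) = (\<Oplus>\<^bsub>S\<^esub>i\<in>I. h (c i [^] p \<otimes> b i))"
        using c h.hom_finsum[of "\<lambda>i. c i [^] p \<otimes> b i" I] by (auto simp: o_def Pi_def)
      also have "\<dots> = (\<Oplus>\<^bsub>S\<^esub>i\<in>I. h (c i) [^]\<^bsub>S\<^esub> p \<otimes>\<^bsub>S\<^esub> h (b i))"
        using c by (intro S.finsum_cong') (auto simp: h.hom_pow)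
      finally show ?thesis .
    qed
    have "frobenius_basis S p I (\<lambda>i. h (b i)) (\<lambda>i s. h (\<kappa> i (g s)))"
    proof
      fix s assume s: "s \<in> carrier S"
      have "(\<Oplus>\<^bsub>S\<^esub>i\<in>I. h (\<kappa> i (g s)) [^]\<^bsub>S\<^esub> p \<otimes>\<^bsub>S\<^esub> h (b i)) = h (\<Oplus>i\<in>I. \<kappa> i (g s) [^] p \<otimes> b i)"
        using s g by (intro sum[symmetric]) auto
      then show "(\<Oplus>\<^bsub>S\<^esub>i\<in>I. h (\<kappa> i (g s)) [^]\<^bsub>S\<^esub> p \<otimes>\<^bsub>S\<^esub> h (b i)) = s"
        using s g by (simp add: B.expansion)
    next
      fix c i assume c: "c \<in> I \<rightarrow> carrier S" and i: "i \<in> I"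
      have cS: "c j \<in> carrier S" if "j \<in> I" for j using c that by auto
      then have gc: "g (c j) \<in> carrier R" if "j \<in> I" for j using g that by simp
      have "(\<Oplus>\<^bsub>S\<^esub>j\<in>I. c j [^]\<^bsub>S\<^esub> p \<otimes>\<^bsub>S\<^esub> h (b j)) = (\<Oplus>\<^bsub>S\<^esub>j\<in>I. h (g (c j)) [^]\<^bsub>S\<^esub> p \<otimes>\<^bsub>S\<^esub> h (b j))"
        using cS g by (intro S.finsum_cong') auto
      also have "\<dots> = h (\<Oplus>j\<in>I. g (c j) [^] p \<otimes> b j)" using gc by (intro sum[symmetric])
      finally have eq: "(\<Oplus>\<^bsub>S\<^esub>j\<in>I. c j [^]\<^bsub>S\<^esub> p \<otimes>\<^bsub>S\<^esub> h (b j)) = h (\<Oplus>j\<in>I. g (c j) [^] p \<otimes> b j)" .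
      have "(\<Oplus>j\<in>I. g (c j) [^] p \<otimes> b j) \<in> carrier R"
        using gc by (intro R.finsum_closed) auto
      then have "g (\<Oplus>\<^bsub>S\<^esub>j\<in>I. c j [^]\<^bsub>S\<^esub> p \<otimes>\<^bsub>S\<^esub> h (b j)) = (\<Oplus>j\<in>I. g (c j) [^] p \<otimes> b j)"
        unfolding eq by (rule gh)
      moreover have "\<kappa> i (\<Oplus>j\<in>I. g (c j) [^] p \<otimes> b j) = g (c i)"
        using gc i by (intro B.coord) auto
      ultimately show "h (\<kappa> i (g (\<Oplus>\<^bsub>S\<^esub>j\<in>I. c j [^]\<^bsub>S\<^esub> p \<otimes>\<^bsub>S\<^esub> h (b j)))) = c i"
        using c i g by auto
    qed (auto simp: g)
    then show ?thesis unfolding has_frobenius_basis_def by blast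
  qed
  ultimately show ?thesis by (simp add: frobenius_noetherian_def)
qed

lemma frobenius_noetherian_series:
  assumes "frobenius_noetherian p R"
  shows "frobenius_noetherian p (power_series_ring R {()})"
proof -
  have R: "char_p_ring R p" using assms by (simp add: frobenius_noetherian_def)
  interpret U: univariate_char_p R "power_series_ring R {()}" p
    by (intro univariate_char_p.intro univariate_series.intro R char_p_ring.axioms(1)[OF R])
  obtain I :: "nat set" and b \<kappa> where "frobenius_basis R (p ^ 1) I b \<kappa>"
    using assms by (auto simp: frobenius_noetherian_def has_frobenius_basis_def)
  then interpret F: univariate_frobenius R "power_series_ring R {()}" p 1 I b \<kappa>
    by (intro univariate_frobenius.intro U.univariate_char_p_axioms)
  have "has_frobenius_basis (power_series_ring R {()}) p"
    using frobenius_basis.has_frobenius_basis[OF F.frobenius_basis_series] by simp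
  then show ?thesis
    using U.PC.char_p_ring_axioms U.noetherian_power_series assms
    by (simp add: frobenius_noetherian_def)
qed

lemma (in ring) combine_eq_finsum:
  assumes "length Ks = length Us" "set Ks \<subseteq> carrier R" "set Us \<subseteq> carrier R"
  shows "combine Ks Us = (\<Oplus>i\<in>{..<length Us}. Ks ! i \<otimes> Us ! i)"
  using assms
proof (induction Ks Us rule: list_induct2)
  case (Cons k Ks u Us)
  have closed: "(\<lambda>i. Ks ! i \<otimes> Us ! i) \<in> {..<length Us} \<rightarrow> carrier R"
    using Cons.prems Cons.hyps by (auto simp: subset_iff)
  have "(\<Oplus>i\<in>{..<length (u # Us)}. (k # Ks) ! i \<otimes> (u # Us) ! i)
      = k \<otimes> u \<oplus> (\<Oplus>i\<in>Suc ` {..<length Us}. (k # Ks) ! i \<otimes> (u # Us) ! i)"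
    unfolding list.size lessThan_Suc_eq_insert_0 add_Suc_right add_0_right
    using Cons.prems closed by (subst finsum_insert) auto
  also have "(\<Oplus>i\<in>Suc ` {..<length Us}. (k # Ks) ! i \<otimes> (u # Us) ! i)
      = (\<Oplus>i\<in>{..<length Us}. Ks ! i \<otimes> Us ! i)"
    using closed by (subst finsum_reindex) auto
  finally show ?case using Cons by simp
qed simp

lemma (in cring) has_frobenius_basisI:
  assumes I: "finite I" "\<And>i. i \<in> I \<Longrightarrow> b i \<in> carrier R"
    and ex: "\<And>s. s \<in> carrier R \<Longrightarrow> \<exists>c\<in>I \<rightarrow> carrier R. (\<Oplus>i\<in>I. c i [^] Q \<otimes> b i) = s"
    and uniq: "\<And>c c' i. c \<in> I \<rightarrow> carrier R \<Longrightarrow> c' \<in> I \<rightarrow> carrier R \<Longrightarrow>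
      (\<Oplus>i\<in>I. c i [^] Q \<otimes> b i) = (\<Oplus>i\<in>I. c' i [^] Q \<otimes> b i) \<Longrightarrow> i \<in> I \<Longrightarrow> c i = c' i"
  shows "has_frobenius_basis R Q"
proof -
  define k where "k s = (SOME c. c \<in> I \<rightarrow> carrier R \<and> (\<Oplus>i\<in>I. c i [^] Q \<otimes> b i) = s)" for s
  have "k s \<in> I \<rightarrow> carrier R \<and> (\<Oplus>i\<in>I. k s i [^] Q \<otimes> b i) = s" if s: "s \<in> carrier R" for s
  proof -
    have "\<exists>c. c \<in> I \<rightarrow> carrier R \<and> (\<Oplus>i\<in>I. c i [^] Q \<otimes> b i) = s" using ex[OF s] by blast
    then show ?thesis unfolding k_def by (rule someI_ex)
  qed
  then have k: "k s \<in> I \<rightarrow> carrier R" "(\<Oplus>i\<in>I. k s i [^] Q \<otimes> b i) = s" if "s \<in> carrier R" for s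
    using that by auto
  have "frobenius_basis R Q I b (\<lambda>i s. k s i)"
  proof
    fix c i assume c: "c \<in> I \<rightarrow> carrier R" and i: "i \<in> I"
    have s: "(\<Oplus>i\<in>I. c i [^] Q \<otimes> b i) \<in> carrier R" using c I by (intro finsum_closed) auto
    show "k (\<Oplus>j\<in>I. c j [^] Q \<otimes> b j) i = c i"
      by (rule uniq[OF k(1)[OF s] c k(2)[OF s] i])
  qed (use I k in auto)
  then show ?thesis by (rule frobenius_basis.has_frobenius_basis)
qed

text \<open>
  A basis of \<open>K\<close> over \<open>K\<^sup>p\<close> is a Frobenius basis: a coefficient in \<open>K\<^sup>p\<close> has exactly one \<open>p\<close>-th root,
  the Frobenius map of a field being injective.
\<close>

lemma frobenius_noetherian_field:
  fixes K (structure)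
  assumes p: "Factorial_Ring.prime p" and "field K" and char: "has_characteristic K p"
    and fin: "ring.finite_dimension K ((\<lambda>a. a [^] p) ` carrier K) (carrier K)"
  shows "frobenius_noetherian p K"
proof -
  interpret field K by fact
  have "[p] \<cdot>\<^bsub>K\<^esub> \<one> = \<zero>" using char by (simp add: has_characteristic_def)
  then have C: "char_p_ring K p"
    by (intro char_p_ring.intro char_p_ring_axioms.intro is_cring p)
  interpret C: char_p_ring K p by (rule C)
  have "noetherian_ring K"
  proof (rule noetherian_ringI)
    fix J assume "ideal J K"
    then have "J = {\<zero>} \<or> J = carrier K" using all_ideals by blast
    then have "J = Idl {\<zero>} \<or> J = Idl {\<one>}" using genideal_zero genideal_one by simp
    then show "\<exists>A\<subseteq>carrier K. finite A \<and> J = Idl A"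
      by (metis bot_least finite.emptyI finite.insertI insert_subset one_closed zero_closed)
  qed
  moreover have "has_frobenius_basis K p"
  proof -
    let ?F = "\<lambda>a. a [^] p"
    let ?Kp = "?F ` carrier K"
    have hom: "?F \<in> ring_hom K K" using C.frobenius_hom[of 1] by simp
    interpret F: ring_hom_ring K K ?F by (rule ring_hom_ringI2[OF ring_axioms ring_axioms hom])
    have sub: "subfield ?Kp K" and inj: "inj_on ?F (carrier K)"
      using F.img_is_subfield[OF carrier_is_subfield] by simp_all
    obtain n where "dimension n ?Kp (carrier K)" using fin by (auto simp: finite_dimension_def)
    then obtain Vs where Vs: "set Vs \<subseteq> carrier K" "independent ?Kp Vs" "Span ?Kp Vs = carrier K"
      using exists_base[OF sub] by blast
    have Vsi: "Vs ! i \<in> carrier K" if "i < length Vs" for i using that Vs(1) by auto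
    have comb: "combine (map (\<lambda>i. c i [^] p) [0..<length Vs]) Vs = (\<Oplus>i\<in>{..<length Vs}. c i [^] p \<otimes> Vs ! i)"
      if c: "c \<in> {..<length Vs} \<rightarrow> carrier K" for c
    proof -
      have "combine (map (\<lambda>i. c i [^] p) [0..<length Vs]) Vs
          = (\<Oplus>i\<in>{..<length Vs}. map (\<lambda>i. c i [^] p) [0..<length Vs] ! i \<otimes> Vs ! i)"
        using c Vs(1) by (intro combine_eq_finsum) auto
      also have "\<dots> = (\<Oplus>i\<in>{..<length Vs}. c i [^] p \<otimes> Vs ! i)"
        using c Vsi by (intro finsum_cong') (auto simp: Pi_iff)
      finally show ?thesis .
    qed
    show ?thesis
    proof (rule has_frobenius_basisI[of "{..<length Vs}" "\<lambda>i. Vs ! i"])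
      show "Vs ! i \<in> carrier K" if "i \<in> {..<length Vs}" for i using that Vsi by simp
      fix s assume "s \<in> carrier K"
      then obtain Ks where Ks: "set Ks \<subseteq> ?Kp" "length Ks = length Vs" "s = combine Ks Vs"
        using unique_decomposition[OF sub Vs(2), of s] Vs(3) by blast
      define c where "c i = inv_into (carrier K) ?F (Ks ! i)" for i
      have "Ks ! i \<in> ?Kp" if "i < length Vs" for i
        using Ks(1,2) that nth_mem by (metis subsetD)
      then have c: "c i \<in> carrier K" "c i [^] p = Ks ! i" if "i < length Vs" for i
        unfolding c_def using that by (metis inv_into_into, metis f_inv_into_f)
      have "map (\<lambda>i. c i [^] p) [0..<length Vs] = Ks"
        using c Ks(2) by (intro nth_equalityI) auto
      then have "(\<Oplus>i\<in>{..<length Vs}. c i [^] p \<otimes> Vs ! i) = s"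
        using comb[of c] c Ks(3) by auto
      then show "\<exists>c\<in>{..<length Vs} \<rightarrow> carrier K. (\<Oplus>i\<in>{..<length Vs}. c i [^] p \<otimes> Vs ! i) = s"
        using c by (intro bexI[of _ c]) auto
    next
      fix c c' i
      assume c: "c \<in> {..<length Vs} \<rightarrow> carrier K" and c': "c' \<in> {..<length Vs} \<rightarrow> carrier K"
        and eq: "(\<Oplus>i\<in>{..<length Vs}. c i [^] p \<otimes> Vs ! i) = (\<Oplus>i\<in>{..<length Vs}. c' i [^] p \<otimes> Vs ! i)"
        and i: "i \<in> {..<length Vs}"
      let ?m = "\<lambda>c. map (\<lambda>i. c i [^] p) [0..<length Vs]"
      have m: "set (?m c) \<subseteq> ?Kp" if "c \<in> {..<length Vs} \<rightarrow> carrier K" for c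
        using that by auto
      have "combine (?m c) Vs \<in> carrier K"
        using c Vs(1) by (intro combine_in_carrier) auto
      then have ex1: "\<exists>!Ks. set Ks \<subseteq> ?Kp \<and> length Ks = length Vs \<and> combine (?m c) Vs = combine Ks Vs"
        using unique_decomposition[OF sub Vs(2), of "combine (?m c) Vs"] by (simp only: Vs(3))
      define U where "U Ks \<longleftrightarrow>
          set Ks \<subseteq> ?Kp \<and> length Ks = length Vs \<and> combine (?m c) Vs = combine Ks Vs" for Ks
      have "\<exists>!Ks. U Ks" unfolding U_def by (rule ex1)
      moreover have "U (?m c)" unfolding U_def using m[OF c] by simp
      moreover have "U (?m c')" unfolding U_def using m[OF c'] comb[OF c] comb[OF c'] eq by simp
      ultimately have "?m c = ?m c'" by blast
      then have "?m c ! i = ?m c' ! i" by (simp only:)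
      then have "c i [^] p = c' i [^] p" using i by simp
      moreover have "c i \<in> carrier K" "c' i \<in> carrier K" using c c' i by auto
      ultimately show "c i = c' i" by (rule inj_onD[OF inj])
    qed simp
  qed
  ultimately show ?thesis using C by (simp add: frobenius_noetherian_def)
qed

lemma (in cring) power_series_no_variables: "ps_const R \<in> ring_iso R (power_series_ring R {})"
proof -
  let ?P = "power_series_ring R {}"
  have "(\<lambda>f. f {#}) \<in> ring_iso ?P R"
  proof (rule ring_iso_memI)
    show "bij_betw (\<lambda>f. f {#}) (carrier ?P) (carrier R)"
    proof (rule bij_betw_byWitness[where f' = "ps_const R"])
      show "\<forall>f\<in>carrier ?P. ps_const R (f {#}) = f"
        by (auto simp: power_series_carrier ps_const_def fun_eq_iff)
    qed (auto simp: power_series_carrier ps_const_def)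
  qed (auto simp: power_series_carrier power_series_mult power_series_one)
  then have "inv_into (carrier ?P) (\<lambda>f. f {#}) \<in> ring_iso R ?P"
    by (rule ring_iso_set_sym[OF cring.axioms(1)[OF power_series_cring]])
  then show ?thesis
  proof (rule ring_iso_restrict)
    fix a assume a: "a \<in> carrier R"
    have "ps_const R a \<in> carrier ?P" using a by (auto simp: power_series_carrier ps_const_def)
    moreover have "inj_on (\<lambda>f. f {#}) (carrier ?P)"
      by (rule inj_on_inverseI[of _ "ps_const R"])
        (auto simp: power_series_carrier ps_const_def fun_eq_iff)
    ultimately show "inv_into (carrier ?P) (\<lambda>f. f {#}) a = ps_const R a"
      using inv_into_f_f[of "\<lambda>f. f {#}" "carrier ?P" "ps_const R a"] by (simp add: ps_const_def)
  qed
qed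

lemma submultisets_split:
  "{k. k \<subseteq># m} = (\<lambda>z. snd z + replicate_mset (fst z) i) `
    ({..count m i} \<times> {k. k \<subseteq># filter_mset (\<lambda>x. x \<noteq> i) m})"
proof (intro equalityI subsetI)
  fix k assume "k \<in> {k. k \<subseteq># m}"
  then have k: "k \<subseteq># m" by simp
  let ?z = "(count k i, filter_mset (\<lambda>x. x \<noteq> i) k)"
  have "k = snd ?z + replicate_mset (fst ?z) i" by (rule multiset_eqI) simp
  moreover have "?z \<in> {..count m i} \<times> {k. k \<subseteq># filter_mset (\<lambda>x. x \<noteq> i) m}"
    using k by (simp add: mset_subset_eq_count multiset_filter_mono)
  ultimately show "k \<in> (\<lambda>z. snd z + replicate_mset (fst z) i) `
    ({..count m i} \<times> {k. k \<subseteq># filter_mset (\<lambda>x. x \<noteq> i) m})"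
    by (rule image_eqI[where f = "\<lambda>z. snd z + replicate_mset (fst z) i"])
next
  fix k assume "k \<in> (\<lambda>z. snd z + replicate_mset (fst z) i) `
    ({..count m i} \<times> {k. k \<subseteq># filter_mset (\<lambda>x. x \<noteq> i) m})"
  then obtain j l where k: "k = l + replicate_mset j i" "j \<le> count m i" "l \<subseteq># filter_mset (\<lambda>x. x \<noteq> i) m"
    by auto
  have "count k x \<le> count m x" for x
    using k(2) mset_subset_eq_count[OF k(3), of x] by (cases "x = i") (simp_all add: k(1))
  then show "k \<in> {k. k \<subseteq># m}" by (simp add: subseteq_mset_def)
qed

text \<open>
  The coefficient of \<open>i\<^sup>n l\<close>, for \<open>l\<close> not containing \<open>i\<close>, is the coefficient at \<open>l\<close> of the \<open>n\<close>-th
  coefficient. Multiplicativity holds because a divisor of a monomial splits into a power of \<open>i\<close> and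
  a divisor of the rest.
\<close>

lemma (in cring) power_series_insert_variable:
  fixes I :: "'i set"
  assumes i: "i \<notin> I"
  shows "(\<lambda>u m. ps_coeff u (count m i) (filter_mset (\<lambda>x. x \<noteq> i) m))
    \<in> ring_iso (power_series_ring (power_series_ring R I) {()}) (power_series_ring R (insert i I))"
proof -
  let ?S = "power_series_ring R I"
  let ?T = "power_series_ring ?S {()}"
  let ?P = "power_series_ring R (insert i I)"
  let ?del = "\<lambda>m :: 'i multiset. filter_mset (\<lambda>x. x \<noteq> i) m"
  let ?h = "\<lambda>u m. ps_coeff u (count m i) (?del m)"
  let ?g = "\<lambda>f. ps_seq (\<lambda>n l. if set_mset l \<subseteq> I then f (l + replicate_mset n i) else \<zero>)"
  interpret S: cring ?S by (rule power_series_cring)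
  interpret U: univariate_series ?S ?T by (intro univariate_series.intro S.is_cring)
  have coeff: "ps_coeff u n l \<in> carrier R" if "u \<in> carrier ?T" for u n l
    using U.coeff_closed[OF that] by (rule power_series_coeff_closed)
  have vanish: "ps_coeff u n l = \<zero>" if "u \<in> carrier ?T" "\<not> set_mset l \<subseteq> I" for u n l
    using U.coeff_closed[OF that(1), of n] that(2) by (simp add: power_series_carrier)
  have del: "set_mset (?del m) \<subseteq> I \<longleftrightarrow> set_mset m \<subseteq> insert i I" for m by auto
  have hmult: "?h (u \<otimes>\<^bsub>?T\<^esub> v) m = (?h u \<otimes>\<^bsub>?P\<^esub> ?h v) m"
    if u: "u \<in> carrier ?T" and v: "v \<in> carrier ?T" for u v and m :: "'i multiset"
  proof -
    let ?n = "count m i"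
    let ?Z = "{..?n} \<times> {k. k \<subseteq># ?del m}"
    let ?j = "\<lambda>z. snd z + replicate_mset (fst z) i"
    have inj: "inj_on ?j ?Z"
    proof (rule inj_on_inverseI[where g = "\<lambda>k. (count k i, ?del k)"])
      fix z assume "z \<in> ?Z"
      then have "snd z \<subseteq># ?del m" by auto
      then have "i \<notin># snd z" by (auto dest: mset_subset_eqD)
      then have "count (?j z) i = fst z" "?del (?j z) = snd z"
        by (auto simp: not_in_iff multiset_eq_iff)
      then show "(count (?j z) i, ?del (?j z)) = z" by simp
    qed
    have part: "count (?j z) i = fst z" "?del (?j z) = snd z"
      "count (m - ?j z) i = ?n - fst z" "?del (m - ?j z) = ?del m - snd z" if "z \<in> ?Z" for z
    proof -
      have "snd z \<subseteq># ?del m" using that by auto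
      then have "i \<notin># snd z" by (auto dest: mset_subset_eqD)
      then show "count (?j z) i = fst z" "?del (?j z) = snd z"
        "count (m - ?j z) i = ?n - fst z" "?del (m - ?j z) = ?del m - snd z"
        by (auto simp: not_in_iff multiset_eq_iff)
    qed
    have "?h (u \<otimes>\<^bsub>?T\<^esub> v) m = (\<Oplus>\<^bsub>?S\<^esub>j\<in>{..?n}. ps_coeff u j \<otimes>\<^bsub>?S\<^esub> ps_coeff v (?n - j)) (?del m)"
      using u v by (simp add: U.coeff_mult)
    also have "\<dots> = (\<Oplus>j\<in>{..?n}. (ps_coeff u j \<otimes>\<^bsub>?S\<^esub> ps_coeff v (?n - j)) (?del m))"
      using u v by (intro power_series_finsum) auto
    also have "\<dots> = (\<Oplus>j\<in>{..?n}. \<Oplus>l\<in>{k. k \<subseteq># ?del m}.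
        ps_coeff u j l \<otimes> ps_coeff v (?n - j) (?del m - l))"
      by (simp add: power_series_mult)
    also have "\<dots> = (\<Oplus>z\<in>?Z. ps_coeff u (fst z) (snd z) \<otimes> ps_coeff v (?n - fst z) (?del m - snd z))"
      using coeff u v by (intro finsum_Sigma) (auto simp: finite_submultisets)
    also have "\<dots> = (\<Oplus>z\<in>?Z. ?h u (?j z) \<otimes> ?h v (m - ?j z))"
      using coeff u v by (intro finsum_cong') (auto simp only: part Pi_iff m_closed)
    also have "\<dots> = (\<Oplus>k\<in>?j ` ?Z. ?h u k \<otimes> ?h v (m - k))"
      using coeff u v by (intro finsum_reindex[symmetric, OF _ inj]) auto
    also have "\<dots> = (?h u \<otimes>\<^bsub>?P\<^esub> ?h v) m"
      unfolding submultisets_split[symmetric] by (simp add: power_series_mult)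
    finally show ?thesis .
  qed
  show ?thesis
  proof (rule ring_iso_memI)
    fix u v assume u: "u \<in> carrier ?T" and v: "v \<in> carrier ?T"
    show "?h u \<in> carrier ?P"
      using u coeff vanish del by (simp add: power_series_carrier)
    show "?h (u \<otimes>\<^bsub>?T\<^esub> v) = ?h u \<otimes>\<^bsub>?P\<^esub> ?h v" using hmult[OF u v] by (rule ext)
    show "?h (u \<oplus>\<^bsub>?T\<^esub> v) = ?h u \<oplus>\<^bsub>?P\<^esub> ?h v" by (rule ext) (simp add: U.coeff_add)
  next
    show "?h \<one>\<^bsub>?T\<^esub> = \<one>\<^bsub>?P\<^esub>"
    proof
      fix m :: "'i multiset"
      have m: "m = {#}" if "count m i = 0" "?del m = {#}"
      proof (rule multiset_eqI)
        fix x
        show "count m x = count {#} x"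
          using that arg_cong[OF that(2), of "\<lambda>l. count l x"] by (cases "x = i") simp_all
      qed
      show "?h \<one>\<^bsub>?T\<^esub> m = \<one>\<^bsub>?P\<^esub> m"
      proof (cases "m = {#}")
        case True
        then show ?thesis by (simp only: U.coeff_one) (simp add: power_series_one)
      next
        case False
        then have "count m i \<noteq> 0 \<or> ?del m \<noteq> {#}" using m by blast
        then have "?h \<one>\<^bsub>?T\<^esub> m = \<zero>"
        proof
          assume "count m i \<noteq> 0"
          then show ?thesis by (simp only: U.coeff_one if_False power_series_zero)
        next
          assume "?del m \<noteq> {#}"
          then have "\<one>\<^bsub>?S\<^esub> (?del m) = \<zero>" by (simp only: power_series_one if_False)
          then show ?thesis unfolding U.coeff_one by (cases "count m i = 0") (simp_all only: simp_thms if_True if_False power_series_zero)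
        qed
        with False show ?thesis by (simp add: power_series_one)
      qed
    qed
  next
    have gc: "?g f \<in> carrier ?T" if f: "f \<in> carrier ?P" for f
    proof (rule U.seq_closed)
      fix n
      have "f m \<in> carrier R" for m using f by (simp add: power_series_carrier)
      then show "(\<lambda>l. if set_mset l \<subseteq> I then f (l + replicate_mset n i) else \<zero>) \<in> carrier ?S"
        by (simp add: power_series_carrier)
    qed
    have gh: "?g (?h u) = u" if "u \<in> carrier ?T" for u
    proof (rule ps_eqI, rule ext)
      fix n and l :: "'i multiset"
      show "ps_coeff (?g (?h u)) n l = ps_coeff u n l"
      proof (cases "set_mset l \<subseteq> I")
        case True
        then have "i \<notin># l" using i by auto
        then have "count (l + replicate_mset n i) i = n" "?del (l + replicate_mset n i) = l"
          by (auto simp: not_in_iff multiset_eq_iff)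
        with True show ?thesis by simp
      next
        case False
        then show ?thesis using vanish[OF that] by simp
      qed
    qed
    have hg: "?h (?g f) = f" if "f \<in> carrier ?P" for f
    proof
      fix m :: "'i multiset"
      have "?del m + replicate_mset (count m i) i = m" by (rule multiset_eqI) simp
      then show "?h (?g f) m = f m"
        using that del[of m] by (simp add: power_series_carrier)
    qed
    show "bij_betw ?h (carrier ?T) (carrier ?P)"
    proof (rule bij_betw_byWitness[where f' = ?g])
      show "?h ` carrier ?T \<subseteq> carrier ?P"
        using coeff vanish del by (auto simp: power_series_carrier)
    qed (use gh hg gc in auto)
  qed
qed

theorem frobenius_noetherian_power_series:
  assumes R: "frobenius_noetherian p R" and I: "finite I"
  shows "frobenius_noetherian p (power_series_ring R I)"
  using I
proof (induction I rule: finite_induct)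
  interpret R: char_p_ring R p using R by (simp add: frobenius_noetherian_def)
  {
    case empty
    show ?case
      by (rule frobenius_noetherian_iso[OF R R.power_series_cring R.power_series_no_variables])
  next
    case (insert i I)
    show ?case
      by (rule frobenius_noetherian_iso[OF frobenius_noetherian_series[OF insert.IH]
            R.power_series_cring R.power_series_insert_variable[OF insert.hyps(2)]])
  }
qed

section \<open>Reduction modulo a linear factor\<close>

lemma (in ideal) quotient_zero_iff:
  assumes "t \<in> carrier R"
  shows "I +> t = \<zero>\<^bsub>R Quot I\<^esub> \<longleftrightarrow> t \<in> I"
proof
  assume "I +> t = \<zero>\<^bsub>R Quot I\<^esub>"
  then have "I +> t = I" by (simp add: FactRing_def)
  then show "t \<in> I" using a_rcos_self[OF assms] by simp
next
  assume "t \<in> I"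
  then show "I +> t = \<zero>\<^bsub>R Quot I\<^esub>" by (simp add: FactRing_def a_rcos_const)
qed

context univariate_series
begin

text \<open>
  Modulo \<open>Y - c\<close> the factor \<open>Y\<^sup>k\<close> in \<open>t = \<Sum>\<^sub>k Y\<^sup>k t\<^sub>k(Y\<^sup>L)\<close>, \<open>k < L\<close>, may be replaced by \<open>c\<^sup>k\<close>, which leaves
  the series \<open>(\<Sum>\<^sub>k c\<^sup>k t\<^sub>k)(Y\<^sup>L)\<close> in \<open>Y\<^sup>L\<close>. So this operation retracts \<open>R[[Y]]\<close> onto \<open>R[[Y\<^sup>L]]\<close>,
  written as series in \<open>Y\<close>, without changing residue classes.
\<close>

definition reduce_root :: "nat \<Rightarrow> 'a \<Rightarrow> (unit multiset \<Rightarrow> 'a) \<Rightarrow> unit multiset \<Rightarrow> 'a" where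
  "reduce_root L c t = (\<Oplus>\<^bsub>P\<^esub>k\<in>{..<L}. const (c [^] k) \<otimes>\<^bsub>P\<^esub> decim L k t)"

lemma reduce_root_closed [simp]: "c \<in> carrier R \<Longrightarrow> t \<in> carrier P \<Longrightarrow> reduce_root L c t \<in> carrier P"
  unfolding reduce_root_def by (intro P.finsum_closed) auto

lemma reduce_root_add:
  assumes "c \<in> carrier R" "t \<in> carrier P" "u \<in> carrier P"
  shows "reduce_root L c (t \<oplus>\<^bsub>P\<^esub> u) = reduce_root L c t \<oplus>\<^bsub>P\<^esub> reduce_root L c u"
proof -
  have "reduce_root L c (t \<oplus>\<^bsub>P\<^esub> u) = (\<Oplus>\<^bsub>P\<^esub>k\<in>{..<L}. const (c [^] k) \<otimes>\<^bsub>P\<^esub> decim L k t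
      \<oplus>\<^bsub>P\<^esub> const (c [^] k) \<otimes>\<^bsub>P\<^esub> decim L k u)"
    unfolding reduce_root_def using assms by (intro P.finsum_cong') (auto simp: decim_add P.r_distr)
  also have "\<dots> = reduce_root L c t \<oplus>\<^bsub>P\<^esub> reduce_root L c u"
    unfolding reduce_root_def using assms by (intro P.finsum_addf) auto
  finally show ?thesis .
qed

lemma reduce_root_stretch_mult:
  assumes "L > 0" "c \<in> carrier R" "w \<in> carrier P" "t \<in> carrier P"
  shows "reduce_root L c (stretch L w \<otimes>\<^bsub>P\<^esub> t) = w \<otimes>\<^bsub>P\<^esub> reduce_root L c t"
proof -
  have "reduce_root L c (stretch L w \<otimes>\<^bsub>P\<^esub> t)
      = (\<Oplus>\<^bsub>P\<^esub>k\<in>{..<L}. w \<otimes>\<^bsub>P\<^esub> (const (c [^] k) \<otimes>\<^bsub>P\<^esub> decim L k t))"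
    unfolding reduce_root_def using assms
    by (intro P.finsum_cong') (auto simp: decim_stretch_mult P.m_lcomm)
  also have "\<dots> = w \<otimes>\<^bsub>P\<^esub> reduce_root L c t"
    unfolding reduce_root_def using assms by (intro P.finsum_rdistr[symmetric]) auto
  finally show ?thesis .
qed

lemma reduce_root_stretch:
  assumes "L > 0" "c \<in> carrier R" "w \<in> carrier P"
  shows "reduce_root L c (stretch L w) = w"
proof -
  have "reduce_root L c (stretch L w) = (\<Oplus>\<^bsub>P\<^esub>k\<in>{..<L}. if k = 0 then w else \<zero>\<^bsub>P\<^esub>)"
    unfolding reduce_root_def using assms
    by (intro P.finsum_cong') (auto simp: decim_stretch)
  also have "\<dots> = w"
    using assms P.add.finprod_singleton_swap[of 0 "{..<L}" "\<lambda>_. w"] by simp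
  finally show ?thesis .
qed

text \<open>
  Multiplication by \<open>Y\<close> moves \<open>t\<^sub>k\<close> to the place \<open>k + 1\<close>, which amounts to the factor \<open>c\<close>, except for
  the last part: it wraps around to the place \<open>0\<close> with a factor \<open>Y\<close> where \<open>c\<^sup>L\<close> would have been
  needed. Hence everything but this part cancels.
\<close>

lemma reduce_root_linear_factor:
  assumes L: "L > 0" and c: "c \<in> carrier R" and u: "u \<in> carrier P"
  shows "reduce_root L c ((Y \<ominus>\<^bsub>P\<^esub> const c) \<otimes>\<^bsub>P\<^esub> u) = (Y \<ominus>\<^bsub>P\<^esub> const (c [^] L)) \<otimes>\<^bsub>P\<^esub> decim L (L - 1) u"
proof -
  obtain l where l: "L = Suc l" using L by (cases L) auto
  \<comment> \<open>the terms common to the reductions of \<open>Y u\<close> and \<open>c u\<close>\<close>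
  define s where "s k = const (c [^] Suc k) \<otimes>\<^bsub>P\<^esub> decim L k u" for k
  have s: "s k \<in> carrier P" for k using c u by (simp add: s_def)
  have shift: "(\<Oplus>\<^bsub>P\<^esub>k\<in>{..<l}. s k) \<in> carrier P" using s by (intro P.finsum_closed) auto
  have Yu: "reduce_root L c (Y \<otimes>\<^bsub>P\<^esub> u) = Y \<otimes>\<^bsub>P\<^esub> decim L l u \<oplus>\<^bsub>P\<^esub> (\<Oplus>\<^bsub>P\<^esub>k\<in>{..<l}. s k)"
  proof -
    have "reduce_root L c (Y \<otimes>\<^bsub>P\<^esub> u) = const (c [^] (0::nat)) \<otimes>\<^bsub>P\<^esub> decim L 0 (Y \<otimes>\<^bsub>P\<^esub> u)
        \<oplus>\<^bsub>P\<^esub> (\<Oplus>\<^bsub>P\<^esub>k\<in>Suc ` {..<l}. const (c [^] k) \<otimes>\<^bsub>P\<^esub> decim L k (Y \<otimes>\<^bsub>P\<^esub> u))"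
    proof -
      have "{..<L} = insert 0 (Suc ` {..<l})" by (simp add: l lessThan_Suc_eq_insert_0)
      then show ?thesis unfolding reduce_root_def
        using c u by (simp only:) (subst P.finsum_insert, auto)
    qed
    also have "(\<Oplus>\<^bsub>P\<^esub>k\<in>Suc ` {..<l}. const (c [^] k) \<otimes>\<^bsub>P\<^esub> decim L k (Y \<otimes>\<^bsub>P\<^esub> u))
        = (\<Oplus>\<^bsub>P\<^esub>k\<in>{..<l}. const (c [^] Suc k) \<otimes>\<^bsub>P\<^esub> decim L (Suc k) (Y \<otimes>\<^bsub>P\<^esub> u))"
      using c u by (intro P.finsum_reindex) (auto simp del: R.nat_pow_Suc)
    also have "\<dots> = (\<Oplus>\<^bsub>P\<^esub>k\<in>{..<l}. s k)"
      using s by (intro P.finsum_cong') (auto simp: s_def decim_Y_mult[OF u] simp del: R.nat_pow_Suc)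
    also have "const (c [^] (0::nat)) \<otimes>\<^bsub>P\<^esub> decim L 0 (Y \<otimes>\<^bsub>P\<^esub> u) = Y \<otimes>\<^bsub>P\<^esub> decim L l u"
      using decim_Y_mult_0[OF u L] u by (simp add: l)
    finally show ?thesis .
  qed
  have cu: "reduce_root L c (const c \<otimes>\<^bsub>P\<^esub> u) = s l \<oplus>\<^bsub>P\<^esub> (\<Oplus>\<^bsub>P\<^esub>k\<in>{..<l}. s k)"
  proof -
    have "reduce_root L c (const c \<otimes>\<^bsub>P\<^esub> u) = (\<Oplus>\<^bsub>P\<^esub>k\<in>{..<L}. s k)"
      unfolding reduce_root_def using c u s
      by (intro P.finsum_cong') (auto simp: s_def decim_const_mult P.m_assoc)
    also have "{..<L} = insert l {..<l}" by (auto simp: l)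
    also have "(\<Oplus>\<^bsub>P\<^esub>k\<in>insert l {..<l}. s k) = s l \<oplus>\<^bsub>P\<^esub> (\<Oplus>\<^bsub>P\<^esub>k\<in>{..<l}. s k)"
      using s by (intro P.finsum_insert) auto
    finally show ?thesis .
  qed
  let ?v = "(Y \<ominus>\<^bsub>P\<^esub> const c) \<otimes>\<^bsub>P\<^esub> u"
  have Dl: "decim L l u \<in> carrier P" using u by simp
  have v: "?v \<in> carrier P" "const c \<otimes>\<^bsub>P\<^esub> u \<in> carrier P" using c u by simp_all
  have "?v \<oplus>\<^bsub>P\<^esub> const c \<otimes>\<^bsub>P\<^esub> u = Y \<otimes>\<^bsub>P\<^esub> u"
    using c u Y_closed const_closed[OF c] by algebra
  then have "reduce_root L c ?v \<oplus>\<^bsub>P\<^esub> reduce_root L c (const c \<otimes>\<^bsub>P\<^esub> u) = reduce_root L c (Y \<otimes>\<^bsub>P\<^esub> u)"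
    using reduce_root_add[OF c v, of L] by simp
  then have "reduce_root L c ?v \<oplus>\<^bsub>P\<^esub> s l \<oplus>\<^bsub>P\<^esub> (\<Oplus>\<^bsub>P\<^esub>k\<in>{..<l}. s k)
      = Y \<otimes>\<^bsub>P\<^esub> decim L l u \<oplus>\<^bsub>P\<^esub> (\<Oplus>\<^bsub>P\<^esub>k\<in>{..<l}. s k)"
    unfolding Yu cu using reduce_root_closed[OF c v(1)] s shift by (simp only: P.a_assoc)
  then have "reduce_root L c ?v \<oplus>\<^bsub>P\<^esub> s l = Y \<otimes>\<^bsub>P\<^esub> decim L l u"
    using reduce_root_closed[OF c v(1)] s shift Dl by simp
  moreover have "s l = const (c [^] L) \<otimes>\<^bsub>P\<^esub> decim L l u" by (simp only: s_def l)
  ultimately have *: "reduce_root L c ?v \<oplus>\<^bsub>P\<^esub> const (c [^] L) \<otimes>\<^bsub>P\<^esub> decim L l u = Y \<otimes>\<^bsub>P\<^esub> decim L l u"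
    by simp
  have cL: "const (c [^] L) \<in> carrier P" using c by simp
  have "reduce_root L c ?v = (reduce_root L c ?v \<oplus>\<^bsub>P\<^esub> const (c [^] L) \<otimes>\<^bsub>P\<^esub> decim L l u) \<ominus>\<^bsub>P\<^esub> const (c [^] L) \<otimes>\<^bsub>P\<^esub> decim L l u"
    using reduce_root_closed[OF c v(1), of L] cL Dl by algebra
  also have "\<dots> = (Y \<ominus>\<^bsub>P\<^esub> const (c [^] L)) \<otimes>\<^bsub>P\<^esub> decim L l u"
    unfolding * using cL Dl Y_closed by algebra
  finally show ?thesis by (simp only: l diff_Suc_1)
qed

lemma hom_stretch_reduce_root:
  assumes L: "L > 0" and c: "c \<in> carrier R" and t: "t \<in> carrier P"
    and "ring_hom_cring P B \<pi>" and Yc: "\<pi> Y = \<pi> (const c)"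
  shows "\<pi> (stretch L (reduce_root L c t)) = \<pi> t"
proof -
  interpret B: ring_hom_cring P B \<pi> by fact
  interpret st: ring_hom_cring P P "stretch L"
    by (intro ring_hom_cring.intro ring_hom_cring_axioms.intro P.is_cring stretch_hom L)
  have "stretch L (reduce_root L c t) = (\<Oplus>\<^bsub>P\<^esub>k\<in>{..<L}. stretch L (const (c [^] k) \<otimes>\<^bsub>P\<^esub> decim L k t))"
    unfolding reduce_root_def using st.hom_finsum[of "\<lambda>k. const (c [^] k) \<otimes>\<^bsub>P\<^esub> decim L k t" "{..<L}"] c t
    by (simp add: o_def Pi_def)
  also have "\<dots> = (\<Oplus>\<^bsub>P\<^esub>k\<in>{..<L}. const (c [^] k) \<otimes>\<^bsub>P\<^esub> stretch L (decim L k t))"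
    using c t L by (intro P.finsum_cong') (auto simp: stretch_const)
  finally have 1: "\<pi> (stretch L (reduce_root L c t))
      = (\<Oplus>\<^bsub>B\<^esub>k\<in>{..<L}. \<pi> (const (c [^] k) \<otimes>\<^bsub>P\<^esub> stretch L (decim L k t)))"
    using B.hom_finsum[of "\<lambda>k. const (c [^] k) \<otimes>\<^bsub>P\<^esub> stretch L (decim L k t)" "{..<L}"] c t
    by (simp add: o_def Pi_def)
  have 2: "\<pi> t = (\<Oplus>\<^bsub>B\<^esub>k\<in>{..<L}. \<pi> (stretch L (decim L k t) \<otimes>\<^bsub>P\<^esub> Y [^]\<^bsub>P\<^esub> k))"
    using B.hom_finsum[of "\<lambda>k. stretch L (decim L k t) \<otimes>\<^bsub>P\<^esub> Y [^]\<^bsub>P\<^esub> k" "{..<L}"] t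
      decim_expansion[OF L t] by (simp add: o_def Pi_def)
  show ?thesis unfolding 1 2
  proof (rule B.S.finsum_cong')
    fix k :: nat
    have "\<pi> (const (c [^] k)) = \<pi> (Y [^]\<^bsub>P\<^esub> k)"
      using c by (simp add: const_pow B.hom_pow Yc)
    then show "\<pi> (const (c [^] k) \<otimes>\<^bsub>P\<^esub> stretch L (decim L k t)) = \<pi> (stretch L (decim L k t) \<otimes>\<^bsub>P\<^esub> Y [^]\<^bsub>P\<^esub> k)"
      using c t by (simp add: B.S.m_comm)
  qed (use t in auto)
qed

end

context univariate_frobenius
begin

text \<open>
  The coordinates, with respect to the basis \<open>b\<close>, of \<open>R[[Y]]/(Y - c)\<close> as a module over itself
  through \<open>a \<mapsto> a\<^sup>Q\<close>, lifted to series.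
\<close>

definition root_coord :: "'a \<Rightarrow> 'i \<Rightarrow> (unit multiset \<Rightarrow> 'a) \<Rightarrow> unit multiset \<Rightarrow> 'a" where
  "root_coord c i t = kap i (reduce_root Q c t)"

lemma root_coord_closed [simp]:
  "c \<in> carrier R \<Longrightarrow> i \<in> I \<Longrightarrow> t \<in> carrier P \<Longrightarrow> root_coord c i t \<in> carrier P"
  by (simp add: root_coord_def)

lemma root_coord_add:
  assumes "c \<in> carrier R" "i \<in> I" "t \<in> carrier P" "u \<in> carrier P"
  shows "root_coord c i (t \<oplus>\<^bsub>P\<^esub> u) = root_coord c i t \<oplus>\<^bsub>P\<^esub> root_coord c i u"
  using assms by (simp add: root_coord_def reduce_root_add kap_add)

lemma root_coord_mult:
  assumes "c \<in> carrier R" "i \<in> I" "a \<in> carrier P" "t \<in> carrier P"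
  shows "root_coord c i (stretch Q (cpow Q a) \<otimes>\<^bsub>P\<^esub> t) = a \<otimes>\<^bsub>P\<^esub> root_coord c i t"
  using assms by (simp add: root_coord_def reduce_root_stretch_mult[OF q_pos] kap_cpow_mult)

lemma root_coord_surj:
  assumes "c \<in> carrier R" "w \<in> I \<rightarrow> carrier P"
  shows "\<exists>t\<in>carrier P. \<forall>i\<in>I. root_coord c i t = w i"
proof (rule bexI[where x = "stretch Q (\<Oplus>\<^bsub>P\<^esub>j\<in>I. cpow Q (w j) \<otimes>\<^bsub>P\<^esub> const (b j))"])
  have cl: "w j \<in> carrier P" if "j \<in> I" for j using assms that by auto
  have closed: "(\<Oplus>\<^bsub>P\<^esub>j\<in>I. cpow Q (w j) \<otimes>\<^bsub>P\<^esub> const (b j)) \<in> carrier P"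
    using cl by (intro P.finsum_closed) auto
  then show "stretch Q (\<Oplus>\<^bsub>P\<^esub>j\<in>I. cpow Q (w j) \<otimes>\<^bsub>P\<^esub> const (b j)) \<in> carrier P" by simp
  show "\<forall>i\<in>I. root_coord c i (stretch Q (\<Oplus>\<^bsub>P\<^esub>j\<in>I. cpow Q (w j) \<otimes>\<^bsub>P\<^esub> const (b j))) = w i"
    unfolding root_coord_def reduce_root_stretch[OF q_pos assms(1) closed] using kap_coord[OF assms(2)] by blast
qed

lemma cpow_linear_factor:
  assumes c: "c \<in> carrier R"
  shows "cpow Q (Y \<ominus>\<^bsub>P\<^esub> const c) = Y \<ominus>\<^bsub>P\<^esub> const (c [^] Q)"
proof -
  interpret cp: ring_hom_cring P P "cpow Q"
    by (intro ring_hom_cring.intro ring_hom_cring_axioms.intro P.is_cring cpow_hom)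
  have "cpow Q (\<ominus>\<^bsub>P\<^esub> const c) = \<ominus>\<^bsub>P\<^esub> cpow Q (const c)"
    using c by (intro cp.hom_a_inv) simp
  then show ?thesis
    using c by (simp add: P.minus_eq cpow_Y[OF q_pos] cpow_const[OF c q_pos])
qed

text \<open>
  The coordinates are compatible with passing to residue classes and determine them. From left to
  right: a multiple of \<open>Y - c\<close> is carried to a multiple of \<open>Y - c\<^sup>Q\<close>, which is the coefficientwise
  \<open>Q\<close>-th power of \<open>Y - c\<close> and hence comes out of \<open>kap i\<close> as \<open>Y - c\<close>. From right to left: modulo
  \<open>Y - c\<close>, \<open>t\<close> is the combination of the \<open>b\<^sub>i\<close> with the \<open>Q\<close>-th powers of its coordinates.
\<close>

lemma linear_factor_dvd_iff:
  assumes c: "c \<in> carrier R" and t: "t \<in> carrier P"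
  shows "t \<in> PIdl\<^bsub>P\<^esub> (Y \<ominus>\<^bsub>P\<^esub> const c)
    \<longleftrightarrow> (\<forall>i\<in>I. root_coord c i t \<in> PIdl\<^bsub>P\<^esub> (Y \<ominus>\<^bsub>P\<^esub> const c))"
proof
  let ?g = "Y \<ominus>\<^bsub>P\<^esub> const c"
  have g: "?g \<in> carrier P" using c by simp
  {
    assume "t \<in> PIdl\<^bsub>P\<^esub> ?g"
    then obtain u where u: "u \<in> carrier P" "t = u \<otimes>\<^bsub>P\<^esub> ?g" by (auto simp: cgenideal_def)
    show "\<forall>i\<in>I. root_coord c i t \<in> PIdl\<^bsub>P\<^esub> ?g"
    proof
      fix i assume i: "i \<in> I"
      have "t = ?g \<otimes>\<^bsub>P\<^esub> u" using u g by (simp add: P.m_comm)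
      then have "reduce_root Q c t = cpow Q ?g \<otimes>\<^bsub>P\<^esub> decim Q (Q - 1) u"
        using reduce_root_linear_factor[OF q_pos[of e] c u(1)] by (simp add: cpow_linear_factor[OF c])
      then have "root_coord c i t = ?g \<otimes>\<^bsub>P\<^esub> kap i (decim Q (Q - 1) u)"
        unfolding root_coord_def using kap_cpow_mult[OF i g] u by simp
      also have "\<dots> = kap i (decim Q (Q - 1) u) \<otimes>\<^bsub>P\<^esub> ?g"
        using g i u by (intro P.m_comm) auto
      finally show "root_coord c i t \<in> PIdl\<^bsub>P\<^esub> ?g"
        using i u unfolding cgenideal_def by auto
    qed
  }
  assume all: "\<forall>i\<in>I. root_coord c i t \<in> PIdl\<^bsub>P\<^esub> ?g"
  interpret G: ideal "PIdl\<^bsub>P\<^esub> ?g" P by (rule P.cgenideal_ideal[OF g])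
  let ?B = "P Quot PIdl\<^bsub>P\<^esub> ?g"
  let ?\<pi> = "\<lambda>t. PIdl\<^bsub>P\<^esub> ?g +>\<^bsub>P\<^esub> t"
  interpret \<pi>: ring_hom_cring P ?B ?\<pi> by (rule G.rcos_ring_hom_cring[OF P.is_cring])
  have "?\<pi> ?g = \<zero>\<^bsub>?B\<^esub>" using G.quotient_zero_iff[OF g] P.cgenideal_self[OF g] by blast
  moreover have "?\<pi> (?g \<oplus>\<^bsub>P\<^esub> const c) = ?\<pi> ?g \<oplus>\<^bsub>?B\<^esub> ?\<pi> (const c)"
    by (rule \<pi>.hom_add[OF g const_closed[OF c]])
  moreover have "?g \<oplus>\<^bsub>P\<^esub> const c = Y"
    using Y_closed const_closed[OF c] by algebra
  ultimately have Yc: "?\<pi> Y = ?\<pi> (const c)"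
    using \<pi>.hom_closed[OF const_closed[OF c]] by simp
  have comb: "(\<Oplus>\<^bsub>P\<^esub>i\<in>I. cpow Q (root_coord c i t) \<otimes>\<^bsub>P\<^esub> const (b i)) = reduce_root Q c t"
    unfolding root_coord_def by (rule kap_expansion) (use c t in simp)
  interpret st: ring_hom_cring P P "stretch Q"
    by (intro ring_hom_cring.intro ring_hom_cring_axioms.intro P.is_cring stretch_hom q_pos)
  have "?\<pi> t = ?\<pi> (stretch Q (\<Oplus>\<^bsub>P\<^esub>i\<in>I. cpow Q (root_coord c i t) \<otimes>\<^bsub>P\<^esub> const (b i)))"
    unfolding comb using hom_stretch_reduce_root[OF q_pos c t \<pi>.ring_hom_cring_axioms Yc] by simp
  also have "\<dots> = ?\<pi> (\<Oplus>\<^bsub>P\<^esub>i\<in>I. stretch Q (cpow Q (root_coord c i t) \<otimes>\<^bsub>P\<^esub> const (b i)))"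
    using st.hom_finsum[of "\<lambda>i. cpow Q (root_coord c i t) \<otimes>\<^bsub>P\<^esub> const (b i)" I] c t
    by (simp add: o_def Pi_def)
  also have "\<dots> = (\<Oplus>\<^bsub>?B\<^esub>i\<in>I. ?\<pi> (stretch Q (cpow Q (root_coord c i t) \<otimes>\<^bsub>P\<^esub> const (b i))))"
    using \<pi>.hom_finsum[of "\<lambda>i. stretch Q (cpow Q (root_coord c i t) \<otimes>\<^bsub>P\<^esub> const (b i))" I] c t
    by (simp add: o_def Pi_def)
  also have "\<dots> = \<zero>\<^bsub>?B\<^esub>"
  proof (rule \<pi>.S.add.finprod_one_eqI)
    fix i assume i: "i \<in> I"
    have r: "root_coord c i t \<in> carrier P" using c t i by simp
    have "?\<pi> (root_coord c i t) = \<zero>\<^bsub>?B\<^esub>" using all i G.quotient_zero_iff[OF r] by blast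
    then have "?\<pi> (root_coord c i t [^]\<^bsub>P\<^esub> Q) = \<zero>\<^bsub>?B\<^esub>"
      using r q_pos[of e] \<pi>.S.nat_pow_zero[of Q] by (simp only: \<pi>.hom_pow)
    then show "?\<pi> (stretch Q (cpow Q (root_coord c i t) \<otimes>\<^bsub>P\<^esub> const (b i))) = \<zero>\<^bsub>?B\<^esub>"
      using r i by (simp add: pow_q_series[symmetric])
  qed
  finally show "t \<in> PIdl\<^bsub>P\<^esub> ?g" using G.quotient_zero_iff[OF t] by simp
qed

end

section \<open>Restriction of scalars and direct sums of copies\<close>

definition restrict_scalars :: "('a \<Rightarrow> 'b) \<Rightarrow> ('b, 'c) ring_scheme \<Rightarrow> ('a, 'b) module" where
  "restrict_scalars \<phi> B =
    \<lparr> carrier = carrier B, monoid.mult = monoid.mult B, one = one B,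
      ring.zero = ring.zero B, ring.add = ring.add B, smult = (\<lambda>a x. \<phi> a \<otimes>\<^bsub>B\<^esub> x) \<rparr>"

lemma restrict_scalars_simps [simp]:
  "carrier (restrict_scalars \<phi> B) = carrier B"
  "ring.zero (restrict_scalars \<phi> B) = ring.zero B"
  "ring.add (restrict_scalars \<phi> B) = ring.add B"
  "smult (restrict_scalars \<phi> B) a x = \<phi> a \<otimes>\<^bsub>B\<^esub> x"
  by (simp_all add: restrict_scalars_def)

lemma finsum_restrict_scalars [simp]: "finsum (restrict_scalars \<phi> B) = finsum B"
  by (simp add: finsum_def finprod_def restrict_scalars_def fun_eq_iff)

lemma module_restrict_scalars:
  assumes "ring_hom_cring A B \<phi>"
  shows "module A (restrict_scalars \<phi> B)"
proof -
  interpret \<phi>: ring_hom_cring A B \<phi> by fact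
  show ?thesis
  proof (rule moduleI)
    show "abelian_group (restrict_scalars \<phi> B)"
      by (rule abelian_groupI) (auto simp: \<phi>.S.a_ac intro: \<phi>.S.add.l_inv_ex)
  qed (auto simp: \<phi>.S.l_distr \<phi>.S.r_distr \<phi>.S.m_assoc \<phi>.R.is_cring)
qed

lemma frobenius_pushforward_eq:
  "frobenius_pushforward p e A (regular_module A) = restrict_scalars (\<lambda>a. a [^]\<^bsub>A\<^esub> (p ^ e)) A"
  by (simp add: frobenius_pushforward_def regular_module_def restrict_scalars_def)

lemma (in ideal) descend_to_quotient:
  assumes "\<And>t u. t \<in> carrier R \<Longrightarrow> u \<in> carrier R \<Longrightarrow> I +> t = I +> u \<Longrightarrow> H t = H u"
  shows "\<exists>h. \<forall>t\<in>carrier R. h (I +> t) = H t"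
proof (intro exI ballI)
  fix t assume t: "t \<in> carrier R"
  let ?u = "SOME u. u \<in> carrier R \<and> I +> u = I +> t"
  have "?u \<in> carrier R \<and> I +> ?u = I +> t"
    by (rule someI[of _ t]) (use t in simp)
  then have "H ?u = H t" using assms t by blast
  then show "(\<lambda>C. H (SOME u. u \<in> carrier R \<and> I +> u = C)) (I +> t) = H t" by simp
qed

text \<open>
  The multiplicities are taken to vanish except at the index \<open>j0\<close>, so that only copies of \<open>M j0\<close>
  occur.
\<close>

lemma module_isomorphic_copies:
  fixes M :: "nat \<Rightarrow> ('a, 'n) module" and U :: "('a, 'm, 'c) module_scheme" and N :: "('a, 'k, 'd) module_scheme"
  assumes iso: "module_isomorphic R N (M j0)" and j0: "j0 < s" and I: "finite I"
    and H: "bij_betw H (carrier U) (\<Pi>\<^sub>E i\<in>I. carrier N)"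
    and add: "\<And>x y i. x \<in> carrier U \<Longrightarrow> y \<in> carrier U \<Longrightarrow> i \<in> I \<Longrightarrow> H (x \<oplus>\<^bsub>U\<^esub> y) i = H x i \<oplus>\<^bsub>N\<^esub> H y i"
    and smult: "\<And>a x i. a \<in> carrier R \<Longrightarrow> x \<in> carrier U \<Longrightarrow> i \<in> I \<Longrightarrow> H (a \<odot>\<^bsub>U\<^esub> x) i = a \<odot>\<^bsub>N\<^esub> H x i"
  shows "\<exists>t :: nat \<Rightarrow> nat. module_isomorphic R U (direct_sum_module (SIGMA j:{..<s}. {..<t j}) (\<lambda>(j, i). M j))"
proof -
  obtain \<theta> where \<theta>: "bij_betw \<theta> (carrier N) (carrier (M j0))"
    and \<theta>add: "\<And>x y. x \<in> carrier N \<Longrightarrow> y \<in> carrier N \<Longrightarrow> \<theta> (x \<oplus>\<^bsub>N\<^esub> y) = \<theta> x \<oplus>\<^bsub>M j0\<^esub> \<theta> y"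
    and \<theta>smult: "\<And>a x. a \<in> carrier R \<Longrightarrow> x \<in> carrier N \<Longrightarrow> \<theta> (a \<odot>\<^bsub>N\<^esub> x) = a \<odot>\<^bsub>M j0\<^esub> \<theta> x"
    using iso unfolding module_isomorphic_def by blast
  obtain g where g: "bij_betw g {..<card I} I"
    using ex_bij_betw_nat_finite[OF I] by (auto simp: atLeast0LessThan)
  define t where "t j = (if j = j0 then card I else 0)" for j
  define J where "J = (SIGMA j:{..<s}. {..<t j})"
  have J: "J = {j0} \<times> {..<card I}" using j0 by (auto simp: J_def t_def split: if_splits)
  let ?D = "direct_sum_module J (\<lambda>(j, i). M j)"
  have carD: "carrier ?D = (\<Pi>\<^sub>E z\<in>J. carrier (M j0))"
  proof -
    have "finite J" by (simp add: J)
    then have "finite {z \<in> J. Q z}" for Q by simp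
    moreover have "(\<Pi>\<^sub>E z\<in>J. carrier ((\<lambda>(j, i). M j) z)) = (\<Pi>\<^sub>E z\<in>J. carrier (M j0))"
      by (rule PiE_cong) (auto simp: J)
    ultimately show ?thesis by (simp add: direct_sum_module_def)
  qed
  define h where "h x = (\<lambda>z\<in>J. \<theta> (H x (g (snd z))))" for x
  have gI: "g (snd z) \<in> I" if "z \<in> J" for z using that g by (auto simp: J bij_betw_def)
  have Hx: "H x i \<in> carrier N" if "x \<in> carrier U" "i \<in> I" for x i
    using H that by (auto simp: bij_betw_def)
  have \<theta>c: "\<theta> x \<in> carrier (M j0)" if "x \<in> carrier N" for x
    using \<theta> that by (auto simp: bij_betw_def)
  have inj: "inj_on h (carrier U)"
  proof (rule inj_onI)
    fix x y assume x: "x \<in> carrier U" and y: "y \<in> carrier U" and eq: "h x = h y"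
    have "H x i = H y i" if i: "i \<in> I" for i
    proof -
      have "i \<in> g ` {..<card I}" using i bij_betw_imp_surj_on[OF g] by (simp only:)
      then obtain n where n: "n < card I" "g n = i" by (elim imageE) simp
      have "(j0, n) \<in> J" using n by (simp add: J)
      then have "\<theta> (H x i) = \<theta> (H y i)"
        using fun_cong[OF eq, of "(j0, n)"] n by (simp add: h_def)
      then show ?thesis using \<theta> Hx x y i by (auto simp: bij_betw_def inj_on_def)
    qed
    moreover have "H x \<in> (\<Pi>\<^sub>E i\<in>I. carrier N)" "H y \<in> (\<Pi>\<^sub>E i\<in>I. carrier N)"
      using H x y by (auto simp: bij_betw_def)
    ultimately have "H x = H y" by (intro PiE_ext) auto
    then show "x = y" using H x y by (auto simp: bij_betw_def inj_on_def)
  qed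
  have surj: "h ` carrier U = carrier ?D"
  proof (intro equalityI subsetI)
    fix y assume "y \<in> h ` carrier U"
    then show "y \<in> carrier ?D" unfolding carD h_def using \<theta>c Hx gI by auto
  next
    fix y assume y: "y \<in> carrier ?D"
    define v where "v = (\<lambda>i\<in>I. the_inv_into (carrier N) \<theta> (y (j0, the_inv_into {..<card I} g i)))"
    have ginv: "the_inv_into {..<card I} g i < card I" "g (the_inv_into {..<card I} g i) = i" if "i \<in> I" for i
      using that g the_inv_into_into[of g "{..<card I}" i "{..<card I}"]
      by (auto simp: bij_betw_def f_the_inv_into_f)
    have yM: "y (j0, n) \<in> \<theta> ` carrier N" if "n < card I" for n
      using y that \<theta> unfolding carD bij_betw_def by (auto simp: J)
    have vN: "v i \<in> carrier N" if "i \<in> I" for i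
      unfolding v_def using that yM ginv \<theta>
      by (auto simp: bij_betw_def intro!: the_inv_into_into)
    have "v \<in> (\<Pi>\<^sub>E i\<in>I. carrier N)" using vN by (auto simp: v_def)
    then have "v \<in> H ` carrier U" by (simp only: bij_betw_imp_surj_on[OF H])
    then obtain x where x: "x \<in> carrier U" "H x = v" by (elim imageE) simp
    have "h x = y"
    proof (rule PiE_ext)
      show "h x \<in> (\<Pi>\<^sub>E z\<in>J. carrier (M j0))" unfolding h_def using x(1) \<theta>c Hx gI by auto
      show "y \<in> (\<Pi>\<^sub>E z\<in>J. carrier (M j0))" using y carD by simp
      fix z assume z: "z \<in> J"
      then obtain n where n: "z = (j0, n)" "n < card I" by (auto simp: J)
      have "the_inv_into {..<card I} g (g n) = n"
        using g n(2) by (intro the_inv_into_f_f) (auto simp: bij_betw_def)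
      then have "v (g n) = the_inv_into (carrier N) \<theta> (y (j0, n))"
        using gI[OF z] n by (simp add: v_def)
      moreover have "\<theta> (the_inv_into (carrier N) \<theta> (y (j0, n))) = y (j0, n)"
        using yM[OF n(2)] \<theta> by (intro f_the_inv_into_f) (auto simp: bij_betw_def)
      ultimately show "h x z = y z" using z n x(2) by (simp add: h_def)
    qed
    then show "y \<in> h ` carrier U" using x(1) by blast
  qed
  have "h (x \<oplus>\<^bsub>U\<^esub> y) = h x \<oplus>\<^bsub>?D\<^esub> h y" if "x \<in> carrier U" "y \<in> carrier U" for x y
  proof
    fix z
    show "h (x \<oplus>\<^bsub>U\<^esub> y) z = (h x \<oplus>\<^bsub>?D\<^esub> h y) z"
      using that gI Hx by (cases "z \<in> J")
        (auto simp: h_def direct_sum_module_def add \<theta>add J)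
  qed
  moreover have "h (a \<odot>\<^bsub>U\<^esub> x) = a \<odot>\<^bsub>?D\<^esub> h x" if "a \<in> carrier R" "x \<in> carrier U" for a x
  proof
    fix z
    show "h (a \<odot>\<^bsub>U\<^esub> x) z = (a \<odot>\<^bsub>?D\<^esub> h x) z"
      using that gI Hx by (cases "z \<in> J")
        (auto simp: h_def direct_sum_module_def smult \<theta>smult J)
  qed
  ultimately have "module_isomorphic R U ?D"
    unfolding module_isomorphic_def using inj surj by (intro exI[of _ h]) (auto simp: bij_betw_def)
  then show ?thesis unfolding J_def by (rule exI[of _ t])
qed

text \<open>
  If \<open>n\<close> is not divisible by \<open>p\<close>, then \<open>n x = p y + 1\<close> for some \<open>x\<close> and \<open>y\<close>, so \<open>n = 0\<close> in \<open>A\<close> would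
  give \<open>1 = 0\<close>.
\<close>

lemma char_p_ring_cases:
  assumes "char_p_ring A p"
  shows "has_characteristic A p \<or> carrier A = {\<zero>\<^bsub>A\<^esub>}"
proof (cases "\<one>\<^bsub>A\<^esub> = \<zero>\<^bsub>A\<^esub>")
  interpret char_p_ring A p by fact
  {
    case True
    then show ?thesis using one_zeroD by auto
  next
    case False
    have "p dvd n" if n: "[n] \<cdot>\<^bsub>A\<^esub> \<one>\<^bsub>A\<^esub> = \<zero>\<^bsub>A\<^esub>" for n :: nat
    proof (rule ccontr)
      assume "\<not> p dvd n"
      then have "coprime p n" using prime_p by (rule prime_imp_coprime[rotated])
      then have "gcd n p = 1" by (simp add: coprime_iff_gcd_eq_1 gcd.commute)
      moreover have "n \<noteq> 0" using \<open>\<not> p dvd n\<close> dvd_0_right by metis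
      ultimately obtain x y where xy: "n * x = p * y + 1" using bezout_nat[of n p] by metis
      have "[(n * x)] \<cdot>\<^bsub>A\<^esub> \<one>\<^bsub>A\<^esub> = [x] \<cdot>\<^bsub>A\<^esub> ([n] \<cdot>\<^bsub>A\<^esub> \<one>\<^bsub>A\<^esub>)"
        by (rule add.nat_pow_pow[symmetric]) simp
      then have "[(n * x)] \<cdot>\<^bsub>A\<^esub> \<one>\<^bsub>A\<^esub> = \<zero>\<^bsub>A\<^esub>" by (simp add: n)
      moreover have "[(p * y + 1)] \<cdot>\<^bsub>A\<^esub> \<one>\<^bsub>A\<^esub> = \<one>\<^bsub>A\<^esub>"
        using p_multiple_zero[of "\<one>\<^bsub>A\<^esub>" "p * y"] by simp
      ultimately show False using False xy by simp
    qed
    moreover have "[n] \<cdot>\<^bsub>A\<^esub> \<one>\<^bsub>A\<^esub> = \<zero>\<^bsub>A\<^esub>" if "p dvd n" for n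
      using that by (intro p_multiple_zero) auto
    ultimately have "has_characteristic A p" unfolding has_characteristic_def by blast
    then show ?thesis by simp
  }
qed

section \<open>Frobenius pushforwards of the hypersurface\<close>

lemma carrier_quotient: "carrier (R Quot I) = (\<lambda>t. I +>\<^bsub>R\<^esub> t) ` carrier R"
  by (auto simp: FactRing_def A_RCOSETS_def')

text \<open>
  With \<open>c = -f\<close> the two polynomials are \<open>g = Y - c\<close> and \<open>h = Y\<^sup>q - c\<close>, and \<open>h = g(Y\<^sup>q)\<close> for
  \<open>q = p\<^sup>d\<close>.
\<close>

locale hypersurface = univariate_char_p R P p
  for R (structure) and P (structure) and p :: nat +
  fixes d :: nat and c :: 'a
  assumes c_closed [simp]: "c \<in> carrier R"
begin

abbreviation g where "g \<equiv> Y \<ominus>\<^bsub>P\<^esub> const c"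

abbreviation h where "h \<equiv> stretch (p ^ d) g"

abbreviation B where "B \<equiv> P Quot (PIdl\<^bsub>P\<^esub> g)"

abbreviation A where "A \<equiv> P Quot (PIdl\<^bsub>P\<^esub> h)"

abbreviation class_B where "class_B t \<equiv> PIdl\<^bsub>P\<^esub> g +>\<^bsub>P\<^esub> t"

abbreviation class_A where "class_A t \<equiv> PIdl\<^bsub>P\<^esub> h +>\<^bsub>P\<^esub> t"

lemma g_closed [simp]: "g \<in> carrier P" and h_closed [simp]: "h \<in> carrier P"
  by simp_all

lemma h_eq: "h = Y [^]\<^bsub>P\<^esub> (p ^ d) \<ominus>\<^bsub>P\<^esub> const c"
proof -
  interpret st: ring_hom_cring P P "stretch (p ^ d)"
    by (intro ring_hom_cring.intro ring_hom_cring_axioms.intro P.is_cring stretch_hom q_pos)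
  have "stretch (p ^ d) (\<ominus>\<^bsub>P\<^esub> const c) = \<ominus>\<^bsub>P\<^esub> stretch (p ^ d) (const c)"
    by (intro st.hom_a_inv) simp
  then show ?thesis
    by (simp add: P.minus_eq stretch_Y[OF q_pos] stretch_const[OF q_pos])
qed

lemma ideal_B: "ideal (PIdl\<^bsub>P\<^esub> g) P" and ideal_A: "ideal (PIdl\<^bsub>P\<^esub> h) P"
  by (simp_all add: P.cgenideal_ideal)

lemma class_B_hom: "ring_hom_cring P B class_B"
  by (rule ideal.rcos_ring_hom_cring[OF ideal_B P.is_cring])

lemma class_A_hom: "ring_hom_cring P A class_A"
  by (rule ideal.rcos_ring_hom_cring[OF ideal_A P.is_cring])

lemma class_B_zero: "t \<in> carrier P \<Longrightarrow> class_B t = \<zero>\<^bsub>B\<^esub> \<longleftrightarrow> t \<in> PIdl\<^bsub>P\<^esub> g"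
  by (rule ideal.quotient_zero_iff[OF ideal_B])

lemma class_A_zero: "t \<in> carrier P \<Longrightarrow> class_A t = \<zero>\<^bsub>A\<^esub> \<longleftrightarrow> t \<in> PIdl\<^bsub>P\<^esub> h"
  by (rule ideal.quotient_zero_iff[OF ideal_A])

lemma class_B_cases:
  assumes "x \<in> carrier B"
  obtains t where "t \<in> carrier P" "x = class_B t"
  using assms by (auto simp: carrier_quotient)

lemma class_A_cases:
  assumes "x \<in> carrier A"
  obtains t where "t \<in> carrier P" "x = class_A t"
  using assms by (auto simp: carrier_quotient)

sublocale B: cring B
  using class_B_hom by (simp add: ring_hom_cring_def)

sublocale A: cring A
  using class_A_hom by (simp add: ring_hom_cring_def)

lemma class_B_simps [simp]:
  "t \<in> carrier P \<Longrightarrow> class_B t \<in> carrier B"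
  "t \<in> carrier P \<Longrightarrow> u \<in> carrier P \<Longrightarrow> class_B (t \<oplus>\<^bsub>P\<^esub> u) = class_B t \<oplus>\<^bsub>B\<^esub> class_B u"
  "t \<in> carrier P \<Longrightarrow> u \<in> carrier P \<Longrightarrow> class_B (t \<otimes>\<^bsub>P\<^esub> u) = class_B t \<otimes>\<^bsub>B\<^esub> class_B u"
  using ring_hom_cring.homh[OF class_B_hom] by (auto simp: ring_hom_def)

lemma class_A_simps [simp]:
  "t \<in> carrier P \<Longrightarrow> class_A t \<in> carrier A"
  "t \<in> carrier P \<Longrightarrow> u \<in> carrier P \<Longrightarrow> class_A (t \<oplus>\<^bsub>P\<^esub> u) = class_A t \<oplus>\<^bsub>A\<^esub> class_A u"
  "t \<in> carrier P \<Longrightarrow> u \<in> carrier P \<Longrightarrow> class_A (t \<otimes>\<^bsub>P\<^esub> u) = class_A t \<otimes>\<^bsub>A\<^esub> class_A u"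
  using ring_hom_cring.homh[OF class_A_hom] by (auto simp: ring_hom_def)

lemma class_A_one: "class_A \<one>\<^bsub>P\<^esub> = \<one>\<^bsub>A\<^esub>" and class_B_one: "class_B \<one>\<^bsub>P\<^esub> = \<one>\<^bsub>B\<^esub>"
  by (simp_all add: FactRing_def)

lemma class_A_pow: "t \<in> carrier P \<Longrightarrow> class_A (t [^]\<^bsub>P\<^esub> (n::nat)) = class_A t [^]\<^bsub>A\<^esub> n"
  by (rule ring_hom_cring.hom_pow[OF class_A_hom])

lemma class_A_finsum:
  assumes "u \<in> I \<rightarrow> carrier P"
  shows "class_A (\<Oplus>\<^bsub>P\<^esub>i\<in>I. u i) = (\<Oplus>\<^bsub>A\<^esub>i\<in>I. class_A (u i))"
  using ring_hom_cring.hom_finsum[OF class_A_hom assms] by (simp add: o_def)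

lemma class_B_finsum:
  assumes "u \<in> I \<rightarrow> carrier P"
  shows "class_B (\<Oplus>\<^bsub>P\<^esub>i\<in>I. u i) = (\<Oplus>\<^bsub>B\<^esub>i\<in>I. class_B (u i))"
  using ring_hom_cring.hom_finsum[OF class_B_hom assms] by (simp add: o_def)

lemma char_p_A: "char_p_ring A p"
proof (intro char_p_ring.intro char_p_ring_axioms.intro A.is_cring prime_p)
  have "class_A ([p] \<cdot>\<^bsub>P\<^esub> \<one>\<^bsub>P\<^esub>) = [p] \<cdot>\<^bsub>A\<^esub> class_A \<one>\<^bsub>P\<^esub>"
    by (rule ring_hom_cring.hom_add_pow[OF class_A_hom P.one_closed])
  then show "[p] \<cdot>\<^bsub>A\<^esub> \<one>\<^bsub>A\<^esub> = \<zero>\<^bsub>A\<^esub>"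
    by (simp only: PC.char_p class_A_one ring_hom_cring.hom_zero[OF class_A_hom])
qed

lemma noetherian_A:
  assumes "noetherian_ring R"
  shows "noetherian_ring A"
proof (rule noetherian_ring_hom_image[OF noetherian_power_series[OF assms] A.ring_axioms])
  show "class_A \<in> ring_hom P A" by (rule ring_hom_cring.homh[OF class_A_hom])
  show "class_A ` carrier P = carrier A" by (simp add: carrier_quotient)
qed

text \<open>
  The coefficientwise \<open>q\<close>-th power of \<open>h = g(Y\<^sup>q)\<close> is \<open>g\<^sup>q\<close>; therefore coefficientwise powers descend
  to a homomorphism from \<open>A\<close> to \<open>B\<close>.
\<close>

lemma cpow_h: "cpow (p ^ d) h \<in> PIdl\<^bsub>P\<^esub> g"
proof -
  have "cpow (p ^ d) h = g [^]\<^bsub>P\<^esub> (p ^ d)"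
  proof (rule ps_eqI)
    fix n
    have "ps_coeff (cpow (p ^ d) h) n = ps_coeff (stretch (p ^ d) (cpow (p ^ d) g)) n"
      using q_pos[of d] by (simp only: ps_coeff_cmap coeff_stretch) (simp add: R.nat_pow_zero)
    then show "ps_coeff (cpow (p ^ d) h) n = ps_coeff (g [^]\<^bsub>P\<^esub> (p ^ d)) n"
      by (simp only: pow_q_series[OF g_closed])
  qed
  also have "\<dots> = g [^]\<^bsub>P\<^esub> (p ^ d - 1) \<otimes>\<^bsub>P\<^esub> g"
  proof -
    obtain m where "p ^ d = Suc m" using q_pos[of d] by (metis Suc_pred)
    then show ?thesis by (simp only: P.nat_pow_Suc diff_Suc_1)
  qed
  finally show ?thesis unfolding cgenideal_def using P.nat_pow_closed[OF g_closed] by blast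
qed

lemma ex_twist: "\<exists>\<phi>. \<forall>t\<in>carrier P. \<phi> (class_A t) = class_B (cpow (p ^ d) t)"
proof (rule ideal.descend_to_quotient[OF ideal_A])
  interpret cp: ring_hom_cring P P "cpow (p ^ d)"
    by (intro ring_hom_cring.intro ring_hom_cring_axioms.intro P.is_cring cpow_hom)
  fix t u assume t: "t \<in> carrier P" and u: "u \<in> carrier P" and eq: "class_A t = class_A u"
  define v where "v = t \<ominus>\<^bsub>P\<^esub> u"
  have v: "v \<in> carrier P" "t = v \<oplus>\<^bsub>P\<^esub> u" using t u by (simp_all add: v_def P.minus_eq P.a_assoc P.l_neg)
  have "class_A t = class_A v \<oplus>\<^bsub>A\<^esub> class_A u" unfolding v(2) using v(1) u by simp
  then have "class_A v = \<zero>\<^bsub>A\<^esub>" using eq v u by simp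
  then have "v \<in> PIdl\<^bsub>P\<^esub> h" using class_A_zero v by blast
  then obtain w where w: "w \<in> carrier P" "v = w \<otimes>\<^bsub>P\<^esub> h" by (auto simp: cgenideal_def)
  have "cpow (p ^ d) v = cpow (p ^ d) w \<otimes>\<^bsub>P\<^esub> cpow (p ^ d) h"
    unfolding w(2) by (rule cp.hom_mult[OF w(1) h_closed])
  then have "cpow (p ^ d) v \<in> PIdl\<^bsub>P\<^esub> g"
    using ideal.I_l_closed[OF ideal_B cpow_h cpow_closed[OF w(1)]] by simp
  then have "class_B (cpow (p ^ d) v) = \<zero>\<^bsub>B\<^esub>" using class_B_zero v(1) by simp
  moreover have "cpow (p ^ d) t = cpow (p ^ d) v \<oplus>\<^bsub>P\<^esub> cpow (p ^ d) u"
    unfolding v(2) by (rule cp.hom_add[OF v(1) u])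
  ultimately show "class_B (cpow (p ^ d) t) = class_B (cpow (p ^ d) u)"
    using v(1) u by simp
qed

text \<open>
  The homomorphism that makes \<open>B\<close> the \<open>A\<close>-module to which all pushforwards with \<open>e \<ge> d\<close> reduce.
\<close>

definition twist where
  "twist = (SOME \<phi>. \<forall>t\<in>carrier P. \<phi> (class_A t) = class_B (cpow (p ^ d) t))"

lemma twist_class: "t \<in> carrier P \<Longrightarrow> twist (class_A t) = class_B (cpow (p ^ d) t)"
  using someI_ex[OF ex_twist] unfolding twist_def by blast

lemma twist_hom: "ring_hom_cring A B twist"
proof (intro ring_hom_cring.intro ring_hom_cring_axioms.intro A.is_cring B.is_cring ring_hom_memI)
  interpret cp: ring_hom_cring P P "cpow (p ^ d)"
    by (intro ring_hom_cring.intro ring_hom_cring_axioms.intro P.is_cring cpow_hom)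
  fix x y assume "x \<in> carrier A" "y \<in> carrier A"
  then obtain t u where t: "t \<in> carrier P" "x = class_A t" and u: "u \<in> carrier P" "y = class_A u"
    by (elim class_A_cases)
  show "twist x \<in> carrier B" using t by (simp add: twist_class)
  have "class_A (t \<otimes>\<^bsub>P\<^esub> u) = x \<otimes>\<^bsub>A\<^esub> y" "class_A (t \<oplus>\<^bsub>P\<^esub> u) = x \<oplus>\<^bsub>A\<^esub> y" using t u by simp_all
  then show "twist (x \<otimes>\<^bsub>A\<^esub> y) = twist x \<otimes>\<^bsub>B\<^esub> twist y" "twist (x \<oplus>\<^bsub>A\<^esub> y) = twist x \<oplus>\<^bsub>B\<^esub> twist y"
    using twist_class[OF P.m_closed[OF t(1) u(1)]] twist_class[OF P.a_closed[OF t(1) u(1)]] t u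
    by (simp_all add: twist_class)
next
  interpret cp: ring_hom_cring P P "cpow (p ^ d)"
    by (intro ring_hom_cring.intro ring_hom_cring_axioms.intro P.is_cring cpow_hom)
  show "twist \<one>\<^bsub>A\<^esub> = \<one>\<^bsub>B\<^esub>"
    using twist_class[OF P.one_closed]
    by (simp only: cp.hom_one class_A_one class_B_one)
qed

lemma finitely_generated_twist:
  assumes "frobenius_basis R (p ^ d) I b \<kappa>"
  shows "finitely_generated_module A (restrict_scalars twist B)"
proof -
  interpret F: univariate_frobenius R P p d I b \<kappa>
    by (intro univariate_frobenius.intro univariate_char_p_axioms assms) (rule P_def)
  interpret M: module A "restrict_scalars twist B"
    by (rule module_restrict_scalars[OF twist_hom])
  show ?thesis
  proof (rule M.finitely_generated_by_family[of I "\<lambda>i. class_B (const (b i))"])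
    fix x assume "x \<in> carrier (restrict_scalars twist B)"
    then have "x \<in> carrier B" by simp
    then obtain t where t: "t \<in> carrier P" "x = class_B t" by (elim class_B_cases)
    have "x = class_B (\<Oplus>\<^bsub>P\<^esub>i\<in>I. cpow (p ^ d) (F.kap i t) \<otimes>\<^bsub>P\<^esub> const (b i))"
      using F.kap_expansion[OF t(1)] t(2) by simp
    also have "\<dots> = (\<Oplus>\<^bsub>B\<^esub>i\<in>I. class_B (cpow (p ^ d) (F.kap i t) \<otimes>\<^bsub>P\<^esub> const (b i)))"
      using t(1) by (intro class_B_finsum) auto
    also have "\<dots> = (\<Oplus>\<^bsub>B\<^esub>i\<in>I. twist (class_A (F.kap i t)) \<otimes>\<^bsub>B\<^esub> class_B (const (b i)))"
      using t(1) by (intro B.finsum_cong') (auto simp: twist_class)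
    finally have "x = (\<Oplus>\<^bsub>restrict_scalars twist B\<^esub>i\<in>I.
        class_A (F.kap i t) \<odot>\<^bsub>restrict_scalars twist B\<^esub> class_B (const (b i)))"
      by simp
    moreover have "(\<lambda>i. class_A (F.kap i t)) \<in> I \<rightarrow> carrier A" using t(1) by simp
    ultimately show "\<exists>a\<in>I \<rightarrow> carrier A. x = (\<Oplus>\<^bsub>restrict_scalars twist B\<^esub>i\<in>I.
        a i \<odot>\<^bsub>restrict_scalars twist B\<^esub> class_B (const (b i)))"
      by (rule bexI)
  qed auto
qed

lemma finitely_generated_pushforward:
  assumes "frobenius_basis R (p ^ e) I b \<kappa>"
  shows "finitely_generated_module A (frobenius_pushforward p e A (regular_module A))"
proof -
  interpret F: univariate_frobenius R P p e I b \<kappa>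
    by (intro univariate_frobenius.intro univariate_char_p_axioms assms) (rule P_def)
  interpret C: char_p_ring A p by (rule char_p_A)
  interpret FB: frobenius_basis P "p ^ e" "I \<times> {..<p ^ e}"
    "\<lambda>z. const (b (fst z)) \<otimes>\<^bsub>P\<^esub> Y [^]\<^bsub>P\<^esub> snd z" "\<lambda>z t. F.kap (fst z) (decim (p ^ e) (snd z) t)"
    by (rule F.frobenius_basis_series)
  let ?M = "restrict_scalars (\<lambda>a. a [^]\<^bsub>A\<^esub> (p ^ e)) A"
  let ?I = "I \<times> {..<p ^ e}"
  let ?b = "\<lambda>z. const (b (fst z)) \<otimes>\<^bsub>P\<^esub> Y [^]\<^bsub>P\<^esub> snd z"
  let ?\<kappa> = "\<lambda>z t. F.kap (fst z) (decim (p ^ e) (snd z) t)"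
  interpret M: module A ?M
    by (rule module_restrict_scalars[OF C.frobenius_ring_hom_cring])
  show ?thesis unfolding frobenius_pushforward_eq
  proof (rule M.finitely_generated_by_family[of ?I "\<lambda>z. class_A (?b z)"])
    fix x assume "x \<in> carrier ?M"
    then have "x \<in> carrier A" by simp
    then obtain t where t: "t \<in> carrier P" "x = class_A t" by (elim class_A_cases)
    have "x = class_A (\<Oplus>\<^bsub>P\<^esub>z\<in>?I. ?\<kappa> z t [^]\<^bsub>P\<^esub> (p ^ e) \<otimes>\<^bsub>P\<^esub> ?b z)"
      using FB.expansion[OF t(1)] t(2) by simp
    also have "\<dots> = (\<Oplus>\<^bsub>A\<^esub>z\<in>?I. class_A (?\<kappa> z t [^]\<^bsub>P\<^esub> (p ^ e) \<otimes>\<^bsub>P\<^esub> ?b z))"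
      using t(1) by (intro class_A_finsum) auto
    also have "\<dots> = (\<Oplus>\<^bsub>A\<^esub>z\<in>?I. class_A (?\<kappa> z t) [^]\<^bsub>A\<^esub> (p ^ e) \<otimes>\<^bsub>A\<^esub> class_A (?b z))"
      using t(1) by (intro A.finsum_cong') (auto simp: class_A_pow)
    finally have "x = (\<Oplus>\<^bsub>?M\<^esub>z\<in>?I. class_A (?\<kappa> z t) \<odot>\<^bsub>?M\<^esub> class_A (?b z))"
      by simp
    moreover have "(\<lambda>z. class_A (?\<kappa> z t)) \<in> ?I \<rightarrow> carrier A" using t(1) by auto
    ultimately show "\<exists>a\<in>?I \<rightarrow> carrier A. x = (\<Oplus>\<^bsub>?M\<^esub>z\<in>?I. a z \<odot>\<^bsub>?M\<^esub> class_A (?b z))"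
      by (rule bexI)
  qed auto
qed

text \<open>
  Decimation by \<open>q\<close> splits \<open>A\<close> into \<open>q\<close> copies of \<open>B\<close>, and the coordinates of each copy with respect to
  \<open>b\<close> give the isomorphism. It is linear because \<open>a\<^bsup>qL\<^esup>\<close>, with \<open>L = p\<^sup>j\<close>, is the coefficientwise \<open>L\<close>-th
  power of the coefficientwise \<open>q\<close>-th power of \<open>a\<close>, evaluated at \<open>Y\<^bsup>qL\<^esup>\<close>: decimation absorbs the
  exponent \<open>q\<close>, and the coordinates turn the rest into multiplication by \<open>twist a\<close>.
\<close>

lemma pushforward_coordinates:
  assumes "frobenius_basis R (p ^ j) I b \<kappa>"
  shows "\<exists>H. bij_betw H (carrier A) (\<Pi>\<^sub>E z\<in>I \<times> {..<p ^ d}. carrier B) \<and>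
    (\<forall>x\<in>carrier A. \<forall>y\<in>carrier A. \<forall>z\<in>I \<times> {..<p ^ d}. H (x \<oplus>\<^bsub>A\<^esub> y) z = H x z \<oplus>\<^bsub>B\<^esub> H y z) \<and>
    (\<forall>a\<in>carrier A. \<forall>x\<in>carrier A. \<forall>z\<in>I \<times> {..<p ^ d}.
      H (a [^]\<^bsub>A\<^esub> (p ^ (d + j)) \<otimes>\<^bsub>A\<^esub> x) z = twist a \<otimes>\<^bsub>B\<^esub> H x z)"
proof -
  interpret F: univariate_frobenius R P p j I b \<kappa>
    by (intro univariate_frobenius.intro univariate_char_p_axioms assms) (rule P_def)
  define q where "q = p ^ d"
  define Z where "Z = I \<times> {..<q}"
  have q: "q > 0" unfolding q_def by (rule q_pos)
  \<comment> \<open>the coordinate map before passing to the quotient \<open>A\<close>; its kernel is the ideal of \<open>h\<close>\<close>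
  define G where "G t = (\<lambda>z\<in>Z. class_B (F.root_coord c (fst z) (decim q (snd z) t)))" for t
  have Gz: "G t z = class_B (F.root_coord c (fst z) (decim q (snd z) t))" if "z \<in> Z" for t z
    using that by (simp add: G_def)
  have Gc: "G t z \<in> carrier B" if "t \<in> carrier P" "z \<in> Z" for t z
    using that by (auto simp: Gz Z_def)
  have Gadd: "G (t \<oplus>\<^bsub>P\<^esub> u) z = G t z \<oplus>\<^bsub>B\<^esub> G u z" if "t \<in> carrier P" "u \<in> carrier P" "z \<in> Z" for t u z
    using that by (auto simp: Gz Z_def decim_add F.root_coord_add)
  have Gzero: "(\<forall>z\<in>Z. G t z = \<zero>\<^bsub>B\<^esub>) \<longleftrightarrow> t \<in> PIdl\<^bsub>P\<^esub> h" if t: "t \<in> carrier P" for t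
  proof -
    have "(\<forall>z\<in>Z. G t z = \<zero>\<^bsub>B\<^esub>)
        \<longleftrightarrow> (\<forall>k<q. \<forall>i\<in>I. F.root_coord c i (decim q k t) \<in> PIdl\<^bsub>P\<^esub> g)"
    proof -
      have "G t (i, k) = \<zero>\<^bsub>B\<^esub> \<longleftrightarrow> F.root_coord c i (decim q k t) \<in> PIdl\<^bsub>P\<^esub> g" if "i \<in> I" "k < q" for i k
        using that t by (subst Gz) (auto simp: Z_def class_B_zero)
      then show ?thesis unfolding Z_def by auto
    qed
    also have "\<dots> \<longleftrightarrow> (\<forall>k<q. decim q k t \<in> PIdl\<^bsub>P\<^esub> g)"
      using t by (simp add: F.linear_factor_dvd_iff)
    also have "\<dots> \<longleftrightarrow> t \<in> PIdl\<^bsub>P\<^esub> h"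
    proof
      assume D: "\<forall>k<q. decim q k t \<in> PIdl\<^bsub>P\<^esub> g"
      have "stretch q (decim q k t) \<otimes>\<^bsub>P\<^esub> Y [^]\<^bsub>P\<^esub> k \<in> PIdl\<^bsub>P\<^esub> h" if k: "k < q" for k
      proof -
        obtain w where w: "w \<in> carrier P" "decim q k t = w \<otimes>\<^bsub>P\<^esub> g"
          using D k by (auto simp: cgenideal_def)
        have "stretch q (decim q k t) = stretch q w \<otimes>\<^bsub>P\<^esub> h"
          unfolding w(2) stretch_mult[OF q w(1) g_closed] by (simp only: q_def)
        moreover have "h \<in> PIdl\<^bsub>P\<^esub> h" by (rule P.cgenideal_self[OF h_closed])
        ultimately show ?thesis
          using w by (simp add: ideal.I_l_closed[OF ideal_A] ideal.I_r_closed[OF ideal_A])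
      qed
      then have "(\<Oplus>\<^bsub>P\<^esub>k\<in>{..<q}. stretch q (decim q k t) \<otimes>\<^bsub>P\<^esub> Y [^]\<^bsub>P\<^esub> k) \<in> PIdl\<^bsub>P\<^esub> h"
        by (intro ideal.finsum_in_ideal[OF ideal_A]) simp
      then show "t \<in> PIdl\<^bsub>P\<^esub> h" using decim_expansion[OF q t] by simp
    next
      assume "t \<in> PIdl\<^bsub>P\<^esub> h"
      then obtain w where w: "w \<in> carrier P" "t = w \<otimes>\<^bsub>P\<^esub> h" by (auto simp: cgenideal_def)
      have "t = stretch q g \<otimes>\<^bsub>P\<^esub> w" unfolding w(2) q_def using w(1) by (intro P.m_comm) auto
      then have D: "decim q k t = g \<otimes>\<^bsub>P\<^esub> decim q k w" if "k < q" for k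
        using decim_stretch_mult[OF q that g_closed w(1)] by simp
      show "\<forall>k<q. decim q k t \<in> PIdl\<^bsub>P\<^esub> g"
      proof (intro allI impI)
        fix k assume "k < q"
        then show "decim q k t \<in> PIdl\<^bsub>P\<^esub> g"
          using ideal.I_r_closed[OF ideal_B P.cgenideal_self[OF g_closed] decim_closed[OF w(1)]]
          by (simp only: D)
      qed
    qed
    finally show ?thesis .
  qed
  have Gdiff: "G t = G u \<longleftrightarrow> class_A t = class_A u" if t: "t \<in> carrier P" and u: "u \<in> carrier P" for t u
  proof -
    define v where "v = t \<ominus>\<^bsub>P\<^esub> u"
    have v: "v \<in> carrier P" "t = v \<oplus>\<^bsub>P\<^esub> u"
      using t u by (simp_all add: v_def P.minus_eq P.a_assoc P.l_neg)
    have "class_A t = class_A u \<longleftrightarrow> class_A v = \<zero>\<^bsub>A\<^esub>"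
      unfolding v(2) using v(1) u by simp
    also have "\<dots> \<longleftrightarrow> (\<forall>z\<in>Z. G v z = \<zero>\<^bsub>B\<^esub>)"
      using class_A_zero[OF v(1)] Gzero[OF v(1)] by simp
    also have "\<dots> \<longleftrightarrow> (\<forall>z\<in>Z. G t z = G u z)"
      unfolding v(2) using v(1) u Gc by (simp add: Gadd)
    also have "\<dots> \<longleftrightarrow> G t = G u"
      by (auto simp: G_def restrict_def fun_eq_iff)
    finally show ?thesis by simp
  qed
  have Gsurj: "\<exists>t\<in>carrier P. G t = y" if y: "y \<in> (\<Pi>\<^sub>E z\<in>Z. carrier B)" for y
  proof -
    have "\<exists>w. w \<in> carrier P \<and> y z = class_B w" if "z \<in> Z" for z
    proof -
      have "y z \<in> carrier B" using y that by auto
      then show ?thesis by (elim class_B_cases) blast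
    qed
    then obtain w where w: "\<And>z. z \<in> Z \<Longrightarrow> w z \<in> carrier P \<and> y z = class_B (w z)" by metis
    have "\<exists>s\<in>carrier P. \<forall>i\<in>I. F.root_coord c i s = w (i, k)" if "k < q" for k
      by (rule F.root_coord_surj) (use w that in \<open>auto simp: Z_def\<close>)
    then obtain s where s: "\<And>k. k < q \<Longrightarrow> s k \<in> carrier P \<and> (\<forall>i\<in>I. F.root_coord c i (s k) = w (i, k))"
      by metis
    define t where "t = (\<Oplus>\<^bsub>P\<^esub>k\<in>{..<q}. stretch q (s k) \<otimes>\<^bsub>P\<^esub> Y [^]\<^bsub>P\<^esub> k)"
    have t: "t \<in> carrier P" unfolding t_def using s by (intro P.finsum_closed) auto
    have "G t = y"
    proof
      fix z
      show "G t z = y z"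
      proof (cases "z \<in> Z")
        case True
        then have z: "fst z \<in> I" "snd z < q" by (auto simp: Z_def)
        have "decim q (snd z) t = s (snd z)"
          unfolding t_def using z s by (intro decim_sum_Y_pow) auto
        then show ?thesis using s[OF z(2)] z(1) w[OF True] by (simp add: Gz[OF True])
      next
        case False
        then have "y z = undefined" by (rule PiE_arb[OF y])
        then show ?thesis using False by (simp add: G_def)
      qed
    qed
    then show ?thesis using t by blast
  qed
  have Gmult: "G (a [^]\<^bsub>P\<^esub> (p ^ (d + j)) \<otimes>\<^bsub>P\<^esub> t) z = class_B (cpow q a) \<otimes>\<^bsub>B\<^esub> G t z"
    if a: "a \<in> carrier P" and t: "t \<in> carrier P" and z: "z \<in> Z" for a t z
  proof -
    have z': "fst z \<in> I" "snd z < q" using z by (auto simp: Z_def)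
    have "a [^]\<^bsub>P\<^esub> (p ^ (d + j)) = stretch (p ^ (d + j)) (cpow (p ^ (d + j)) a)"
      by (rule pow_q_series[OF a])
    also have "\<dots> = stretch q (stretch (p ^ j) (cpow (p ^ j) (cpow q a)))"
      using cpow_cpow[OF a, of "p ^ j" q] stretch_stretch[OF q q_pos[of j]]
      by (simp add: q_def power_add)
    finally have "decim q (snd z) (a [^]\<^bsub>P\<^esub> (p ^ (d + j)) \<otimes>\<^bsub>P\<^esub> t)
        = stretch (p ^ j) (cpow (p ^ j) (cpow q a)) \<otimes>\<^bsub>P\<^esub> decim q (snd z) t"
      using decim_stretch_mult[OF q z'(2) _ t] a by simp
    then show ?thesis
      using a t z' by (simp add: Gz[OF z] F.root_coord_mult)
  qed
  have "\<exists>H. \<forall>t\<in>carrier P. H (class_A t) = G t"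
    by (rule ideal.descend_to_quotient[OF ideal_A]) (simp add: Gdiff)
  then obtain H where H: "\<And>t. t \<in> carrier P \<Longrightarrow> H (class_A t) = G t" by blast
  have "bij_betw H (carrier A) (\<Pi>\<^sub>E z\<in>Z. carrier B)"
  proof (intro bij_betw_imageI inj_onI)
    fix x y assume "x \<in> carrier A" "y \<in> carrier A" and eq: "H x = H y"
    then obtain t u where "t \<in> carrier P" "x = class_A t" "u \<in> carrier P" "y = class_A u"
      by (elim class_A_cases)
    then show "x = y" using eq by (simp add: H Gdiff)
  next
    have "H x \<in> (\<Pi>\<^sub>E z\<in>Z. carrier B)" if x: "x \<in> carrier A" for x
    proof -
      obtain t where t: "t \<in> carrier P" "x = class_A t" using x by (rule class_A_cases)
      have "G t \<in> extensional Z" by (simp add: G_def)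
      then show ?thesis using t Gc by (simp add: H PiE_def)
    qed
    moreover have "y \<in> H ` carrier A" if y: "y \<in> (\<Pi>\<^sub>E z\<in>Z. carrier B)" for y
    proof -
      obtain t where "t \<in> carrier P" "G t = y" using Gsurj[OF y] by (elim bexE)
      then show ?thesis by (intro image_eqI[where x = "class_A t"]) (simp_all add: H)
    qed
    ultimately show "H ` carrier A = (\<Pi>\<^sub>E z\<in>Z. carrier B)" by (intro equalityI subsetI) (elim imageE, simp_all)
  qed
  moreover have "H (x \<oplus>\<^bsub>A\<^esub> y) z = H x z \<oplus>\<^bsub>B\<^esub> H y z"
    if x: "x \<in> carrier A" and y: "y \<in> carrier A" and z: "z \<in> Z" for x y z
  proof -
    obtain t where t: "t \<in> carrier P" "x = class_A t" using x by (rule class_A_cases)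
    obtain u where u: "u \<in> carrier P" "y = class_A u" using y by (rule class_A_cases)
    have "x \<oplus>\<^bsub>A\<^esub> y = class_A (t \<oplus>\<^bsub>P\<^esub> u)" using t u by simp
    then have "H (x \<oplus>\<^bsub>A\<^esub> y) = G (t \<oplus>\<^bsub>P\<^esub> u)" using t u by (simp only: H P.a_closed)
    then show ?thesis using t u z by (simp add: Gadd H)
  qed
  moreover have "H (a [^]\<^bsub>A\<^esub> (p ^ (d + j)) \<otimes>\<^bsub>A\<^esub> x) z = twist a \<otimes>\<^bsub>B\<^esub> H x z"
    if a: "a \<in> carrier A" and x: "x \<in> carrier A" and z: "z \<in> Z" for a x z
  proof -
    obtain t where t: "t \<in> carrier P" "x = class_A t" using x by (rule class_A_cases)
    obtain s where s: "s \<in> carrier P" "a = class_A s" using a by (rule class_A_cases)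
    have "a [^]\<^bsub>A\<^esub> (p ^ (d + j)) \<otimes>\<^bsub>A\<^esub> x = class_A (s [^]\<^bsub>P\<^esub> (p ^ (d + j)) \<otimes>\<^bsub>P\<^esub> t)"
      using s t by (simp add: class_A_pow)
    then have "H (a [^]\<^bsub>A\<^esub> (p ^ (d + j)) \<otimes>\<^bsub>A\<^esub> x) = G (s [^]\<^bsub>P\<^esub> (p ^ (d + j)) \<otimes>\<^bsub>P\<^esub> t)"
      using s t by (simp only: H P.m_closed P.nat_pow_closed)
    then show ?thesis using s t z by (simp add: Gmult H twist_class q_def)
  qed
  ultimately show ?thesis unfolding Z_def q_def by blast
qed

text \<open>
  The module at index \<open>0\<close> is \<open>B\<close> through \<open>twist\<close>, which serves all \<open>e \<ge> d\<close>; the module at an index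
  \<open>0 < e < d\<close> is the pushforward \<open>F\<^sup>e\<^sub>*(A)\<close> itself.
\<close>

theorem hypersurface_FFRT:
  assumes R: "noetherian_ring R" and FB: "has_frobenius_basis R p" and d: "d > 0"
  shows "has_FFRT p A"
proof -
  have basis: "\<exists>(I :: nat set) b \<kappa>. frobenius_basis R (p ^ e) I b \<kappa>" for e
    using has_frobenius_basis_power[OF FB] by (simp add: has_frobenius_basis_def)
  let ?F = "\<lambda>e. frobenius_pushforward p e A (regular_module A)"
  let ?N = "restrict_scalars twist B"
  define M0 where "M0 j = (if j = 0 then ?N else ?F j)" for j
  have fg: "finitely_generated_module A (M0 j)" for j
  proof (cases "j = 0")
    case True
    obtain I :: "nat set" and b \<kappa> where "frobenius_basis R (p ^ d) I b \<kappa>" using basis by blast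
    then have "finitely_generated_module A ?N" by (rule finitely_generated_twist)
    then show ?thesis using True by (simp add: M0_def)
  next
    case False
    obtain I :: "nat set" and b \<kappa> where "frobenius_basis R (p ^ j) I b \<kappa>" using basis by blast
    then have "finitely_generated_module A (?F j)" by (rule finitely_generated_pushforward)
    then show ?thesis using False by (simp add: M0_def)
  qed
  define M where "M j = (SOME M' :: ((unit multiset \<Rightarrow> 'a) set, (nat \<Rightarrow> (unit multiset \<Rightarrow> 'a) set) set) module.
    finitely_generated_module A M' \<and> module_isomorphic A (M0 j) M')" for j
  have M: "finitely_generated_module A (M j) \<and> module_isomorphic A (M0 j) (M j)" for j
    unfolding M_def by (rule someI_ex[OF finitely_generated_module_representative[OF fg]])
  have iso: "\<exists>t :: nat \<Rightarrow> nat. module_isomorphic A (?F e)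
      (direct_sum_module (SIGMA j:{..<d}. {..<t j}) (\<lambda>(j, i). M j))" if e: "e > 0" for e
  proof (cases "e < d")
    case True
    have "module_isomorphic A (?F e) (M e)" using M[of e] e by (simp add: M0_def)
    then show ?thesis
    proof (rule module_isomorphic_copies[where I = "{()}" and H = "\<lambda>x. \<lambda>_\<in>{()}. x", OF _ True])
      show "bij_betw (\<lambda>x. \<lambda>_\<in>{()}. x) (carrier (?F e)) (\<Pi>\<^sub>E i\<in>{()}. carrier (?F e))"
      proof (rule bij_betw_byWitness[where f' = "\<lambda>v. v ()"])
        show "\<forall>v\<in>\<Pi>\<^sub>E i\<in>{()}. carrier (?F e). (\<lambda>_\<in>{()}. v ()) = v"
          by (auto simp: fun_eq_iff)
      qed auto
    qed auto
  next
    case False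
    then obtain j where j: "e = d + j" using le_Suc_ex not_less by blast
    obtain I :: "nat set" and b \<kappa> where FBj: "frobenius_basis R (p ^ j) I b \<kappa>" using basis by blast
    have I: "finite I" using FBj by (rule frobenius_basis.finite_index)
    obtain H where H: "bij_betw H (carrier A) (\<Pi>\<^sub>E z\<in>I \<times> {..<p ^ d}. carrier B)"
      and add: "\<And>x y z. x \<in> carrier A \<Longrightarrow> y \<in> carrier A \<Longrightarrow> z \<in> I \<times> {..<p ^ d} \<Longrightarrow>
        H (x \<oplus>\<^bsub>A\<^esub> y) z = H x z \<oplus>\<^bsub>B\<^esub> H y z"
      and mult: "\<And>a x z. a \<in> carrier A \<Longrightarrow> x \<in> carrier A \<Longrightarrow> z \<in> I \<times> {..<p ^ d} \<Longrightarrow>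
        H (a [^]\<^bsub>A\<^esub> (p ^ (d + j)) \<otimes>\<^bsub>A\<^esub> x) z = twist a \<otimes>\<^bsub>B\<^esub> H x z"
      using pushforward_coordinates[OF FBj] by blast
    have "module_isomorphic A ?N (M 0)" using M[of 0] by (simp add: M0_def)
    then show ?thesis unfolding frobenius_pushforward_eq
    proof (rule module_isomorphic_copies[where I = "I \<times> {..<p ^ d}" and H = H, OF _ d])
      show "finite (I \<times> {..<p ^ d})" using I by simp
    qed (simp_all add: H add mult j)
  qed
  have "Factorial_Ring.prime p" "cring A" "noetherian_ring A"
    "has_characteristic A p \<or> carrier A = {\<zero>\<^bsub>A\<^esub>}"
    by (rule prime_p A.is_cring noetherian_A[OF R] char_p_ring_cases[OF char_p_A])+
  then show ?thesis unfolding has_FFRT_def using M iso by (intro conjI exI[of _ d] exI[of _ M]) auto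
qed

end

theorem theorem5p16:
  fixes K :: "('k, 'z) ring_scheme"
    and p n d :: nat
    and f :: "nat multiset \<Rightarrow> 'k"
  defines "S \<equiv> power_series_ring K {1..n}"
  defines "T \<equiv> power_series_ring S {()}"
  assumes "Factorial_Ring.prime p"
    and "field K"
    and "has_characteristic K p"
    and "ring.finite_dimension K ((\<lambda>a. a [^]\<^bsub>K\<^esub> p) ` carrier K) (carrier K)"
    and "d > 0"
    and "f \<in> carrier S"
  shows "has_FFRT p (T Quot (PIdl\<^bsub>T\<^esub> (ps_var S () [^]\<^bsub>T\<^esub> (p ^ d) \<oplus>\<^bsub>T\<^esub> ps_const S f)))"
proof -
  have S: "frobenius_noetherian p S"
    unfolding S_def using assms(3-6)
    by (intro frobenius_noetherian_power_series frobenius_noetherian_field) auto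
  then interpret S: char_p_ring S p by (simp add: frobenius_noetherian_def)
  interpret hypersurface S T p d "\<ominus>\<^bsub>S\<^esub> f"
    unfolding T_def
    by (intro hypersurface.intro univariate_char_p.intro univariate_series.intro
        hypersurface_axioms.intro S.is_cring S.char_p_ring_axioms S.a_inv_closed assms(8))
  have "const (\<ominus>\<^bsub>S\<^esub> f) = \<ominus>\<^bsub>T\<^esub> const f" by (rule const.hom_a_inv[OF assms(8)])
  then have "h = ps_var S () [^]\<^bsub>T\<^esub> (p ^ d) \<oplus>\<^bsub>T\<^esub> ps_const S f"
    unfolding h_eq using assms(8) by (simp add: P.minus_eq)
  moreover have "has_FFRT p A"
    using S assms(7) by (intro hypersurface_FFRT) (auto simp: frobenius_noetherian_def)
  ultimately show ?thesis by (simp only:)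
qed

end
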